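(* Let $k\ge 1$, let $G$ be a graph in $\mathcal{C}(n,k)\setminus\{\mathcal{C}_{1}(n,k)\}$, and let $|E(G)|=m$ with $m>15$ and $m>4k$. Then $$Sz^{\ast}_{e}(G) \geq \begin{cases} \dfrac{2m^{2}+3m+4k(6m-15)-8}{4}, & m\geq 20,\\[2mm] \dfrac{3m^{2}-19m+4k(6m-15)+45}{4}, & 15<m\leq 19,\end{cases}$$ with equality if and only if $G\cong G^{\ast}_{1}$ when $m\geq 20$, and if and only if $G\cong G(3,\underbrace{4,\ldots,4}_{k-1})$ when $15<m\leq 19$.
   Context: All graphs are finite, undirected, simple and connected. For an edge $e=uv$ of $G$ and a vertex $w$, the distance between $e$ and $w$ is $d_G(e,w)=\min\{d_G(u,w),d_G(v,w)\}$. For $e=uv\in E(G)$, let $m_u(e|G)$ (resp. $m_v(e|G)$) be the number of edges of $G$ whose distance to $u$ is smaller than their distance to $v$ (resp. whose distance to $v$ is smaller than their distance to $u$), and let $m_0(e|G)$ be the number of edges of $G$ equidistant from $u$ and $v$ (this includes $e$ itself). The edge revised Szeged index of $G$ is $$Sz^{\ast}_{e}(G)=\sum_{e=uv\in E(G)}\Big(m_u(e|G)+\frac{m_0(e|G)}{2}\Big)\Big(m_v(e|G)+\frac{m_0(e|G)}{2}\Big).$$ A cactus is a connected graph in which every block is either a cut edge or a cycle (equivalently, any two cycles have at most one common vertex). $\mathcal{C}(n,k)$ is the class of all cacti with $n$ vertices and exactly $k$ cycles (graphs considered up to isomorphism). For integers $m_1,\ldots,m_k\ge 3$, $G(m_1,\ldots,m_k)\in\mathcal{C}(n,k)$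 denotes the cactus consisting of $k$ cycles of lengths $m_1,\ldots,m_k$ all having exactly one common vertex, with $n+k-1-\sum_{i=1}^k m_i$ pendant vertices attached to that common vertex. $\mathcal{C}_1(n,k)=G(4,\ldots,4)$ is the cactus of order $n$ consisting of $k$ quadrangles (4-cycles) sharing exactly one common vertex, with $n-3k-1$ pendant edges attached at that common vertex. $G^{\ast}_1$ is the graph of order $n$ obtained from $\mathcal{C}_1(n-1,k)$ by adding a pendant edge at a pendant vertex of $\mathcal{C}_1(n-1,k)$ (when $\mathcal{C}_1(n-1,k)$ has a pendant vertex; otherwise no graph is $G_1^\ast$). *)

theory Defs
  imports Complex_Main
begin

section \<open>Finite simple graphs\<close>

text \<open>Edges are two-element sets of vertices.\<close>

datatype 'a sgraph = Graph (verts: "'a set") (edges: "'a set set")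

definition simple_graph :: "'a sgraph \<Rightarrow> bool" where
  "simple_graph G \<longleftrightarrow> finite (verts G) \<and> (\<forall>e\<in>edges G. e \<subseteq> verts G \<and> card e = 2)"

definition adj :: "'a sgraph \<Rightarrow> ('a \<times> 'a) set" where
  "adj G = {(u, v). {u, v} \<in> edges G}"

definition connected_graph :: "'a sgraph \<Rightarrow> bool" where
  "connected_graph G \<longleftrightarrow>
     verts G \<noteq> {} \<and> (\<forall>u\<in>verts G. \<forall>v\<in>verts G. (u, v) \<in> (adj G)\<^sup>*)"

definition graph_iso :: "'a sgraph \<Rightarrow> 'b sgraph \<Rightarrow> bool" where
  "graph_iso G H \<longleftrightarrow>
     (\<exists>f. bij_betw f (verts G) (verts H) \<and> (\<lambda>e. f ` e) ` edges G = edges H)"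

definition subgraph :: "'a sgraph \<Rightarrow> 'a sgraph \<Rightarrow> bool" where
  "subgraph H G \<longleftrightarrow> simple_graph H \<and> verts H \<subseteq> verts G \<and> edges H \<subseteq> edges G"

definition delete_vertex :: "'a sgraph \<Rightarrow> 'a \<Rightarrow> 'a sgraph" where
  "delete_vertex G v = Graph (verts G - {v}) {e \<in> edges G. v \<notin> e}"

definition delete_edge :: "'a sgraph \<Rightarrow> 'a set \<Rightarrow> 'a sgraph" where
  "delete_edge G e = Graph (verts G) (edges G - {e})"

definition pendant_vertex :: "'a sgraph \<Rightarrow> 'a \<Rightarrow> bool" where
  "pendant_vertex G v \<longleftrightarrow> v \<in> verts G \<and> card {e \<in> edges G. v \<in> e} = 1"

section \<open>The edge revised Szeged index\<close>

text \<open>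
  The distance in a connected graph is the least length of a walk; \<open>adj G ^^ l\<close> relates the
  ends of walks of length \<open>l\<close>. Its value on vertices in different components is irrelevant here.
\<close>

definition vdist :: "'a sgraph \<Rightarrow> 'a \<Rightarrow> 'a \<Rightarrow> nat" where
  "vdist G u v = (LEAST l. (u, v) \<in> adj G ^^ l)"

definition edist :: "'a sgraph \<Rightarrow> 'a set \<Rightarrow> 'a \<Rightarrow> nat" where
  "edist G e w = Min ((\<lambda>u. vdist G u w) ` e)"

text \<open>For an edge \<open>e = uv\<close>, \<open>m_closer G u v\<close> is $m_u(e|G)$ and \<open>m_equal G u v\<close> is $m_0(e|G)$.\<close>

definition m_closer :: "'a sgraph \<Rightarrow> 'a \<Rightarrow> 'a \<Rightarrow> nat" where
  "m_closer G u v = card {f \<in> edges G. edist G f u < edist G f v}"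

definition m_equal :: "'a sgraph \<Rightarrow> 'a \<Rightarrow> 'a \<Rightarrow> nat" where
  "m_equal G u v = card {f \<in> edges G. edist G f u = edist G f v}"

definition Sz_factor :: "'a sgraph \<Rightarrow> 'a \<Rightarrow> 'a \<Rightarrow> real" where
  "Sz_factor G u v = real (m_closer G u v) + real (m_equal G u v) / 2"

text \<open>
  The summand of an edge is symmetric in the two ends, so it does not depend on their order;
  \<open>Sz_term_edge\<close> shows that the description below is well defined.
\<close>

definition Sz_term :: "'a sgraph \<Rightarrow> 'a set \<Rightarrow> real" where
  "Sz_term G e = (THE x. \<exists>u v. e = {u, v} \<and> x = Sz_factor G u v * Sz_factor G v u)"

lemma Sz_term_edge: "Sz_term G {u, v} = Sz_factor G u v * Sz_factor G v u"
  unfolding Sz_term_def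
  by (rule the_equality) (auto simp: doubleton_eq_iff mult.commute)

definition edge_revised_Szeged :: "'a sgraph \<Rightarrow> real" where
  "edge_revised_Szeged G = (\<Sum>e\<in>edges G. Sz_term G e)"

section \<open>Cacti\<close>

text \<open>
  A cycle is identified with its edge set, so that cycles differing only in the starting point or
  the orientation are counted once.
\<close>

definition cycle_edges :: "'a list \<Rightarrow> 'a set set" where
  "cycle_edges vs = {{vs ! i, vs ! (Suc i mod length vs)} | i. i < length vs}"

definition cycles :: "'a sgraph \<Rightarrow> 'a set set set" where
  "cycles G = {cycle_edges vs | vs.
     3 \<le> length vs \<and> distinct vs \<and> set vs \<subseteq> verts G \<and> cycle_edges vs \<subseteq> edges G}"

definition cycle_graph :: "'a sgraph \<Rightarrow> bool" where
  "cycle_graph G \<longleftrightarrow>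
     (\<exists>vs. 3 \<le> length vs \<and> distinct vs \<and> verts G = set vs \<and> edges G = cycle_edges vs)"

definition cut_vertex :: "'a sgraph \<Rightarrow> 'a \<Rightarrow> bool" where
  "cut_vertex G v \<longleftrightarrow> v \<in> verts G \<and>
     (\<exists>x \<in> verts G - {v}. \<exists>y \<in> verts G - {v}. (x, y) \<notin> (adj (delete_vertex G v))\<^sup>*)"

definition cut_edge :: "'a sgraph \<Rightarrow> 'a set \<Rightarrow> bool" where
  "cut_edge G e \<longleftrightarrow> e \<in> edges G \<and> \<not> connected_graph (delete_edge G e)"

definition nonseparable :: "'a sgraph \<Rightarrow> bool" where
  "nonseparable G \<longleftrightarrow> connected_graph G \<and> (\<forall>v. \<not> cut_vertex G v)"

text \<open>A block is a maximal connected subgraph without a cut vertex of its own.\<close>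

definition block :: "'a sgraph \<Rightarrow> 'a sgraph \<Rightarrow> bool" where
  "block G B \<longleftrightarrow> subgraph B G \<and> nonseparable B \<and>
     (\<forall>H. subgraph H G \<and> nonseparable H \<and> subgraph B H \<longrightarrow> H = B)"

definition cactus :: "'a sgraph \<Rightarrow> bool" where
  "cactus G \<longleftrightarrow> simple_graph G \<and> connected_graph G \<and>
     (\<forall>B. block G B \<longrightarrow> (\<exists>e. cut_edge G e \<and> B = Graph e {e}) \<or> cycle_graph B)"

definition cacti :: "nat \<Rightarrow> nat \<Rightarrow> 'a sgraph set" where
  "cacti n k = {G. cactus G \<and> card (verts G) = n \<and> card (cycles G) = k}"

section \<open>The extremal cacti\<close>

text \<open>
  \<open>Hub\<close> is the common vertex, \<open>Rim i j\<close> with \<open>1 \<le> j < ms ! i\<close> are the other vertices of the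
  \<open>i\<close>-th cycle, \<open>Leaf j\<close> are the pendant vertices.
\<close>

datatype bvertex = Hub | Rim nat nat | Leaf nat

definition bouquet :: "nat list \<Rightarrow> nat \<Rightarrow> bvertex sgraph" where
  "bouquet ms p = Graph
     ({Hub} \<union> (\<Union>i<length ms. Rim i ` {1..<ms ! i}) \<union> Leaf ` {..<p})
     ((\<Union>i<length ms. cycle_edges (Hub # map (Rim i) [1..<ms ! i]))
        \<union> (\<lambda>j. {Hub, Leaf j}) ` {..<p})"

text \<open>
  \<open>cycle_bouquet n [m\<^sub>1, \<dots>, m\<^sub>k]\<close> is $G(m_1,\ldots,m_k)$ on \<open>n\<close> vertices. It is meaningful
  only if all \<open>m\<^sub>i \<ge> 3\<close> and the subtraction does not truncate.
\<close>

definition cycle_bouquet :: "nat \<Rightarrow> nat list \<Rightarrow> bvertex sgraph" where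
  "cycle_bouquet n ms = bouquet ms (n + length ms - 1 - sum_list ms)"

definition C1 :: "nat \<Rightarrow> nat \<Rightarrow> bvertex sgraph" where
  "C1 n k = cycle_bouquet n (replicate k 4)"

definition add_pendant :: "'a \<Rightarrow> 'a \<Rightarrow> 'a sgraph \<Rightarrow> 'a sgraph" where
  "add_pendant p w G = Graph (insert w (verts G)) (insert {p, w} (edges G))"

text \<open>
  \<open>is_G1_star n k G\<close> says $G \cong G_1^*$ (of order \<open>n\<close>, with \<open>k\<close> quadrangles). It holds for no
  \<open>G\<close> if \<open>C1 (n - 1) k\<close> has no pendant vertex.
\<close>

definition is_G1_star :: "nat \<Rightarrow> nat \<Rightarrow> 'a sgraph \<Rightarrow> bool" where
  "is_G1_star n k G \<longleftrightarrow> (\<exists>p w. pendant_vertex (C1 (n - 1) k) p \<and> w \<notin> verts (C1 (n - 1) k) \<and>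
     graph_iso G (add_pendant p w (C1 (n - 1) k)))"

end

theory Submission
  imports Defs
begin

text \<open>
  If \<open>m\<close> is the number of edges, then \<open>4\<close> times the summand of an edge \<open>uv\<close> is
  \<open>m\<^sup>2 - (m\<^sub>u - m\<^sub>v)\<^sup>2\<close>, so the index is small when every edge splits the graph as unevenly as
  possible. A pendant edge is as uneven as an edge can be and contributes \<open>2 m - 1\<close>; a quadrangle
  whose other edges all hang at a single vertex contributes \<open>4 (8 m - 16)\<close>. Measuring every bridge
  against a pendant edge, and every cycle of length \<open>l\<close> against such a quadrangle together with
  \<open>l - 4\<close> pendant edges, turns four times the index into a quantity depending on \<open>m\<close> and \<open>k\<close>
  alone plus a sum of local excesses (\<open>Szeged_excess\<close>).

  The excesses can be computed one block at a time. Let \<open>B\<close> be a cycle or a bridge. Deleting the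
  edges of \<open>B\<close> leaves its vertices in different components, hence every other edge hangs at exactly
  one vertex of \<open>B\<close>, its gate, and all distances from it to \<open>B\<close> pass through this gate
  (\<open>gate_vdist\<close>). The edges of \<open>B\<close> itself are balanced by a reflection, so \<open>m\<^sub>u - m\<^sub>v\<close> is determined
  by the numbers of edges hanging at the vertices of \<open>B\<close> (\<open>closer_diff_gate\<close>). This gives:

    \<^item> a bridge with \<open>a\<close> and \<open>b\<close> edges on its two sides has excess \<open>4 a b\<close>, which is \<open>0\<close> if it is
      pendant, \<open>4 (m - 2)\<close> if one side is a single edge, and more otherwise;
    \<^item> a quadrangle has excess \<open>0\<close> if everything else hangs at one of its vertices, and at least
      \<open>8 m - 40\<close> otherwise;
    \<^item> a triangle has excess at least \<open>(m - 3) (m - 15)\<close>, with equality if everything else hangs at one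
      of its vertices;
    \<^item> a longer cycle has excess at least \<open>16 m - 60\<close>.

  For \<open>m > 15\<close> all of these are nonnegative, and the least positive one is \<open>4 (m - 2)\<close> for
  \<open>m \<ge> 20\<close> and \<open>(m - 3) (m - 15)\<close> for \<open>m \<le> 19\<close>. It remains to see which cacti have at most one block
  of positive excess, and this block of the least kind. In such a cactus every block ends soon after
  it begins, and by connectivity all blocks share one vertex (\<open>star_structure\<close>). Such a graph is a
  flower: petals and leaves at one vertex, with possibly one leaf prolonged by a second edge. The
  lengths of the petals and the number of leaves determine it up to isomorphism.
\<close>

section \<open>Cycles given by vertex lists\<close>

lemma cycle_edges_image:
  "cycle_edges vs = (\<lambda>i. {vs ! i, vs ! (Suc i mod length vs)}) ` {..<length vs}"
  unfolding cycle_edges_def by auto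

lemma cycle_edgesI:
  "i < length vs \<Longrightarrow> {vs ! i, vs ! (Suc i mod length vs)} \<in> cycle_edges vs"
  unfolding cycle_edges_def by auto

lemma finite_cycle_edges: "finite (cycle_edges vs)"
  by (simp add: cycle_edges_image)

lemma Suc_mod_less: "i < l \<Longrightarrow> Suc i mod l < (l::nat)"
  by (rule mod_less_divisor) simp

lemma Union_cycle_edges: "\<Union>(cycle_edges vs) = set vs"
proof
  show "\<Union>(cycle_edges vs) \<subseteq> set vs"
    by (auto simp: cycle_edges_image Suc_mod_less)
  show "set vs \<subseteq> \<Union>(cycle_edges vs)"
    by (auto simp: cycle_edges_image in_set_conv_nth)
qed

lemma cycle_edges_map: "(`) f ` cycle_edges vs = cycle_edges (map f vs)"
  unfolding cycle_edges_image image_image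
  by (rule image_cong) (auto simp: Suc_mod_less)

text \<open>
  Going around a cycle: a property that passes from each index to the next one holds at all
  indices as soon as it holds at one.
\<close>

lemma cyclic_induct [consumes 2, case_names start step]:
  fixes l :: nat
  assumes "i < l" "j < l" and "P i" and step: "\<And>t. t < l \<Longrightarrow> P t \<Longrightarrow> P (Suc t mod l)"
  shows "P j"
proof -
  have *: "P ((i + d) mod l)" for d
  proof (induction d)
    case 0
    then show ?case using assms by simp
  next
    case (Suc d)
    have "P (Suc ((i + d) mod l) mod l)"
      using step[of "(i + d) mod l"] Suc assms(1) by auto
    then show ?case by (simp add: mod_Suc_eq)
  qed
  have "(i + (j + l - i)) mod l = j" using assms by simp
  then show ?thesis using *[of "j + l - i"] by simp
qed

lemma Suc_mod_inj: "\<lbrakk>i < l; j < l; Suc i mod l = Suc j mod (l::nat)\<rbrakk> \<Longrightarrow> i = j"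
  by (auto simp: mod_Suc split: if_splits)

lemma ex_pred_mod: "i < l \<Longrightarrow> \<exists>j<l. Suc j mod l = (i::nat)"
  by (cases i) (auto intro: exI[of _ "l - 1"] exI[of _ "i - 1"])

lemma cycle_edges_at:
  assumes "distinct vs" "i < length vs" "e \<in> cycle_edges vs" "vs ! i \<in> e"
  obtains j where "j < length vs" "e = {vs ! j, vs ! (Suc j mod length vs)}"
    "j = i \<or> Suc j mod length vs = i"
  using assms unfolding cycle_edges_image
  by (auto simp: nth_eq_iff_index_eq Suc_mod_less)

lemma cycle_edges_index_inj:
  assumes "distinct vs" "3 \<le> length vs"
  shows "inj_on (\<lambda>i. {vs ! i, vs ! (Suc i mod length vs)}) {..<length vs}"
proof (rule inj_onI)
  fix i j assume i: "i \<in> {..<length vs}" and j: "j \<in> {..<length vs}"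
    and eq: "{vs ! i, vs ! (Suc i mod length vs)} = {vs ! j, vs ! (Suc j mod length vs)}"
  have "i = j \<or> (i = Suc j mod length vs \<and> Suc i mod length vs = j)"
    using eq i j assms(1) by (auto simp: doubleton_eq_iff nth_eq_iff_index_eq Suc_mod_less)
  then show "i = j"
    using i j assms(2) by (auto simp: mod_Suc split: if_splits)
qed

lemma card_cycle_edges:
  "\<lbrakk>distinct vs; 3 \<le> length vs\<rbrakk> \<Longrightarrow> card (cycle_edges vs) = length vs"
  unfolding cycle_edges_image by (simp add: card_image cycle_edges_index_inj)

lemma sum_cycle_edges:
  assumes "distinct vs" "3 \<le> length vs"
  shows "(\<Sum>e\<in>cycle_edges vs. g e) = (\<Sum>i<length vs. g {vs ! i, vs ! (Suc i mod length vs)})"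
  unfolding cycle_edges_image
  using sum.reindex[OF cycle_edges_index_inj[OF assms]] by simp

lemma cycle_two_edges:
  assumes "distinct vs" "3 \<le> length vs" "x \<in> set vs"
  obtains e f where "e \<in> cycle_edges vs" "f \<in> cycle_edges vs" "x \<in> e" "x \<in> f" "e \<noteq> f"
proof -
  obtain i where i: "i < length vs" "x = vs ! i" using assms(3) by (auto simp: in_set_conv_nth)
  obtain j where j: "j < length vs" "Suc j mod length vs = i" using ex_pred_mod[OF i(1)] by blast
  have "i \<noteq> j" using i j assms(2) by (auto simp: mod_Suc split: if_splits)
  then have "{vs ! i, vs ! (Suc i mod length vs)} \<noteq> {vs ! j, vs ! (Suc j mod length vs)}"
    using inj_onD[OF cycle_edges_index_inj[OF assms(1,2)], of i j] i j by auto
  then show thesis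
    using that[OF cycle_edgesI[OF i(1)] cycle_edgesI[OF j(1)]] i j by auto
qed

text \<open>
  A vertex of the inner cycle has its two inner edges among its two outer ones, so the outer cycle
  continues inside the inner one at every vertex.
\<close>

lemma cycle_in_cycle_eq:
  assumes vs: "distinct vs" "3 \<le> length vs" and ws: "distinct ws" "3 \<le> length ws"
    and sub: "cycle_edges ws \<subseteq> cycle_edges vs"
  shows "cycle_edges ws = cycle_edges vs"
proof -
  let ?l = "length vs"
  have sets: "set ws \<subseteq> set vs" using sub Union_cycle_edges by (metis Union_mono)
  have at: "{vs ! i, vs ! (Suc i mod ?l)} \<in> cycle_edges ws" if i: "i < ?l" "vs ! i \<in> set ws" for i
  proof -
    obtain e f where ef: "e \<in> cycle_edges ws" "f \<in> cycle_edges ws" "vs ! i \<in> e" "vs ! i \<in> f" "e \<noteq> f"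
      using cycle_two_edges[OF ws i(2)] .
    obtain a where a: "a < ?l" "e = {vs ! a, vs ! (Suc a mod ?l)}" "a = i \<or> Suc a mod ?l = i"
      using cycle_edges_at[OF vs(1) i(1), of e] ef sub by blast
    obtain b where b: "b < ?l" "f = {vs ! b, vs ! (Suc b mod ?l)}" "b = i \<or> Suc b mod ?l = i"
      using cycle_edges_at[OF vs(1) i(1), of f] ef sub by blast
    have "a = i \<or> b = i" using a b ef(5) Suc_mod_inj by metis
    then show ?thesis using a b ef by auto
  qed
  have "ws ! 0 \<in> set vs" using sets ws(2) by (metis length_greater_0_conv list.size(3) not_numeral_le_zero nth_mem subsetD)
  then obtain s where s: "s < ?l" "vs ! s = ws ! 0" by (auto simp: in_set_conv_nth)
  have all: "vs ! j \<in> set ws" if "j < ?l" for j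
    using s(1) that
  proof (induction rule: cyclic_induct)
    case start
    show ?case using s ws(2) by (metis length_greater_0_conv list.size(3) not_numeral_le_zero nth_mem)
  next
    case (step t)
    have "vs ! (Suc t mod ?l) \<in> \<Union>(cycle_edges ws)" using at[OF step] by blast
    then show ?case by (simp add: Union_cycle_edges)
  qed
  have "cycle_edges vs \<subseteq> cycle_edges ws"
    using at all by (auto simp: cycle_edges_image[of vs])
  then show ?thesis using sub by blast
qed

lemma cycle_edges_rotate: "cycle_edges (rotate r vs) = cycle_edges vs"
proof (cases "vs = []")
  case False
  let ?l = "length vs"
  have l: "0 < ?l" using False by simp
  have nth: "rotate r vs ! i = vs ! ((r + i) mod ?l)" if "i < ?l" for i
    using that by (simp add: nth_rotate)
  have img: "(\<lambda>i. (r + i) mod ?l) ` {..<?l} = {..<?l}"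
  proof
    show "{..<?l} \<subseteq> (\<lambda>i. (r + i) mod ?l) ` {..<?l}"
    proof
      fix j assume j: "j \<in> {..<?l}"
      have "r \<le> ?l * r" using l by (cases ?l) auto
      then have "r + (j + (?l * r - r)) = j + ?l * r" by linarith
      then have "(r + (j + (?l * r - r)) mod ?l) mod ?l = (j + ?l * r) mod ?l"
        by (simp only: mod_add_right_eq)
      also have "\<dots> = j" using j by simp
      finally have "j = (r + (j + (?l * r - r)) mod ?l) mod ?l" by simp
      then show "j \<in> (\<lambda>i. (r + i) mod ?l) ` {..<?l}" using l by (intro image_eqI) auto
    qed
  qed (use l in auto)
  have "cycle_edges (rotate r vs)
      = (\<lambda>i. {vs ! i, vs ! (Suc i mod ?l)}) ` (\<lambda>i. (r + i) mod ?l) ` {..<?l}"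
    unfolding cycle_edges_image image_image length_rotate
    by (rule image_cong) (auto simp: nth Suc_mod_less mod_add_right_eq mod_Suc_eq)
  then show ?thesis by (simp add: img cycle_edges_image)
qed simp

section \<open>Connectivity and blocks\<close>

lemma sym_adj: "sym (adj G)"
  by (auto simp: sym_def adj_def insert_commute)

lemma rtrancl_adj_sym: "(a, b) \<in> (adj G)\<^sup>* \<Longrightarrow> (b, a) \<in> (adj G)\<^sup>*"
  by (meson sym_adj sym_rtrancl symD)

lemma relpow_sym: "sym R \<Longrightarrow> (a, b) \<in> R ^^ n \<Longrightarrow> (b, a) \<in> R ^^ n"
proof (induction n arbitrary: b)
  case (Suc n)
  then obtain c where "(a, c) \<in> R ^^ n" "(c, b) \<in> R" by auto
  then show ?case using Suc by (meson relpow_Suc_I2 symD)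
qed auto

lemma rtrancl_adj_mono: "edges H \<subseteq> edges G \<Longrightarrow> (adj H)\<^sup>* \<subseteq> (adj G)\<^sup>*"
  by (rule rtrancl_mono) (auto simp: adj_def)

lemma adj_delete_vertex:
  "(a, b) \<in> adj (delete_vertex G v) \<longleftrightarrow> {a, b} \<in> edges G \<and> a \<noteq> v \<and> b \<noteq> v"
  by (auto simp: adj_def delete_vertex_def)

text \<open>Without one of its vertices a cycle is a path, starting at the successor of that vertex.\<close>

lemma cycle_nonseparable:
  assumes "distinct vs" "3 \<le> length vs"
  shows "nonseparable (Graph (set vs) (cycle_edges vs))"
proof -
  let ?G = "Graph (set vs) (cycle_edges vs)" and ?l = "length vs"
  have conn: "(vs ! i, vs ! j) \<in> (adj ?G)\<^sup>*" if "i < ?l" "j < ?l" for i j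
    using that
  proof (induction rule: cyclic_induct)
    case (step t)
    have "(vs ! t, vs ! (Suc t mod ?l)) \<in> adj ?G"
      using cycle_edgesI[OF step(1)] by (simp add: adj_def)
    then show ?case using step(2) by (rule rtrancl_into_rtrancl[rotated])
  qed simp
  have "set vs \<noteq> {}" using assms(2) by auto
  then have "connected_graph ?G"
    using conn unfolding connected_graph_def by (auto simp: in_set_conv_nth)
  moreover have "\<not> cut_vertex ?G v" for v
  proof
    assume "cut_vertex ?G v"
    then obtain x y where xy: "x \<in> set vs - {v}" "y \<in> set vs - {v}"
      "(x, y) \<notin> (adj (delete_vertex ?G v))\<^sup>*" and v: "v \<in> set vs"
      by (auto simp: cut_vertex_def)
    obtain i where i: "i < ?l" "v = vs ! i" using v by (auto simp: in_set_conv_nth)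
    let ?s = "Suc i mod ?l" and ?R = "(adj (delete_vertex ?G v))\<^sup>*"
    have *: "j = i \<or> (vs ! ?s, vs ! j) \<in> ?R" if "j < ?l" for j
      using Suc_mod_less[OF i(1)] that
    proof (induction rule: cyclic_induct)
      case (step t)
      have "(vs ! t, vs ! (Suc t mod ?l)) \<in> adj (delete_vertex ?G v)"
        if "t \<noteq> i" "Suc t mod ?l \<noteq> i"
        using that cycle_edgesI[OF step(1)] i step(1) assms(1)
        by (simp add: adj_delete_vertex nth_eq_iff_index_eq Suc_mod_less)
      then show ?case using step(2) by (auto intro: rtrancl_into_rtrancl)
    qed simp
    have "(vs ! ?s, z) \<in> ?R" if "z \<in> set vs - {v}" for z
      using * that i by (auto simp: in_set_conv_nth)
    then show False using xy rtrancl_adj_sym rtrancl_trans by metis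
  qed
  ultimately show ?thesis by (simp add: nonseparable_def)
qed

lemma edge_nonseparable:
  assumes "card e = 2"
  shows "nonseparable (Graph e {e})"
proof -
  obtain u v where e: "e = {u, v}" "u \<noteq> v" using assms by (auto simp: card_2_iff)
  have "(u, v) \<in> adj (Graph e {e})" "(v, u) \<in> adj (Graph e {e})"
    using e by (auto simp: adj_def)
  then have "connected_graph (Graph e {e})"
    using e by (auto simp: connected_graph_def)
  moreover have "\<not> cut_vertex (Graph e {e}) z" for z
    using e by (auto simp: cut_vertex_def)
  ultimately show ?thesis by (simp add: nonseparable_def)
qed

lemma nonseparable_delete_vertex:
  assumes "simple_graph A" "nonseparable A" "a \<in> verts A - {v}" "b \<in> verts A - {v}"
  shows "(a, b) \<in> (adj (delete_vertex A v))\<^sup>*"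
proof (cases "v \<in> verts A")
  case True
  then show ?thesis using assms by (auto simp: nonseparable_def cut_vertex_def)
next
  case False
  then have "adj A \<subseteq> adj (delete_vertex A v)"
    using assms(1) unfolding simple_graph_def adj_def delete_vertex_def by auto
  moreover have "(a, b) \<in> (adj A)\<^sup>*"
    using assms by (auto simp: nonseparable_def connected_graph_def)
  ultimately show ?thesis using rtrancl_mono by blast
qed

lemma nonseparable_union:
  assumes A: "simple_graph A" "nonseparable A" and B: "simple_graph B" "nonseparable B"
    and xy: "x \<noteq> y" "{x, y} \<subseteq> verts A \<inter> verts B"
  shows "nonseparable (Graph (verts A \<union> verts B) (edges A \<union> edges B))"
proof -
  let ?U = "Graph (verts A \<union> verts B) (edges A \<union> edges B)"
  have sub: "(adj A)\<^sup>* \<subseteq> (adj ?U)\<^sup>*" "(adj B)\<^sup>* \<subseteq> (adj ?U)\<^sup>*"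
    by (rule rtrancl_adj_mono; simp)+
  have "(a, x) \<in> (adj ?U)\<^sup>*" if "a \<in> verts ?U" for a
  proof -
    have "(a, x) \<in> (adj A)\<^sup>* \<or> (a, x) \<in> (adj B)\<^sup>*"
      using that xy A(2) B(2) by (auto simp: nonseparable_def connected_graph_def)
    then show ?thesis using sub by blast
  qed
  then have conn: "connected_graph ?U"
    unfolding connected_graph_def using rtrancl_adj_sym rtrancl_trans xy
    by (metis (no_types, lifting) IntD1 Un_iff empty_iff insert_subset sgraph.sel(1))
  have "\<not> cut_vertex ?U v" for v
  proof
    assume "cut_vertex ?U v"
    then obtain a b where ab: "a \<in> verts ?U - {v}" "b \<in> verts ?U - {v}"
      "(a, b) \<notin> (adj (delete_vertex ?U v))\<^sup>*"
      by (auto simp: cut_vertex_def)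
    (* one of the two shared vertices survives the deletion and joins what is left of both parts *)
    obtain z where z: "z \<in> verts A \<inter> verts B" "z \<noteq> v" using xy by (metis insert_subset)
    have sub: "(adj (delete_vertex A v))\<^sup>* \<subseteq> (adj (delete_vertex ?U v))\<^sup>*"
      "(adj (delete_vertex B v))\<^sup>* \<subseteq> (adj (delete_vertex ?U v))\<^sup>*"
      by (rule rtrancl_adj_mono; auto simp: delete_vertex_def)+
    have "(c, z) \<in> (adj (delete_vertex ?U v))\<^sup>*" if "c \<in> verts ?U - {v}" for c
      using that z sub nonseparable_delete_vertex[OF A, of c v z]
        nonseparable_delete_vertex[OF B, of c v z] by auto
    then show False using ab rtrancl_adj_sym rtrancl_trans by metis
  qed
  then show ?thesis using conn by (simp add: nonseparable_def)
qed

lemma block_exists: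
  assumes G: "simple_graph G" and H: "subgraph H G" "nonseparable H"
  obtains B where "block G B" "subgraph H B"
proof -
  let ?P = "\<lambda>K. subgraph K G \<and> nonseparable K \<and> subgraph H K"
  let ?f = "\<lambda>K. card (verts K) + card (edges K)"
  have fin: "finite (verts G)" "finite (edges G)"
    using G by (auto simp: simple_graph_def intro: finite_subset[of _ "Pow (verts G)"])
  have "subgraph H H" using H by (simp add: subgraph_def)
  then have "?P H" using H by simp
  moreover have "\<forall>K. ?P K \<longrightarrow> ?f K < Suc (?f G)"
    by (auto simp: subgraph_def less_Suc_eq_le intro!: add_mono card_mono fin)
  ultimately obtain B where B: "?P B" and max: "\<And>K. ?P K \<Longrightarrow> ?f K \<le> ?f B"
    using ex_has_greatest_nat[of ?P H ?f "Suc (?f G)"] by metis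
  have "K = B" if K: "subgraph K G" "nonseparable K" "subgraph B K" for K
  proof -
    have "?P K" using K B by (auto simp: subgraph_def)
    then have le: "?f K \<le> ?f B" by (rule max)
    have sub: "verts B \<subseteq> verts K" "edges B \<subseteq> edges K" using K by (auto simp: subgraph_def)
    have fK: "finite (verts K)" "finite (edges K)"
      using K fin by (auto simp: subgraph_def intro: finite_subset)
    have "card (verts B) \<le> card (verts K)" "card (edges B) \<le> card (edges K)"
      using sub fK by (auto intro: card_mono)
    then have "verts B = verts K" "edges B = edges K"
      using le sub fK by (simp_all add: card_subset_eq)
    then show ?thesis by (simp add: sgraph.expand)
  qed
  then have "block G B" using B by (auto simp: block_def)
  then show thesis using that B by blast
qed

lemma blocks_sharing_two_vertices_eq:
  assumes "block G A" "block G B" "x \<noteq> y" "{x, y} \<subseteq> verts A \<inter> verts B"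
  shows "A = B"
proof -
  let ?U = "Graph (verts A \<union> verts B) (edges A \<union> edges B)"
  have AB: "simple_graph A" "nonseparable A" "simple_graph B" "nonseparable B"
    "subgraph A G" "subgraph B G"
    using assms by (auto simp: block_def subgraph_def)
  have "nonseparable ?U" using nonseparable_union[OF AB(1-4) assms(3,4)] .
  moreover have "subgraph ?U G" "subgraph A ?U" "subgraph B ?U"
    using AB by (auto simp: subgraph_def simple_graph_def)
  ultimately have "?U = A" "?U = B" using assms(1,2) unfolding block_def by blast+
  then show ?thesis by simp
qed

section \<open>The edges of a cactus\<close>

lemma cyclesE:
  assumes "C \<in> cycles G"
  obtains vs where "C = cycle_edges vs" "3 \<le> length vs" "distinct vs" "set vs \<subseteq> verts G"
    "cycle_edges vs \<subseteq> edges G"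
  using assms unfolding cycles_def by blast

lemma cyclesI:
  "\<lbrakk>3 \<le> length vs; distinct vs; set vs \<subseteq> verts G; cycle_edges vs \<subseteq> edges G\<rbrakk>
    \<Longrightarrow> cycle_edges vs \<in> cycles G"
  unfolding cycles_def by blast

lemma finite_edges: "simple_graph G \<Longrightarrow> finite (edges G)"
  by (rule finite_subset[of _ "Pow (verts G)"]) (auto simp: simple_graph_def)

lemma finite_cycles: "simple_graph G \<Longrightarrow> finite (cycles G)"
  by (rule finite_subset[of _ "Pow (edges G)"]) (auto simp: cycles_def finite_edges)

lemma edgeE:
  assumes "simple_graph G" "e \<in> edges G"
  obtains u v where "e = {u, v}" "u \<noteq> v" "u \<in> verts G" "v \<in> verts G"
proof -
  have "card e = 2" "e \<subseteq> verts G" using assms by (auto simp: simple_graph_def)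
  then show thesis using that unfolding card_2_iff by blast
qed

lemma simple_cycle_subgraph:
  assumes "simple_graph G" "distinct vs" "set vs \<subseteq> verts G" "cycle_edges vs \<subseteq> edges G"
  shows "subgraph (Graph (set vs) (cycle_edges vs)) G"
  using assms Union_cycle_edges[of vs]
  by (auto simp: subgraph_def simple_graph_def)

text \<open>
  Each edge is a nonseparable subgraph, so it lies in a block, and the blocks are cut edges and
  cycles.
\<close>

lemma cactus_edge_cases:
  assumes "cactus G" "e \<in> edges G"
  shows "cut_edge G e \<or> (\<exists>C\<in>cycles G. e \<in> C)"
proof -
  have G: "simple_graph G" and e: "card e = 2" "e \<subseteq> verts G"
    using assms by (auto simp: cactus_def simple_graph_def)
  have "subgraph (Graph e {e}) G"
    using assms e by (auto simp: subgraph_def simple_graph_def intro: card_ge_0_finite)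
  then obtain B where B: "block G B" "subgraph (Graph e {e}) B"
    using block_exists[OF G _ edge_nonseparable[OF e(1)]] by blast
  have eB: "e \<in> edges B" "edges B \<subseteq> edges G" "verts B \<subseteq> verts G"
    using B by (auto simp: subgraph_def block_def)
  consider f where "cut_edge G f" "B = Graph f {f}" | "cycle_graph B"
    using assms(1) B(1) by (auto simp: cactus_def)
  then show ?thesis
  proof cases
    case 1
    then show ?thesis using eB by auto
  next
    case 2
    then obtain vs where "3 \<le> length vs" "distinct vs" "verts B = set vs" "edges B = cycle_edges vs"
      by (auto simp: cycle_graph_def)
    then have "edges B \<in> cycles G" using cyclesI[of vs G] eB by simp
    then show ?thesis using eB(1) by blast
  qed
qed

text \<open>
  A cycle is nonseparable, so it lies in a block, and this block, having more than one edge, is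
  itself a cycle; a cycle contains no other cycle.  Distinct blocks have at most one common vertex.
\<close>

lemma cactus_cycles_edge_disjoint:
  assumes "cactus G" "C \<in> cycles G" "D \<in> cycles G" "e \<in> C" "e \<in> D"
  shows "C = D"
proof -
  have G: "simple_graph G" using assms(1) by (simp add: cactus_def)
  have in_block: "\<exists>B. block G B \<and> edges B = K" if K: "K \<in> cycles G" for K
  proof -
    obtain vs where vs: "K = cycle_edges vs" "3 \<le> length vs" "distinct vs" "set vs \<subseteq> verts G"
      "cycle_edges vs \<subseteq> edges G" using cyclesE[OF K] .
    obtain B where B: "block G B" "subgraph (Graph (set vs) (cycle_edges vs)) B"
      using block_exists[OF G simple_cycle_subgraph[OF G vs(3,4,5)] cycle_nonseparable[OF vs(3,2)]]
      by blast
    have sub: "cycle_edges vs \<subseteq> edges B" using B(2) by (simp add: subgraph_def)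
    have "cycle_graph B"
    proof (rule ccontr)
      assume "\<not> cycle_graph B"
      then obtain f where "edges B = {f}" using assms(1) B(1) by (auto simp: cactus_def)
      then have "card (cycle_edges vs) \<le> 1" using sub card_mono[of "{f}" "cycle_edges vs"] by simp
      then show False using card_cycle_edges[OF vs(3,2)] vs(2) by simp
    qed
    then obtain ws where "3 \<le> length ws" "distinct ws" "edges B = cycle_edges ws"
      by (auto simp: cycle_graph_def)
    then have "edges B = K" using cycle_in_cycle_eq[of ws vs] vs sub by simp
    then show ?thesis using B(1) by blast
  qed
  obtain A where A: "block G A" "edges A = C" using in_block assms by blast
  obtain B where B: "block G B" "edges B = D" using in_block assms by blast
  have AB: "simple_graph A" "simple_graph B" using A B by (auto simp: block_def subgraph_def)
  then have sub: "e \<subseteq> verts A" "e \<subseteq> verts B"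
    using A B assms(4,5) unfolding simple_graph_def by blast+
  obtain x y where "x \<noteq> y" "e = {x, y}"
    using edgeE[OF AB(1), of e] A assms by blast
  then have "A = B"
    using blocks_sharing_two_vertices_eq[OF A(1) B(1), of x y] sub by simp
  then show ?thesis using A B by simp
qed

section \<open>Gates\<close>

text \<open>
  The vertices \<open>vs\<close> form a cycle of \<open>G\<close>, and \<open>\<pi>\<close> maps each vertex to the index of its gate, the
  vertex of the cycle at which it hangs when the edges of the cycle are deleted. Length \<open>2\<close> is
  permitted because \<open>cycle_edges [u, v]\<close> is just \<open>{{u, v}}\<close>: a bridge is treated as a cycle of
  length \<open>2\<close>.
\<close>

definition gate :: "'a sgraph \<Rightarrow> 'a list \<Rightarrow> ('a \<Rightarrow> nat) \<Rightarrow> bool" where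
  "gate G vs \<pi> \<longleftrightarrow> 2 \<le> length vs \<and> distinct vs \<and> set vs \<subseteq> verts G \<and> cycle_edges vs \<subseteq> edges G \<and>
     (\<forall>i<length vs. \<pi> (vs ! i) = i) \<and> (\<forall>x\<in>verts G. \<pi> x < length vs) \<and>
     (\<forall>a b. {a, b} \<in> edges G - cycle_edges vs \<longrightarrow> \<pi> a = \<pi> b)"

definition off_adj :: "'a sgraph \<Rightarrow> 'a list \<Rightarrow> ('a \<times> 'a) set" where
  "off_adj G vs = {(a, b). {a, b} \<in> edges G - cycle_edges vs}"

lemma sym_off_adj: "sym (off_adj G vs)"
  by (auto simp: sym_def off_adj_def insert_commute)

text \<open>
  Following a path towards the cycle until an edge of the cycle comes next shows that every vertex
  hangs at some vertex of the cycle; \<open>sep\<close> makes this vertex unique.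
\<close>

lemma gate_exists:
  assumes G: "simple_graph G" "connected_graph G"
    and vs: "2 \<le> length vs" "distinct vs" "set vs \<subseteq> verts G" "cycle_edges vs \<subseteq> edges G"
    and sep: "\<And>i j. \<lbrakk>i < length vs; j < length vs; (vs ! i, vs ! j) \<in> (off_adj G vs)\<^sup>*\<rbrakk> \<Longrightarrow> i = j"
  obtains \<pi> where "gate G vs \<pi>"
proof -
  let ?R = "(off_adj G vs)\<^sup>*"
  have R_sym: "(a, b) \<in> ?R \<Longrightarrow> (b, a) \<in> ?R" for a b
    by (meson sym_off_adj sym_rtrancl symD)
  have ex: "\<exists>i<length vs. (x, vs ! i) \<in> ?R" if x: "x \<in> verts G" for x
  proof -
    have "0 < length vs" using vs(1) by linarith
    then have "vs ! 0 \<in> verts G" using vs(3) nth_mem by blast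
    then have "(x, vs ! 0) \<in> (adj G)\<^sup>*" using G(2) x by (simp add: connected_graph_def)
    then show ?thesis
    proof (induction rule: converse_rtrancl_induct)
      case base
      then show ?case using \<open>0 < length vs\<close> by blast
    next
      case (step y z)
      show ?case
      proof (cases "{y, z} \<in> cycle_edges vs")
        case True
        then have "y \<in> set vs" using Union_cycle_edges[of vs] by blast
        then show ?thesis by (auto simp: in_set_conv_nth)
      next
        case False
        then have "(y, z) \<in> off_adj G vs" using step(1) by (simp add: off_adj_def adj_def)
        then show ?thesis using step(3) by (meson converse_rtrancl_into_rtrancl)
      qed
    qed
  qed
  define \<pi> where "\<pi> x = (SOME i. i < length vs \<and> (x, vs ! i) \<in> ?R)" for x
  have \<pi>: "\<pi> x < length vs \<and> (x, vs ! \<pi> x) \<in> ?R" if "x \<in> verts G" for x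
    using someI_ex[OF ex[OF that, simplified]] unfolding \<pi>_def by blast
  have "\<pi> (vs ! i) = i" if "i < length vs" for i
    using sep[of i "\<pi> (vs ! i)"] \<pi>[of "vs ! i"] that vs(3) nth_mem by (metis subsetD)
  moreover have "\<pi> a = \<pi> b" if ab: "{a, b} \<in> edges G - cycle_edges vs" for a b
  proof -
    have V: "a \<in> verts G" "b \<in> verts G" using ab G(1) by (auto simp: simple_graph_def)
    have "(a, b) \<in> off_adj G vs" using ab by (simp add: off_adj_def)
    then have "(vs ! \<pi> a, vs ! \<pi> b) \<in> ?R"
      using \<pi>[OF V(1)] \<pi>[OF V(2)] R_sym by (meson rtrancl_into_rtrancl rtrancl_trans)
    then show ?thesis using sep \<pi> V by blast
  qed
  ultimately have "gate G vs \<pi>" using vs \<pi> by (auto simp: gate_def)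
  then show thesis by (rule that)
qed

text \<open>
  A path between two vertices of a cycle that avoids the edges of the cycle would, together with an
  arc of it, form a second cycle through one of its edges.
\<close>

lemma cactus_cycle_separates:
  assumes G: "cactus G" and vs: "3 \<le> length vs" "distinct vs" "set vs \<subseteq> verts G"
      "cycle_edges vs \<subseteq> edges G"
    and i: "i < length vs" and j: "j < length vs" and path: "(vs ! i, vs ! j) \<in> (off_adj G vs)\<^sup>*"
  shows "i = j"
proof (rule ccontr)
  assume "i \<noteq> j"
  let ?l = "length vs" and ?R = "off_adj G vs"
  \<comment> \<open>The ends are ordered by index, so that the arc between them runs backwards from \<open>b\<close> to \<open>a\<close>.\<close>
  define P where "P n \<longleftrightarrow> (\<exists>i j. i < j \<and> j < ?l \<and> (vs ! i, vs ! j) \<in> ?R ^^ n)" for n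
  have PI: "P n" if "(vs ! a, vs ! b) \<in> ?R ^^ n" "a \<noteq> b" "a < ?l" "b < ?l" for a b n
  proof (cases "a < b")
    case True
    then show ?thesis using that P_def by blast
  next
    case False
    have "(vs ! b, vs ! a) \<in> ?R ^^ n"
      using that(1) by (rule relpow_sym[OF sym_off_adj])
    then show ?thesis using False that P_def by (metis linorder_neqE_nat)
  qed
  obtain n0 where "(vs ! i, vs ! j) \<in> ?R ^^ n0" using path rtrancl_imp_relpow by blast
  then have "P n0" using PI \<open>i \<noteq> j\<close> i j by blast
  define n where "n = (LEAST n. P n)"
  have Pn: "P n" and min: "\<And>n'. P n' \<Longrightarrow> n \<le> n'"
    using LeastI[of P, OF \<open>P n0\<close>] Least_le[of P] by (auto simp: n_def)
  obtain a b where ab: "a < b" "b < ?l" "(vs ! a, vs ! b) \<in> ?R ^^ n" using Pn P_def by blast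
  obtain p where p: "p 0 = vs ! a" "p n = vs ! b" "\<And>t. t < n \<Longrightarrow> (p t, p (Suc t)) \<in> ?R"
    using ab(3) unfolding relpow_fun_conv by blast
  have sub: "(p s, p t) \<in> ?R ^^ (t - s)" if "s \<le> t" "t \<le> n" for s t
    unfolding relpow_fun_conv using that p(3) by (intro exI[of _ "\<lambda>u. p (s + u)"]) auto
  (* the shortest such path meets the cycle in its ends only and repeats no vertex *)
  have inner: "p t \<notin> set vs" if t: "0 < t" "t < n" for t
  proof
    assume "p t \<in> set vs"
    then obtain c where c: "c < ?l" "p t = vs ! c" by (auto simp: in_set_conv_nth)
    have "c \<noteq> a \<or> c \<noteq> b" using ab by simp
    then have "P t \<or> P (n - t)"
      using sub[of 0 t] sub[of t n] t p(1,2) c PI ab by (metis diff_zero le0 less_imp_le_nat less_trans order_refl)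
    then show False using min t by (metis diff_less leD less_trans)
  qed
  have inj: "p s \<noteq> p t" if st: "s < t" "t \<le> n" for s t
  proof
    assume eq: "p s = p t"
    have "(p 0, p n) \<in> ?R ^^ (s + (n - t))"
      unfolding relpow_add using sub[of 0 s] sub[of t n] st eq by auto
    then have "P (s + (n - t))" using PI p(1,2) ab by (metis less_trans nat_neq_iff)
    then show False using min[of "s + (n - t)"] st by simp
  qed
  \<comment> \<open>The second cycle: along the path from \<open>a\<close> to \<open>b\<close>, then back along the arc of the old cycle.\<close>
  define g where "g t = (if t \<le> n then p t else vs ! (b - (t - n)))" for t
  define ws where "ws = map g [0..<n + (b - a)]"
  have n: "0 < n" using ab p(1,2) vs(2) by (cases n) (auto simp: nth_eq_iff_index_eq)
  have len: "length ws = n + (b - a)" by (simp add: ws_def)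
  have arc: "g t = vs ! (b - (t - n))" if "n \<le> t" "t \<le> n + (b - a)" for t
    using that p(2) by (cases "t = n") (auto simp: g_def)
  have edge: "{ws ! t, ws ! (Suc t mod length ws)} = {g t, if Suc t = n + (b - a) then g 0 else g (Suc t)}"
    if "t < n + (b - a)" for t
    using that ab n by (auto simp: ws_def mod_Suc)
  have g0: "g 0 = vs ! a" using n p(1) by (simp add: g_def)
  have path_edge: "{ws ! t, ws ! (Suc t mod length ws)} = {p t, p (Suc t)}" if "t < n" for t
    using edge[of t] that ab(1) by (auto simp: g_def)
  have arc_edge: "{ws ! t, ws ! (Suc t mod length ws)} \<in> cycle_edges vs"
    if t: "n \<le> t" "t < n + (b - a)" for t
  proof -
    define c where "c = b - Suc (t - n)"
    have c: "c < ?l" "Suc c mod ?l = b - (t - n)" "Suc c = b - (t - n)" using t ab by (auto simp: c_def)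
    have "(if Suc t = n + (b - a) then g 0 else g (Suc t)) = vs ! c"
      using t ab arc[of "Suc t"] g0 by (auto simp: c_def Suc_diff_le)
    then show ?thesis using edge[OF t(2)] arc[of t] t c cycle_edgesI[OF c(1)]
      by (simp add: insert_commute)
  qed
  have "cycle_edges ws \<in> cycles G"
  proof (rule cyclesI)
    \<comment> \<open>Path and arc cannot both be one edge, as the path avoids the edges of the cycle.\<close>
    have "n \<noteq> 1 \<or> b - a \<noteq> 1"
    proof (rule ccontr)
      assume *: "\<not> (n \<noteq> 1 \<or> b - a \<noteq> 1)"
      then have "b = Suc a" "n = 1" using ab by auto
      then have "{vs ! a, vs ! (Suc a mod ?l)} \<notin> cycle_edges vs"
        using p(3)[of 0] p(1,2) ab by (auto simp: off_adj_def)
      then show False using cycle_edgesI[of a vs] ab by simp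
    qed
    then show "3 \<le> length ws" using n ab len by auto
    have "inj_on g {0..<n + (b - a)}"
    proof (rule linorder_inj_onI)
      fix s t assume st: "s < t" "s \<in> {0..<n + (b - a)}" "t \<in> {0..<n + (b - a)}"
      show "g s \<noteq> g t"
      proof (cases "t \<le> n")
        case True
        then show ?thesis using inj st by (simp add: g_def)
      next
        case False
        then have gt: "g t = vs ! (b - (t - n))" by (simp add: g_def)
        have bt: "a < b - (t - n)" "b - (t - n) < b" using False st by auto
        consider "s = 0" | "0 < s" "s < n" | "n \<le> s" by linarith
        then show ?thesis
        proof cases
          case 1
          then show ?thesis using g0 gt bt ab vs(2) by (auto simp: nth_eq_iff_index_eq)
        next
          case 2
          then have "g s \<notin> set vs" using inner by (simp add: g_def)
          then show ?thesis using gt bt ab by (metis less_trans nth_mem)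
        next
          case 3
          then have "g s = vs ! (b - (s - n))" using arc st by simp
          then show ?thesis using gt bt ab vs(2) 3 st False by (auto simp: nth_eq_iff_index_eq)
        qed
      qed
    qed (simp add: linear)
    then show "distinct ws" by (simp add: ws_def distinct_map)
    show sub: "cycle_edges ws \<subseteq> edges G"
    proof
      fix e assume "e \<in> cycle_edges ws"
      then obtain t where t: "t < n + (b - a)" "e = {ws ! t, ws ! (Suc t mod length ws)}"
        by (auto simp: cycle_edges_image len)
      show "e \<in> edges G"
        using t path_edge[of t] arc_edge[of t] p(3)[of t] vs(4)
        by (cases "t < n") (auto simp: off_adj_def)
    qed
    then have "\<Union>(cycle_edges ws) \<subseteq> verts G"
      using G by (auto simp: cactus_def simple_graph_def)
    then show "set ws \<subseteq> verts G" by (simp only: Union_cycle_edges)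
  qed
  moreover have "cycle_edges vs \<in> cycles G" using vs by (intro cyclesI)
  moreover have "n < length ws" using ab len by simp
  moreover have "{ws ! n, ws ! (Suc n mod length ws)} \<in> cycle_edges vs" using arc_edge[of n] ab by simp
  ultimately have "cycle_edges ws = cycle_edges vs"
    using cactus_cycles_edge_disjoint[OF G] cycle_edgesI by blast
  moreover have "{p 0, p (Suc 0)} \<in> cycle_edges ws"
    using cycle_edgesI[of 0 ws] path_edge[OF n] n len by simp
  ultimately show False using p(3)[OF n] by (simp add: off_adj_def)
qed

lemma cactus_cycle_gate:
  assumes G: "cactus G" and vs: "3 \<le> length vs" "distinct vs" "set vs \<subseteq> verts G"
      "cycle_edges vs \<subseteq> edges G"
  obtains \<pi> where "gate G vs \<pi>"
proof -
  have "simple_graph G" "connected_graph G" "2 \<le> length vs" using G vs by (auto simp: cactus_def)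
  then show thesis
    using gate_exists[of G vs] cactus_cycle_separates[OF G vs] vs that by blast
qed

lemma cycle_edges_two: "cycle_edges [u, v] = {{u, v}}"
  by (auto simp: cycle_edges_image lessThan_Suc insert_commute)

lemma cut_edge_gate:
  assumes G: "simple_graph G" "connected_graph G" and e: "cut_edge G {u, v}"
  obtains \<pi> where "gate G [u, v] \<pi>"
proof -
  have uv: "{u, v} \<in> edges G" using e by (simp add: cut_edge_def)
  then have V: "u \<in> verts G" "v \<in> verts G" "u \<noteq> v"
    using G(1) by (auto simp: simple_graph_def dest!: bspec)
  let ?R = "off_adj G [u, v]"
  have R: "?R = adj (delete_edge G {u, v})"
    by (auto simp: off_adj_def adj_def delete_edge_def cycle_edges_two)
  have sep: "(u, v) \<notin> ?R\<^sup>*"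
  proof
    assume uv_R: "(u, v) \<in> ?R\<^sup>*"
    have vu_R: "(v, u) \<in> ?R\<^sup>*" using uv_R by (meson sym_off_adj sym_rtrancl symD)
    have "adj G \<subseteq> ?R\<^sup>*"
    proof clarify
      fix a b assume ab: "(a, b) \<in> adj G"
      show "(a, b) \<in> ?R\<^sup>*"
        using ab uv_R vu_R by (cases "{a, b} = {u, v}")
          (auto simp: off_adj_def adj_def cycle_edges_two doubleton_eq_iff)
    qed
    then have "(adj G)\<^sup>* \<subseteq> ?R\<^sup>*" by (rule rtrancl_subset_rtrancl)
    then have "connected_graph (delete_edge G {u, v})"
      using G(2) unfolding connected_graph_def R by (auto simp: delete_edge_def)
    then show False using e by (simp add: cut_edge_def)
  qed
  have "i = j" if "i < length [u, v]" "j < length [u, v]" "([u, v] ! i, [u, v] ! j) \<in> ?R\<^sup>*" for i j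
  proof -
    have "(v, u) \<notin> ?R\<^sup>*" using sep by (meson sym_off_adj sym_rtrancl symD)
    then show ?thesis using that sep by (auto simp: less_Suc_eq)
  qed
  then show thesis
    using gate_exists[OF G, of "[u, v]"] that uv V by (auto simp: cycle_edges_two)
qed

section \<open>Distances past a gate\<close>

lemma vdist_walk:
  assumes "connected_graph G" "x \<in> verts G" "y \<in> verts G"
  shows "(x, y) \<in> adj G ^^ vdist G x y"
proof -
  have "(x, y) \<in> (adj G)\<^sup>*" using assms by (simp add: connected_graph_def)
  then obtain n where "(x, y) \<in> adj G ^^ n" using rtrancl_imp_relpow by blast
  then show ?thesis unfolding vdist_def by (rule LeastI)
qed

lemma vdist_le: "(x, y) \<in> adj G ^^ n \<Longrightarrow> vdist G x y \<le> n"
  unfolding vdist_def by (rule Least_le)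

lemma vdist_self [simp]: "vdist G x x = 0"
  using vdist_le[where G = G and x = x and y = x and n = 0] by simp

lemma vdist_triangle:
  assumes "connected_graph G" "x \<in> verts G" "y \<in> verts G" "z \<in> verts G"
  shows "vdist G x z \<le> vdist G x y + vdist G y z"
proof (rule vdist_le)
  show "(x, z) \<in> adj G ^^ (vdist G x y + vdist G y z)"
    unfolding relpow_add using vdist_walk[OF assms(1-3)] vdist_walk[OF assms(1,3,4)] by (rule relcompI)
qed

text \<open>A potential that grows by at most one along each edge bounds distances from below.\<close>

lemma vdist_lower_bound:
  fixes h :: "'a \<Rightarrow> int"
  assumes "connected_graph G" "x \<in> verts G" "y \<in> verts G"
    and h: "\<And>a b. {a, b} \<in> edges G \<Longrightarrow> h b \<le> h a + 1"
  shows "h y - h x \<le> int (vdist G x y)"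
proof -
  have "h z \<le> h x + int n" if "(x, z) \<in> adj G ^^ n" for z n
    using that
  proof (induction n arbitrary: z)
    case (Suc n)
    then obtain w where "(x, w) \<in> adj G ^^ n" "(w, z) \<in> adj G" by auto
    then show ?case using Suc.IH[of w] h[of w z] by (simp add: adj_def)
  qed simp
  from this[OF vdist_walk[OF assms(1-3)]] show ?thesis by simp
qed

text \<open>The distance of the indices \<open>i\<close> and \<open>j\<close> on a cycle of length \<open>l\<close>.\<close>

definition cdist :: "nat \<Rightarrow> nat \<Rightarrow> nat \<Rightarrow> nat" where
  "cdist l i j = (if i \<le> j then min (j - i) (l - (j - i)) else min (i - j) (l - (i - j)))"

lemma cdist_self [simp]: "cdist l i i = 0"
  by (simp add: cdist_def)

text \<open>The form without truncated subtraction, which linear arithmetic can use.\<close>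

lemma int_cdist:
  "i < l \<Longrightarrow> j < l \<Longrightarrow> int (cdist l i j) =
     (let d = (if i \<le> j then int j - int i else int i - int j) in if 2 * d \<le> int l then d else int l - d)"
  unfolding cdist_def min_def Let_def by (cases "i \<le> j") (auto simp: of_nat_diff)

lemma cdist_step:
  assumes "i < l" "t < l"
  shows "cdist l i (Suc t mod l) \<le> cdist l i t + 1" "cdist l i t \<le> cdist l i (Suc t mod l) + 1"
proof -
  have "cdist l i (Suc t mod l) \<le> cdist l i t + 1 \<and> cdist l i t \<le> cdist l i (Suc t mod l) + 1"
  proof (cases "Suc t = l")
    case True
    then show ?thesis
      using assms int_cdist[of i l 0] int_cdist[of i l t] by (auto simp: Let_def split: if_splits)
  next
    case False
    then show ?thesis
      using assms int_cdist[of i l "Suc t"] int_cdist[of i l t]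
      by (auto simp: Let_def split: if_splits)
  qed
  then show "cdist l i (Suc t mod l) \<le> cdist l i t + 1" "cdist l i t \<le> cdist l i (Suc t mod l) + 1"
    by auto
qed

lemma cycle_walk:
  assumes "cycle_edges vs \<subseteq> edges G" "a < length vs"
  shows "(vs ! a, vs ! ((a + d) mod length vs)) \<in> adj G ^^ d"
proof (induction d)
  case 0
  then show ?case using assms by simp
next
  case (Suc d)
  let ?l = "length vs"
  have "0 < ?l" using assms(2) by linarith
  then have "{vs ! ((a + d) mod ?l), vs ! (Suc ((a + d) mod ?l) mod ?l)} \<in> edges G"
    using assms(1) cycle_edgesI[of "(a + d) mod ?l" vs] by auto
  then show ?case using relpow_Suc_I[OF Suc] by (simp add: adj_def mod_Suc_eq)
qed

lemma vdist_cycle_le: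
  assumes "cycle_edges vs \<subseteq> edges G" "a < length vs" "b < length vs"
  shows "vdist G (vs ! a) (vs ! b) \<le> cdist (length vs) a b"
proof -
  let ?l = "length vs"
  have *: "(vs ! i, vs ! j) \<in> adj G ^^ (j - i) \<and> (vs ! j, vs ! i) \<in> adj G ^^ (?l - (j - i))"
    if "i \<le> j" "j < ?l" for i j
  proof -
    have "(j + (?l - (j - i))) mod ?l = i" using that by simp
    then show ?thesis
      using cycle_walk[OF assms(1), of i "j - i"] cycle_walk[OF assms(1), of j "?l - (j - i)"] that
      by simp
  qed
  have "(vs ! a, vs ! b) \<in> adj G ^^ cdist ?l a b"
  proof (cases "a \<le> b")
    case True
    then show ?thesis
      using *[OF True assms(3)] relpow_sym[OF sym_adj, of "vs ! b" "vs ! a"]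
      by (simp add: cdist_def min_def)
  next
    case False
    then show ?thesis
      using *[of b a] assms(2) relpow_sym[OF sym_adj, of "vs ! b" "vs ! a"]
      by (simp add: cdist_def min_def)
  qed
  then show ?thesis by (rule vdist_le)
qed

text \<open>
  The lower bound comes from a potential that changes by at most one along each edge: minus the
  distance to the gate within the part of \<open>x\<close>, and the distance along the cycle from that gate
  outside of it.
\<close>

lemma gate_vdist:
  assumes G: "simple_graph G" "connected_graph G" and g: "gate G vs \<pi>"
    and x: "x \<in> verts G" and i: "i < length vs"
  shows "vdist G x (vs ! i) = vdist G x (vs ! \<pi> x) + cdist (length vs) (\<pi> x) i"
proof -
  let ?l = "length vs" and ?j = "\<pi> x"
  have j: "?j < ?l" and V: "\<And>t. t < ?l \<Longrightarrow> vs ! t \<in> verts G"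
    using g x by (auto simp: gate_def)
  have "vdist G x (vs ! i) \<le> vdist G x (vs ! ?j) + vdist G (vs ! ?j) (vs ! i)"
    using vdist_triangle[OF G(2) x V[OF j] V[OF i]] .
  also have "vdist G (vs ! ?j) (vs ! i) \<le> cdist ?l ?j i"
    using g vdist_cycle_le[OF _ j i] by (simp add: gate_def)
  finally have le: "vdist G x (vs ! i) \<le> vdist G x (vs ! ?j) + cdist ?l ?j i" by simp
  define h where
    "h y = (if \<pi> y = ?j then - int (vdist G y (vs ! ?j)) else int (cdist ?l ?j (\<pi> y)))" for y
  have h_cycle: "h (vs ! t) = int (cdist ?l ?j t)" if "t < ?l" for t
    using g that by (auto simp: gate_def h_def)
  have "h b \<le> h a + 1" if ab: "{a, b} \<in> edges G" for a b
  proof (cases "{a, b} \<in> cycle_edges vs")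
    case True
    then obtain t where t: "t < ?l" "{a, b} = {vs ! t, vs ! (Suc t mod ?l)}"
      by (auto simp: cycle_edges_image)
    then show ?thesis
      using h_cycle[OF t(1)] h_cycle[OF Suc_mod_less[OF t(1)]] cdist_step[OF j t(1)]
      by (auto simp: doubleton_eq_iff)
  next
    case False
    then have "\<pi> a = \<pi> b" using g ab by (auto simp: gate_def)
    have Vab: "a \<in> verts G" "b \<in> verts G" using ab G(1) by (auto simp: simple_graph_def)
    have "vdist G a b \<le> 1" using ab by (intro vdist_le) (simp add: adj_def)
    then have "vdist G a (vs ! ?j) \<le> 1 + vdist G b (vs ! ?j)"
      using vdist_triangle[OF G(2) Vab V[OF j]] by linarith
    then show ?thesis using \<open>\<pi> a = \<pi> b\<close> by (simp add: h_def)
  qed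
  then have "h (vs ! i) - h x \<le> int (vdist G x (vs ! i))"
    using vdist_lower_bound[OF G(2) x V[OF i]] by blast
  then have "vdist G x (vs ! ?j) + cdist ?l ?j i \<le> vdist G x (vs ! i)"
    using h_cycle[OF i] by (simp add: h_def)
  then show ?thesis using le by simp
qed

section \<open>The summand of an edge\<close>

text \<open>
  As a sum of signs the difference can be split into the part of the cycle and the parts hanging
  at its vertices.
\<close>

lemma closer_diff:
  assumes "finite (edges G)"
  shows "int (m_closer G u v) - int (m_closer G v u)
    = (\<Sum>f\<in>edges G. sgn (int (edist G f v) - int (edist G f u)))"
proof -
  have "(\<Sum>f\<in>edges G. sgn (int (edist G f v) - int (edist G f u)))
    = (\<Sum>f\<in>edges G. of_bool (edist G f u < edist G f v) - of_bool (edist G f v < edist G f u))"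
    by (rule sum.cong) (auto simp: sgn_if)
  also have "\<dots> = int (m_closer G u v) - int (m_closer G v u)"
    unfolding m_closer_def using assms by (simp add: sum_subtractf sum.If_cases of_bool_def Int_def)
  finally show ?thesis by simp
qed

text \<open>The two factors have sum \<open>m\<close> and difference \<open>m\<^sub>u - m\<^sub>v\<close>.\<close>

lemma Sz_term_diff:
  assumes "finite (edges G)" "card (edges G) = m"
    "int (m_closer G u v) - int (m_closer G v u) = d"
  shows "4 * Sz_term G {u, v} = (real m)\<^sup>2 - (real_of_int d)\<^sup>2"
proof -
  let ?A = "{f \<in> edges G. edist G f u < edist G f v}"
  let ?B = "{f \<in> edges G. edist G f v < edist G f u}"
  let ?C = "{f \<in> edges G. edist G f u = edist G f v}"
  have "edges G = ?A \<union> ?B \<union> ?C" by auto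
  then have "card (edges G) = card (?A \<union> ?B \<union> ?C)" by simp
  also have "\<dots> = card (?A \<union> ?B) + card ?C"
    by (rule card_Un_disjoint) (use assms(1) in auto)
  also have "card (?A \<union> ?B) = card ?A + card ?B"
    by (rule card_Un_disjoint) (use assms(1) in auto)
  finally have "m = m_closer G u v + m_closer G v u + m_equal G u v"
    using assms(2) by (simp add: m_closer_def m_equal_def)
  then have m: "real m = real (m_closer G u v) + real (m_closer G v u) + real (m_equal G u v)"
    by simp
  have sym: "m_equal G v u = m_equal G u v" by (simp add: m_equal_def eq_commute)
  have d: "real_of_int d = real (m_closer G u v) - real (m_closer G v u)"
    using assms(3) by (metis of_int_diff of_int_of_nat_eq)
  show ?thesis
    unfolding Sz_term_edge Sz_factor_def sym m d by (simp add: power2_eq_square field_simps)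
qed

definition gate_weight :: "'a sgraph \<Rightarrow> 'a list \<Rightarrow> ('a \<Rightarrow> nat) \<Rightarrow> nat \<Rightarrow> nat" where
  "gate_weight G vs \<pi> j = card {f \<in> edges G - cycle_edges vs. \<pi> ` f = {j}}"

text \<open>
  The reflection of a cycle of length \<open>l\<close> that exchanges the indices \<open>i\<close> and \<open>i + 1\<close>. The summand
  \<open>l\<close> keeps the subtraction from truncating.
\<close>

definition reflect :: "nat \<Rightarrow> nat \<Rightarrow> nat \<Rightarrow> nat" where
  "reflect l i a = (2 * i + 1 + l - a) mod l"

lemma reflect_less: "i < l \<Longrightarrow> reflect l i a < l"
  by (simp add: reflect_def)

lemma reflect_cases:
  assumes "i < l" "a < l"
  shows "reflect l i a = (if 2 * i + 1 < a then 2 * i + 1 + l - a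
    else if 2 * i + 1 - a < l then 2 * i + 1 - a else 2 * i + 1 - a - l)"
proof -
  consider "2 * i + 1 < a" | "a \<le> 2 * i + 1" "2 * i + 1 - a < l" | "a \<le> 2 * i + 1" "l \<le> 2 * i + 1 - a"
    by linarith
  then show ?thesis
  proof cases
    case 2
    then have "2 * i + 1 + l - a = (2 * i + 1 - a) + l" by simp
    then show ?thesis using 2 assms by (simp add: reflect_def del: add_diff_assoc2)
  next
    case 3
    then have "2 * i + 1 + l - a = (2 * i + 1 - a - l) + l + l" by simp
    moreover have "2 * i + 1 - a - l < l" using 3 assms by simp
    ultimately show ?thesis using 3 by (simp add: reflect_def del: add_diff_assoc2)
  qed (use assms in \<open>simp add: reflect_def\<close>)
qed

lemma reflect_reflect: "i < l \<Longrightarrow> a < l \<Longrightarrow> reflect l i (reflect l i a) = a"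
  using reflect_cases[of i l a] reflect_cases[of i l "reflect l i a"] reflect_less[of i l a]
  by (auto split: if_splits)

lemma reflect_Suc:
  assumes "i < l" "a < l"
  shows "Suc (reflect l i (Suc a mod l)) mod l = reflect l i a"
proof -
  have *: "reflect l i a = (if Suc (reflect l i (Suc a mod l)) = l then 0 else Suc (reflect l i (Suc a mod l)))"
  proof (cases "Suc a = l")
    case True
    then show ?thesis
      using assms reflect_cases[of i l a] reflect_cases[of i l 0] by (auto split: if_splits)
  next
    case False
    then show ?thesis
      using assms reflect_cases[of i l a] reflect_cases[of i l "Suc a"] by (auto split: if_splits)
  qed
  then show ?thesis using reflect_less[OF assms(1), of "Suc a mod l"] by auto
qed

lemma cdist_reflect:
  assumes "i < l" "a < l"
  shows "cdist l (reflect l i a) i = cdist l a (Suc i mod l)"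
proof -
  let ?r = "reflect l i a"
  have r: "int ?r = (if 2 * i + 1 < a then 2 * int i + 1 + int l - int a
    else if 2 * int i + 1 - int a < int l then 2 * int i + 1 - int a else 2 * int i + 1 - int a - int l)"
    using reflect_cases[OF assms] assms by (auto split: if_splits)
  note c = int_cdist[OF reflect_less[OF assms(1)] assms(1), of a]
  show ?thesis
  proof (cases "Suc i = l")
    case True
    then show ?thesis
      using assms r c int_cdist[of a l 0] by (auto simp: Let_def split: if_splits)
  next
    case False
    then show ?thesis
      using assms r c int_cdist[of a l "Suc i"] by (auto simp: Let_def split: if_splits)
  qed
qed

lemma edist_edge: "edist G {x, y} w = min (vdist G x w) (vdist G y w)"
  by (simp add: edist_def)

lemma gate_edist_cycle:
  assumes G: "simple_graph G" "connected_graph G" and g: "gate G vs \<pi>"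
    and ab: "a < length vs" "b < length vs" and i: "i < length vs"
  shows "edist G {vs ! a, vs ! b} (vs ! i) = min (cdist (length vs) a i) (cdist (length vs) b i)"
proof -
  have "vdist G (vs ! t) (vs ! i) = cdist (length vs) t i" if "t < length vs" for t
  proof -
    have "vs ! t \<in> verts G" using that g nth_mem[OF that] unfolding gate_def by blast
    then show ?thesis using gate_vdist[OF G g _ i, of "vs ! t"] that g by (simp add: gate_def)
  qed
  then show ?thesis using ab by (simp add: edist_edge)
qed

text \<open>
  The reflection of the cycle that exchanges the ends of an edge pairs the cycle edges closer to one
  end with those closer to the other.
\<close>

lemma cycle_edges_balanced:
  assumes G: "simple_graph G" "connected_graph G" and g: "gate G vs \<pi>"
    and i: "i < length vs"
  shows "(\<Sum>f\<in>cycle_edges vs.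
    sgn (int (edist G f (vs ! (Suc i mod length vs))) - int (edist G f (vs ! i)))) = 0"
proof -
  let ?l = "length vs" and ?u = "vs ! i" and ?v = "vs ! (Suc i mod length vs)"
  let ?r = "reflect (length vs) i"
  define R where "R x = vs ! ?r (\<pi> x)" for x
  have si: "Suc i mod ?l < ?l" using Suc_mod_less[OF i] .
  have \<pi>: "\<pi> (vs ! t) = t" if "t < ?l" for t using g that by (simp add: gate_def)
  note rl = reflect_less[OF i]
  have R: "R (vs ! t) = vs ! ?r t" if "t < ?l" for t using \<pi>[OF that] by (simp add: R_def)
  have props: "R ` f \<in> cycle_edges vs \<and> R ` R ` f = f \<and>
      edist G (R ` f) ?u = edist G f ?v \<and> edist G (R ` f) ?v = edist G f ?u"
    if f: "f \<in> cycle_edges vs" for f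
  proof -
    obtain a where a: "a < ?l" "f = {vs ! a, vs ! (Suc a mod ?l)}"
      using f by (auto simp: cycle_edges_image)
    let ?s = "Suc a mod ?l"
    have s: "?s < ?l" using Suc_mod_less[OF a(1)] .
    have Rf: "R ` f = {vs ! ?r ?s, vs ! ?r a}" using R a s by auto
    then have "R ` f \<in> cycle_edges vs"
      using cycle_edgesI[of "?r ?s" vs] rl reflect_Suc[OF i a(1)] by simp
    moreover have "R ` R ` f = f"
      unfolding Rf using R rl reflect_reflect[OF i] a s by auto
    moreover have "cdist ?l (?r t) i = cdist ?l t (Suc i mod ?l)"
      "cdist ?l (?r t) (Suc i mod ?l) = cdist ?l t i" if "t < ?l" for t
      using cdist_reflect[OF i that] cdist_reflect[OF i rl, of t] reflect_reflect[OF i that] by auto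
    then have "edist G (R ` f) ?u = edist G f ?v \<and> edist G (R ` f) ?v = edist G f ?u"
      unfolding Rf unfolding a(2) using a s by (simp add: gate_edist_cycle[OF G g] rl i si min.commute)
    ultimately show ?thesis by blast
  qed
  have "(\<Sum>f\<in>cycle_edges vs. sgn (int (edist G f ?v) - int (edist G f ?u)))
    = (\<Sum>f\<in>cycle_edges vs. sgn (int (edist G f ?u) - int (edist G f ?v)))"
    by (rule sum.reindex_bij_witness[where i = "image R" and j = "image R"]) (use props in auto)
  also have "\<dots> = - (\<Sum>f\<in>cycle_edges vs. sgn (int (edist G f ?v) - int (edist G f ?u)))"
    unfolding sum_negf[symmetric] by (rule sum.cong) (auto simp: sgn_if)
  finally show ?thesis by simp
qed

lemma gate_off_edge:
  assumes G: "simple_graph G" and g: "gate G vs \<pi>" and f: "f \<in> edges G - cycle_edges vs"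
  obtains j where "j < length vs" "\<pi> ` f = {j}"
proof -
  obtain x y where xy: "f = {x, y}" "x \<in> verts G" "y \<in> verts G" using edgeE[OF G, of f] f by blast
  then have "\<pi> x = \<pi> y" "\<pi> x < length vs" using g f by (auto simp: gate_def)
  then show thesis using that[of "\<pi> x"] xy by auto
qed

text \<open>
  The distance to the gate is common to all distances from \<open>f\<close> to the cycle, so it does not affect
  which end of a cycle edge is closer.
\<close>

lemma gate_edist_off:
  assumes G: "simple_graph G" "connected_graph G" and g: "gate G vs \<pi>"
    and f: "f \<in> edges G - cycle_edges vs" "\<pi> ` f = {j}" and i: "i < length vs"
  shows "edist G f (vs ! i) = edist G f (vs ! j) + cdist (length vs) j i"
proof -
  have "f \<in> edges G" using f(1) by simp
  then obtain x y where xy: "f = {x, y}" "x \<noteq> y" "x \<in> verts G" "y \<in> verts G" using edgeE[OF G(1)] by blast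
  then have "\<pi> x = j" "\<pi> y = j" using f(2) by auto
  then show ?thesis using gate_vdist[OF G g _ i] xy by (simp add: edist_edge)
qed

lemma gate_weight_sum:
  fixes g :: "nat \<Rightarrow> int"
  assumes G: "simple_graph G" and gt: "gate G vs \<pi>"
  shows "(\<Sum>f\<in>edges G - cycle_edges vs. g (Min (\<pi> ` f)))
    = (\<Sum>j<length vs. int (gate_weight G vs \<pi> j) * g j)"
proof -
  let ?F = "edges G - cycle_edges vs"
  have q: "\<pi> ` f = {Min (\<pi> ` f)} \<and> Min (\<pi> ` f) < length vs" if f: "f \<in> ?F" for f
    using gate_off_edge[OF G gt f] by (metis Min_singleton)
  have "(\<Sum>f\<in>?F. g (Min (\<pi> ` f)))
      = (\<Sum>j<length vs. \<Sum>f\<in>{f \<in> ?F. Min (\<pi> ` f) = j}. g (Min (\<pi> ` f)))"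
    by (rule sum.group[symmetric]) (use q finite_edges[OF G] in auto)
  also have "\<dots> = (\<Sum>j<length vs. int (gate_weight G vs \<pi> j) * g j)"
  proof (rule sum.cong[OF refl])
    fix j
    have "{f \<in> ?F. Min (\<pi> ` f) = j} = {f \<in> ?F. \<pi> ` f = {j}}"
      using q by (metis (no_types, lifting) Min_singleton)
    then show "(\<Sum>f\<in>{f \<in> ?F. Min (\<pi> ` f) = j}. g (Min (\<pi> ` f))) = int (gate_weight G vs \<pi> j) * g j"
      by (simp add: gate_weight_def)
  qed
  finally show ?thesis .
qed

lemma gate_weight_total:
  assumes G: "simple_graph G" and gt: "gate G vs \<pi>"
  shows "int (card (edges G)) - int (card (cycle_edges vs)) = (\<Sum>j<length vs. int (gate_weight G vs \<pi> j))"
proof -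
  have "cycle_edges vs \<subseteq> edges G" using gt by (simp add: gate_def)
  then have "int (card (edges G - cycle_edges vs)) = int (card (edges G)) - int (card (cycle_edges vs))"
    using finite_edges[OF G] by (simp add: card_Diff_subset finite_cycle_edges card_mono of_nat_diff)
  then show ?thesis using gate_weight_sum[OF assms, of "\<lambda>_. 1"] by simp
qed

text \<open>The difference \<open>m\<^sub>u - m\<^sub>v\<close> for the cycle edge at index \<open>i\<close>, in terms of the weights.\<close>

definition gate_diff :: "'a sgraph \<Rightarrow> 'a list \<Rightarrow> ('a \<Rightarrow> nat) \<Rightarrow> nat \<Rightarrow> int" where
  "gate_diff G vs \<pi> i = (\<Sum>j<length vs. int (gate_weight G vs \<pi> j) *
     sgn (int (cdist (length vs) j (Suc i mod length vs)) - int (cdist (length vs) j i)))"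

lemma closer_diff_gate:
  assumes G: "simple_graph G" "connected_graph G" and g: "gate G vs \<pi>"
    and i: "i < length vs"
  shows "int (m_closer G (vs ! i) (vs ! (Suc i mod length vs)))
    - int (m_closer G (vs ! (Suc i mod length vs)) (vs ! i)) = gate_diff G vs \<pi> i"
proof -
  let ?u = "vs ! i" and ?v = "vs ! (Suc i mod length vs)" and ?l = "length vs"
  let ?d = "\<lambda>f. sgn (int (edist G f ?v) - int (edist G f ?u))"
  have sub: "cycle_edges vs \<subseteq> edges G" using g by (simp add: gate_def)
  have "int (m_closer G ?u ?v) - int (m_closer G ?v ?u) = (\<Sum>f\<in>edges G. ?d f)"
    by (rule closer_diff[OF finite_edges[OF G(1)]])
  also have "\<dots> = (\<Sum>f\<in>edges G - cycle_edges vs. ?d f) + (\<Sum>f\<in>cycle_edges vs. ?d f)"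
    by (rule sum.subset_diff[OF sub finite_edges[OF G(1)]])
  also have "(\<Sum>f\<in>cycle_edges vs. ?d f) = 0" by (rule cycle_edges_balanced[OF G g i])
  also have "(\<Sum>f\<in>edges G - cycle_edges vs. ?d f) = (\<Sum>f\<in>edges G - cycle_edges vs.
      sgn (int (cdist ?l (Min (\<pi> ` f)) (Suc i mod ?l)) - int (cdist ?l (Min (\<pi> ` f)) i)))"
  proof (rule sum.cong[OF refl])
    fix f assume f: "f \<in> edges G - cycle_edges vs"
    obtain j where j: "\<pi> ` f = {j}" using gate_off_edge[OF G(1) g f] .
    show "?d f = sgn (int (cdist ?l (Min (\<pi> ` f)) (Suc i mod ?l)) - int (cdist ?l (Min (\<pi> ` f)) i))"
      using gate_edist_off[OF G g f j] i Suc_mod_less[OF i] j by simp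
  qed
  also have "\<dots> = gate_diff G vs \<pi> i"
    unfolding gate_diff_def by (rule gate_weight_sum[OF G(1) g])
  finally show ?thesis by simp
qed

lemma gate_Sz_term:
  assumes "simple_graph G" "connected_graph G" "gate G vs \<pi>" "i < length vs" "card (edges G) = m"
  shows "4 * Sz_term G {vs ! i, vs ! (Suc i mod length vs)} = (real m)\<^sup>2 - (real_of_int (gate_diff G vs \<pi> i))\<^sup>2"
  using Sz_term_diff[OF finite_edges _ closer_diff_gate] assms by blast

lemma gate_diff_bound:
  assumes "simple_graph G" "gate G vs \<pi>" "i < length vs"
  shows "\<bar>gate_diff G vs \<pi> i\<bar> \<le> int (card (edges G)) - int (card (cycle_edges vs))"
proof -
  let ?w = "\<lambda>j. int (gate_weight G vs \<pi> j)"
  let ?s = "\<lambda>j. sgn (int (cdist (length vs) j (Suc i mod length vs)) - int (cdist (length vs) j i))"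
  have "\<bar>gate_diff G vs \<pi> i\<bar> \<le> (\<Sum>j<length vs. \<bar>?w j * ?s j\<bar>)"
    unfolding gate_diff_def by (rule sum_abs)
  also have "\<dots> \<le> (\<Sum>j<length vs. ?w j)"
    by (rule sum_mono) (auto simp: abs_mult sgn_if)
  also have "\<dots> = int (card (edges G)) - int (card (cycle_edges vs))"
    using gate_weight_total[OF assms(1,2)] by simp
  finally show ?thesis .
qed

section \<open>Excess over the bouquet of quadrangles\<close>

text \<open>
  An edge is compared with a pendant edge, whose summand is \<open>(2 m - 1) / 4\<close>. A cycle of length \<open>l\<close>
  replaces one quadrangle and \<open>l - 4\<close> pendant edges of the bouquet; since \<open>excess\<close> subtracts
  \<open>2 m - 1\<close> for each of its \<open>l\<close> edges, what remains to be subtracted is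
  \<open>4 (8 m - 16) - 4 (2 m - 1) = 24 m - 60\<close>.
\<close>

definition excess :: "'a sgraph \<Rightarrow> 'a set \<Rightarrow> real" where
  "excess G e = 4 * Sz_term G e - (2 * real (card (edges G)) - 1)"

definition cycle_excess :: "'a sgraph \<Rightarrow> 'a set set \<Rightarrow> real" where
  "cycle_excess G C = (\<Sum>e\<in>C. excess G e) - (24 * real (card (edges G)) - 60)"

definition bridges :: "'a sgraph \<Rightarrow> 'a set set" where
  "bridges G = edges G - \<Union>(cycles G)"

lemma Szeged_excess:
  assumes G: "cactus G" and m: "card (edges G) = m" and k: "card (cycles G) = k"
  shows "4 * edge_revised_Szeged G = 2 * real m ^ 2 - real m + 4 * real k * (6 * real m - 15)
    + (\<Sum>e\<in>bridges G. excess G e) + (\<Sum>C\<in>cycles G. cycle_excess G C)"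
proof -
  have sG: "simple_graph G" using G by (simp add: cactus_def)
  have sub: "\<Union>(cycles G) \<subseteq> edges G" by (auto elim!: cyclesE)
  have "(\<Sum>e\<in>edges G. excess G e) = (\<Sum>e\<in>bridges G. excess G e) + (\<Sum>e\<in>\<Union>(cycles G). excess G e)"
    unfolding bridges_def by (rule sum.subset_diff[OF sub finite_edges[OF sG]])
  also have "(\<Sum>e\<in>\<Union>(cycles G). excess G e) = (\<Sum>C\<in>cycles G. \<Sum>e\<in>C. excess G e)"
  proof (rule sum.Union_disjoint[unfolded comp_def])
    show "\<forall>C\<in>cycles G. finite C" by (auto elim!: cyclesE simp: finite_cycle_edges)
    show "\<forall>C\<in>cycles G. \<forall>D\<in>cycles G. C \<noteq> D \<longrightarrow> C \<inter> D = {}"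
      using cactus_cycles_edge_disjoint[OF G] by blast
  qed
  also have "\<dots> = (\<Sum>C\<in>cycles G. cycle_excess G C) + real k * (24 * real m - 60)"
    by (simp add: cycle_excess_def sum_subtractf k m)
  finally have "(\<Sum>e\<in>edges G. excess G e) = (\<Sum>e\<in>bridges G. excess G e)
    + (\<Sum>C\<in>cycles G. cycle_excess G C) + real k * (24 * real m - 60)" by simp
  moreover have "(\<Sum>e\<in>edges G. excess G e) = 4 * edge_revised_Szeged G - real m * (2 * real m - 1)"
    by (simp add: excess_def edge_revised_Szeged_def sum_subtractf sum_distrib_left m)
  ultimately show ?thesis by (simp add: power2_eq_square algebra_simps)
qed

lemma connected_closed_set:
  assumes "connected_graph G" "x \<in> S" "x \<in> verts G" "z \<in> verts G"
    and closed: "\<And>a b. \<lbrakk>a \<in> S; {a, b} \<in> edges G\<rbrakk> \<Longrightarrow> b \<in> S"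
  shows "z \<in> S"
proof -
  have "(x, z) \<in> (adj G)\<^sup>*" using assms by (simp add: connected_graph_def)
  then show ?thesis
    by (induction rule: rtrancl_induct) (use assms in \<open>auto simp: adj_def\<close>)
qed

lemma edge_verts: "simple_graph G \<Longrightarrow> {a, b} \<in> edges G \<Longrightarrow> a \<in> verts G \<and> b \<in> verts G \<and> a \<noteq> b"
  by (auto simp: simple_graph_def dest!: bspec)

text \<open>
  If no further edge left the gate of \<open>x\<close>, the vertices hanging there would be cut off from it.
  Thus an empty or one-edge part at a vertex can be recognised from the edges at that vertex.
\<close>

lemma gate_off_nbr:
  assumes G: "simple_graph G" "connected_graph G" and g: "gate G vs \<pi>"
    and x: "x \<in> verts G" "x \<noteq> vs ! \<pi> x"
  shows "\<exists>y. {vs ! \<pi> x, y} \<in> edges G - cycle_edges vs"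
proof (rule ccontr)
  assume no: "\<not> ?thesis"
  let ?j = "\<pi> x"
  have j: "?j < length vs" using g x by (auto simp: gate_def)
  then have "vs ! ?j \<in> verts G" using g nth_mem[OF j] by (auto simp: gate_def)
  have "vs ! ?j \<in> {y. \<pi> y = ?j \<and> y \<noteq> vs ! ?j}"
  proof (rule connected_closed_set[OF G(2) _ x(1) \<open>vs ! ?j \<in> verts G\<close>])
    fix a b assume a: "a \<in> {y. \<pi> y = ?j \<and> y \<noteq> vs ! ?j}" and ab: "{a, b} \<in> edges G"
    have "a \<notin> set vs" using a g by (auto simp: gate_def in_set_conv_nth)
    then have "{a, b} \<notin> cycle_edges vs" using Union_cycle_edges[of vs] by blast
    then show "b \<in> {y. \<pi> y = ?j \<and> y \<noteq> vs ! ?j}"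
      using a ab g no by (auto simp: gate_def insert_commute)
  qed (use x in simp)
  then show False by simp
qed

lemma gate_edge_at:
  assumes G: "simple_graph G" and g: "gate G vs \<pi>" and j: "j < length vs"
    and e: "e \<in> edges G - cycle_edges vs" "vs ! j \<in> e"
  shows "e \<in> {f \<in> edges G - cycle_edges vs. \<pi> ` f = {j}}"
proof -
  obtain i where i: "\<pi> ` e = {i}" using gate_off_edge[OF G g e(1)] .
  then have "i = j" using e(2) g j by (force simp: gate_def)
  then show ?thesis using e i by simp
qed

lemma finite_off_edges: "simple_graph G \<Longrightarrow> finite {f \<in> edges G - cycle_edges vs. \<pi> ` f = {j}}"
  by (rule finite_subset[OF _ finite_edges]) auto

lemma gate_weight_eq_0_iff:
  assumes G: "simple_graph G" "connected_graph G" and g: "gate G vs \<pi>" and j: "j < length vs"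
  shows "gate_weight G vs \<pi> j = 0 \<longleftrightarrow> (\<forall>e\<in>edges G. vs ! j \<in> e \<longrightarrow> e \<in> cycle_edges vs)"
proof
  assume "gate_weight G vs \<pi> j = 0"
  then have "{f \<in> edges G - cycle_edges vs. \<pi> ` f = {j}} = {}"
    unfolding gate_weight_def by (rule card_0_eq[OF finite_off_edges[OF G(1)], THEN iffD1])
  then show "\<forall>e\<in>edges G. vs ! j \<in> e \<longrightarrow> e \<in> cycle_edges vs"
    using gate_edge_at[OF G(1) g j] by blast
next
  assume on: "\<forall>e\<in>edges G. vs ! j \<in> e \<longrightarrow> e \<in> cycle_edges vs"
  have False if f: "f \<in> edges G - cycle_edges vs" "\<pi> ` f = {j}" for f
  proof -
    obtain x y where xy: "f = {x, y}" "x \<in> verts G" using edgeE[OF G(1), of f] f(1) by blast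
    then have "\<pi> x = j" "x \<noteq> vs ! j" using f on by auto
    then obtain y where "{vs ! j, y} \<in> edges G - cycle_edges vs"
      using gate_off_nbr[OF G g xy(2)] by auto
    then show False using on by blast
  qed
  then show "gate_weight G vs \<pi> j = 0" unfolding gate_weight_def by (metis (mono_tags, lifting) Collect_empty_eq card.empty)
qed

subsection \<open>Bridges\<close>

text \<open>
  The edge \<open>e\<close> ends at the leaf \<open>v\<close>; respectively, it ends at a vertex \<open>p\<close> from which a single
  edge leads on to the leaf \<open>w\<close>. These are the bridges with no edge, or exactly one edge, on one side.
\<close>

definition pendant_edge :: "'a sgraph \<Rightarrow> 'a set \<Rightarrow> 'a \<Rightarrow> bool" where
  "pendant_edge G e v \<longleftrightarrow> e \<in> edges G \<and> v \<in> e \<and> (\<forall>f\<in>edges G. v \<in> f \<longrightarrow> f = e)"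

definition tail_edge :: "'a sgraph \<Rightarrow> 'a set \<Rightarrow> 'a \<Rightarrow> 'a \<Rightarrow> bool" where
  "tail_edge G e p w \<longleftrightarrow> e \<in> edges G \<and> p \<in> e \<and> w \<notin> e \<and>
     (\<forall>f\<in>edges G. p \<in> f \<longrightarrow> f = e \<or> f = {p, w}) \<and> pendant_edge G {p, w} w"

lemma gate_edge_side:
  assumes G: "simple_graph G" "connected_graph G" and g: "gate G [u, v] \<pi>"
  shows "gate_weight G [u, v] \<pi> 1 = 0 \<longleftrightarrow> pendant_edge G {u, v} v"
    "gate_weight G [u, v] \<pi> 1 = 1 \<longleftrightarrow> (\<exists>w. tail_edge G {u, v} v w)"
proof -
  have uv: "{u, v} \<in> edges G" "u \<in> verts G" "v \<in> verts G" "u \<noteq> v"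
    using g by (auto simp: gate_def cycle_edges_two)
  have ends: "\<pi> ([u, v] ! i) = i" if "i < 2" for i
    using g that by (simp add: gate_def)
  have \<pi>: "\<pi> u = 0" "\<pi> v = 1" "\<And>a b. {a, b} \<in> edges G \<Longrightarrow> {a, b} \<noteq> {u, v} \<Longrightarrow> \<pi> a = \<pi> b"
    using ends[of 0] ends[of 1] g by (auto simp: gate_def cycle_edges_two)
  let ?F = "{f \<in> edges G - cycle_edges [u, v]. \<pi> ` f = {1}}"
  show "gate_weight G [u, v] \<pi> 1 = 0 \<longleftrightarrow> pendant_edge G {u, v} v"
    using gate_weight_eq_0_iff[OF G g, of 1] uv by (auto simp: cycle_edges_two pendant_edge_def)
  show "gate_weight G [u, v] \<pi> 1 = 1 \<longleftrightarrow> (\<exists>w. tail_edge G {u, v} v w)"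
  proof
    assume "gate_weight G [u, v] \<pi> 1 = 1"
    then obtain f where f: "?F = {f}" unfolding gate_weight_def using card_1_singletonE by blast
    obtain x y where xy: "f = {x, y}" "x \<noteq> y" "x \<in> verts G" "y \<in> verts G"
      using edgeE[OF G(1), of f] f by blast
    have \<pi>f: "\<pi> x = 1" "\<pi> y = 1" using f xy by auto
    have "\<exists>z. {[u, v] ! 1, z} \<in> edges G - cycle_edges [u, v]"
      using gate_off_nbr[OF G g, of x] gate_off_nbr[OF G g, of y] xy \<pi>f by fastforce
    then obtain z where z: "{v, z} \<in> edges G - cycle_edges [u, v]" by auto
    have at_v: "e = f" if "e \<in> edges G - cycle_edges [u, v]" "v \<in> e" for e
      using gate_edge_at[OF G(1) g, of 1 e] that f by auto
    then have fz: "f = {v, z}" using z by blast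
    then have zuv: "z \<noteq> u" "z \<noteq> v" using z edge_verts[OF G(1), of v z] by (auto simp: cycle_edges_two insert_commute)
    have "\<pi> z = 1" using fz f by auto
    have at_z: "e = f" if e: "e \<in> edges G" "z \<in> e" for e
    proof -
      obtain a b where ab: "e = {a, b}" using edgeE[OF G(1) e(1)] .
      have "e \<noteq> {u, v}" using e zuv by auto
      then have "e \<in> edges G - cycle_edges [u, v]" using e by (simp add: cycle_edges_two)
      moreover have "\<pi> ` e = {1}"
        using \<pi>(3)[of a b] \<open>e \<noteq> {u, v}\<close> ab e \<open>\<pi> z = 1\<close> by auto
      ultimately show ?thesis using f by blast
    qed
    have "pendant_edge G {v, z} z" using z at_z fz by (simp add: pendant_edge_def)
    moreover have "e = {u, v} \<or> e = {v, z}" if "e \<in> edges G" "v \<in> e" for e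
      using at_v[of e] that fz by (auto simp: cycle_edges_two)
    ultimately have "tail_edge G {u, v} v z"
      unfolding tail_edge_def using uv zuv by simp
    then show "\<exists>w. tail_edge G {u, v} v w" ..
  next
    assume "\<exists>w. tail_edge G {u, v} v w"
    then obtain w where w: "tail_edge G {u, v} v w" ..
    then have vw: "{v, w} \<in> edges G" "w \<noteq> u" "w \<noteq> v" by (auto simp: tail_edge_def pendant_edge_def)
    have at: "f = {u, v} \<or> f = {v, w}" if "f \<in> edges G" "v \<in> f \<or> w \<in> f" for f
      using that w by (auto simp: tail_edge_def pendant_edge_def)
    have "{v, w} \<in> ?F" using vw \<pi> \<pi>(3)[OF vw(1)] by (auto simp: cycle_edges_two doubleton_eq_iff)
    moreover have "f = {v, w}" if f: "f \<in> ?F" for f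
    proof (rule ccontr)
      assume ne: "f \<noteq> {v, w}"
      obtain x y where xy: "f = {x, y}" "x \<in> verts G" using edgeE[OF G(1), of f] f by blast
      have x: "\<pi> x = 1" "x \<noteq> v" "x \<noteq> w" using f ne at[of f] xy by (auto simp: cycle_edges_two)
      let ?S = "{z. \<pi> z = 1 \<and> z \<noteq> v \<and> z \<noteq> w}"
      have "v \<in> ?S"
      proof (rule connected_closed_set[OF G(2) _ xy(2) uv(3)])
        fix a b assume a: "a \<in> ?S" and ab: "{a, b} \<in> edges G"
        have "a \<noteq> u" using a \<pi>(1) by auto
        then have "{a, b} \<noteq> {u, v}" "{a, b} \<noteq> {v, w}" using a by auto
        then show "b \<in> ?S" using a \<pi>(3)[OF ab] at[OF ab] by auto
      qed (use x in simp)
      then show False by simp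
    qed
    ultimately have "?F = {{v, w}}" by blast
    then show "gate_weight G [u, v] \<pi> 1 = 1" by (simp add: gate_weight_def)
  qed
qed

lemma gate_edge_swap:
  assumes g: "gate G [u, v] \<pi>"
  obtains \<pi>' where "gate G [v, u] \<pi>'" "gate_weight G [v, u] \<pi>' 1 = gate_weight G [u, v] \<pi> 0"
proof
  let ?\<pi>' = "\<lambda>x. 1 - \<pi> x"
  have c: "cycle_edges [v, u] = cycle_edges [u, v]" by (simp add: cycle_edges_two insert_commute)
  show "gate G [v, u] ?\<pi>'"
    using g unfolding gate_def c by (auto simp: less_Suc_eq)
  have img: "q ` f = {c} \<longleftrightarrow> f \<noteq> {} \<and> (\<forall>x\<in>f. q x = c)" for q :: "'a \<Rightarrow> nat" and f c by auto
  have "?\<pi>' ` f = {1} \<longleftrightarrow> \<pi> ` f = {0}" for f unfolding img by auto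
  then show "gate_weight G [v, u] ?\<pi>' 1 = gate_weight G [u, v] \<pi> 0"
    unfolding gate_weight_def c by simp
qed

text \<open>
  With \<open>a\<close> and \<open>b\<close> edges on the two sides, \<open>m\<^sub>u - m\<^sub>v = a - b\<close> and \<open>a + b = m - 1\<close>, so that
  \<open>m\<^sup>2 - (a - b)\<^sup>2 - (2 m - 1) = (a + b)\<^sup>2 - (a - b)\<^sup>2\<close>.
\<close>

lemma bridge_excess:
  assumes G: "cactus G" and m: "card (edges G) = m" and e: "e \<in> bridges G" and uv: "e = {u, v}"
  obtains a b where "a + b + 1 = m" "excess G e = 4 * real a * real b"
    "a = 0 \<longleftrightarrow> pendant_edge G e u" "b = 0 \<longleftrightarrow> pendant_edge G e v"
    "a = 1 \<longleftrightarrow> (\<exists>w. tail_edge G e u w)" "b = 1 \<longleftrightarrow> (\<exists>w. tail_edge G e v w)"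
proof -
  have sG: "simple_graph G" "connected_graph G" using G by (auto simp: cactus_def)
  have "cut_edge G {u, v}" using cactus_edge_cases[OF G, of e] e uv by (auto simp: bridges_def)
  then obtain \<pi> where g: "gate G [u, v] \<pi>" using cut_edge_gate[OF sG] by blast
  obtain \<pi>' where g': "gate G [v, u] \<pi>'" "gate_weight G [v, u] \<pi>' 1 = gate_weight G [u, v] \<pi> 0"
    using gate_edge_swap[OF g] .
  let ?a = "gate_weight G [u, v] \<pi> 0" and ?b = "gate_weight G [u, v] \<pi> 1"
  have "int m - 1 = int ?a + int ?b"
    using gate_weight_total[OF sG(1) g] m by (simp add: cycle_edges_two lessThan_Suc)
  then have ab: "?a + ?b + 1 = m" by linarith
  have "gate_diff G [u, v] \<pi> 0 = int ?a - int ?b"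
    by (simp add: gate_diff_def lessThan_Suc cdist_def)
  then have "4 * Sz_term G {u, v} = (real m)\<^sup>2 - (real ?a - real ?b)\<^sup>2"
    using gate_Sz_term[OF sG g, of 0 m] m by simp
  then have "excess G e = 4 * real ?a * real ?b"
    unfolding excess_def uv m using ab[symmetric] by (simp add: power2_eq_square algebra_simps)
  then show thesis
    using that[OF ab] gate_edge_side[OF sG g] gate_edge_side[OF sG g'(1)] g'(2) uv
    by (simp add: insert_commute)
qed

subsection \<open>Cycles\<close>

text \<open>The cycle \<open>C\<close> is an end block of \<open>G\<close>, attached to the rest of the graph at \<open>h\<close> only.\<close>

definition end_cycle :: "'a sgraph \<Rightarrow> 'a set set \<Rightarrow> 'a \<Rightarrow> bool" where
  "end_cycle G C h \<longleftrightarrow> C \<in> cycles G \<and> h \<in> \<Union>C \<and> (\<forall>y\<in>\<Union>C - {h}. \<forall>e\<in>edges G. y \<in> e \<longrightarrow> e \<in> C)"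

lemma end_cycle_gate:
  assumes G: "simple_graph G" "connected_graph G" and g: "gate G vs \<pi>" and C: "cycle_edges vs \<in> cycles G"
  shows "(\<exists>h. end_cycle G (cycle_edges vs) h) \<longleftrightarrow>
    (\<exists>t<length vs. \<forall>j<length vs. j \<noteq> t \<longrightarrow> gate_weight G vs \<pi> j = 0)"
proof -
  have d: "distinct vs" using g by (simp add: gate_def)
  have *: "end_cycle G (cycle_edges vs) (vs ! t) \<longleftrightarrow>
    (\<forall>j<length vs. j \<noteq> t \<longrightarrow> gate_weight G vs \<pi> j = 0)" if t: "t < length vs" for t
  proof -
    have "(\<forall>j<length vs. j \<noteq> t \<longrightarrow> gate_weight G vs \<pi> j = 0) \<longleftrightarrow>
      (\<forall>j<length vs. j \<noteq> t \<longrightarrow> (\<forall>e\<in>edges G. vs ! j \<in> e \<longrightarrow> e \<in> cycle_edges vs))"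
      using gate_weight_eq_0_iff[OF G g] by simp
    also have "\<dots> \<longleftrightarrow> (\<forall>y\<in>set vs - {vs ! t}. \<forall>e\<in>edges G. y \<in> e \<longrightarrow> e \<in> cycle_edges vs)"
    proof -
      have "set vs - {vs ! t} = (!) vs ` {j. j < length vs \<and> j \<noteq> t}"
        using nth_eq_iff_index_eq[OF d _ t] by (auto simp: in_set_conv_nth)
      then show ?thesis by auto
    qed
    finally show ?thesis using C t by (simp add: end_cycle_def Union_cycle_edges)
  qed
  show ?thesis
  proof
    assume "\<exists>h. end_cycle G (cycle_edges vs) h"
    then obtain h where h: "end_cycle G (cycle_edges vs) h" ..
    then obtain t where "t < length vs" "h = vs ! t"
      by (auto simp: end_cycle_def Union_cycle_edges in_set_conv_nth)
    then show "\<exists>t<length vs. \<forall>j<length vs. j \<noteq> t \<longrightarrow> gate_weight G vs \<pi> j = 0" using * h by blast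
  qed (use * in blast)
qed

lemma cycle_gate_profile:
  assumes G: "cactus G" and C: "C \<in> cycles G" and m: "card (edges G) = m"
  obtains vs \<pi> where "C = cycle_edges vs" "3 \<le> length vs" "distinct vs" "gate G vs \<pi>" "card C = length vs"
    "int m - int (card C) = (\<Sum>j<length vs. int (gate_weight G vs \<pi> j))"
    "cycle_excess G C = (\<Sum>i<length vs. (real m)\<^sup>2 - (real_of_int (gate_diff G vs \<pi> i))\<^sup>2 - (2 * real m - 1))
       - (24 * real m - 60)"
    "(\<exists>h. end_cycle G C h) \<longleftrightarrow> (\<exists>t<length vs. \<forall>j<length vs. j \<noteq> t \<longrightarrow> gate_weight G vs \<pi> j = 0)"
proof -
  have sG: "simple_graph G" "connected_graph G" using G by (auto simp: cactus_def)
  obtain vs where vs: "C = cycle_edges vs" "3 \<le> length vs" "distinct vs" "set vs \<subseteq> verts G"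
    "cycle_edges vs \<subseteq> edges G" using cyclesE[OF C] .
  obtain \<pi> where g: "gate G vs \<pi>" using cactus_cycle_gate[OF G vs(2-5)] .
  have card: "card C = length vs" using card_cycle_edges vs by blast
  show thesis
  proof (rule that[OF vs(1-3) g card])
    show "int m - int (card C) = (\<Sum>j<length vs. int (gate_weight G vs \<pi> j))"
      using gate_weight_total[OF sG(1) g] m vs(1) by simp
    have "(\<Sum>e\<in>C. excess G e) = (\<Sum>i<length vs. excess G {vs ! i, vs ! (Suc i mod length vs)})"
      unfolding vs(1) by (rule sum_cycle_edges[OF vs(3,2)])
    also have "\<dots> = (\<Sum>i<length vs. (real m)\<^sup>2 - (real_of_int (gate_diff G vs \<pi> i))\<^sup>2 - (2 * real m - 1))"
      by (rule sum.cong) (use gate_Sz_term[OF sG g _ m] m in \<open>auto simp: excess_def\<close>)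
    finally show "cycle_excess G C = (\<Sum>i<length vs. (real m)\<^sup>2 - (real_of_int (gate_diff G vs \<pi> i))\<^sup>2 - (2 * real m - 1))
       - (24 * real m - 60)" by (simp add: cycle_excess_def m)
    show "(\<exists>h. end_cycle G C h) \<longleftrightarrow> (\<exists>t<length vs. \<forall>j<length vs. j \<noteq> t \<longrightarrow> gate_weight G vs \<pi> j = 0)"
      using end_cycle_gate[OF sG g] C vs(1) by simp
  qed
qed

lemma nat_mult_ge_sum: "0 < a \<Longrightarrow> 0 < b \<Longrightarrow> a + b \<le> a * b + (1::nat)"
  by (cases a; cases b) auto

lemma all_but_one_zero_4:
  "(\<exists>t<4. \<forall>j<4. j \<noteq> t \<longrightarrow> f j = 0) \<longleftrightarrow> f 1 + f 2 + f 3 = 0 \<or> f 0 + f 2 + f 3 = 0 \<or> f 0 + f 1 + f 3 = 0 \<or> f 0 + f 1 + f 2 = (0::nat)" for f :: "nat \<Rightarrow> nat"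
proof -
  have four: "{..<4::nat} = {0, 1, 2, 3}" by auto
  have "(\<exists>t<4. \<forall>j<4. j \<noteq> t \<longrightarrow> f j = 0) \<longleftrightarrow> (\<exists>t\<in>{..<4}. \<forall>j\<in>{..<4}. j \<noteq> t \<longrightarrow> f j = 0)" by (simp add: Bex_def Ball_def)
  then show ?thesis unfolding four by simp
qed

lemma all_but_one_zero_3:
  "(\<exists>t<3. \<forall>j<3. j \<noteq> t \<longrightarrow> f j = 0) \<longleftrightarrow> f 1 + f 2 = 0 \<or> f 0 + f 2 = 0 \<or> f 0 + f 1 = (0::nat)" for f :: "nat \<Rightarrow> nat"
proof -
  have three: "{..<3::nat} = {0, 1, 2}" by auto
  have "(\<exists>t<3. \<forall>j<3. j \<noteq> t \<longrightarrow> f j = 0) \<longleftrightarrow> (\<exists>t\<in>{..<3}. \<forall>j\<in>{..<3}. j \<noteq> t \<longrightarrow> f j = 0)" by (simp add: Bex_def Ball_def)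
  then show ?thesis unfolding three by simp
qed

text \<open>
  Opposite edges of a quadrangle split it the same way, so with weights \<open>a, b, c, d\<close> around the
  quadrangle the excess is \<open>8 ((a + d) (b + c) + (a + b) (c + d))\<close>. If two weights are positive, at
  least one of the two splits separates them.
\<close>

lemma quadrangle_excess:
  assumes G: "cactus G" and C: "C \<in> cycles G" and m: "card (edges G) = m" and l: "card C = 4"
  shows "(\<exists>h. end_cycle G C h) \<Longrightarrow> cycle_excess G C = 0"
    "\<nexists>h. end_cycle G C h \<Longrightarrow> cycle_excess G C \<ge> 8 * real m - 40"
proof -
  obtain vs \<pi> where ring: "C = cycle_edges vs" "3 \<le> length vs" "distinct vs" "gate G vs \<pi>"
    "card C = length vs"
    "int m - int (card C) = (\<Sum>j<length vs. int (gate_weight G vs \<pi> j))"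
    "cycle_excess G C = (\<Sum>i<length vs. (real m)\<^sup>2 - (real_of_int (gate_diff G vs \<pi> i))\<^sup>2 - (2 * real m - 1))
       - (24 * real m - 60)"
    "(\<exists>h. end_cycle G C h) \<longleftrightarrow> (\<exists>t<length vs. \<forall>j<length vs. j \<noteq> t \<longrightarrow> gate_weight G vs \<pi> j = 0)"
    using cycle_gate_profile[OF G C m] .
  note vs = ring(1,5-8)
  define a b c d where w: "a = gate_weight G vs \<pi> 0" "b = gate_weight G vs \<pi> 1"
    "c = gate_weight G vs \<pi> 2" "d = gate_weight G vs \<pi> 3"
  have len: "length vs = 4" using vs(2) l by simp
  have four: "{..<4::nat} = {0, 1, 2, 3}" by auto
  have tot: "int m - 4 = int a + int b + int c + int d"
    using vs(3) l len by (simp add: four w)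
  have D: "gate_diff G vs \<pi> 0 = int a + int d - int b - int c"
    "gate_diff G vs \<pi> 1 = int a + int b - int c - int d"
    "gate_diff G vs \<pi> 2 = int b + int c - int a - int d"
    "gate_diff G vs \<pi> 3 = int c + int d - int a - int b"
    unfolding gate_diff_def len four by (simp_all add: cdist_def w)
  have m': "real m = real a + real b + real c + real d + 4" using tot by linarith
  have exc: "cycle_excess G C = 8 * real ((a + d) * (b + c) + (a + b) * (c + d))"
    unfolding vs(4) len four by (simp add: D D(2)[unfolded One_nat_def] m') (simp add: power2_eq_square algebra_simps)
  have conc: "(\<exists>h. end_cycle G C h) \<longleftrightarrow>
    b + c + d = 0 \<or> a + c + d = 0 \<or> a + b + d = 0 \<or> a + b + c = 0"
    unfolding vs(5) len w all_but_one_zero_4 by simp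
  show "cycle_excess G C = 0" if "\<exists>h. end_cycle G C h"
    using that unfolding conc exc by auto
  show "cycle_excess G C \<ge> 8 * real m - 40" if "\<nexists>h. end_cycle G C h"
  proof -
    have "0 < (a + d) \<and> 0 < (b + c) \<or> 0 < (a + b) \<and> 0 < (c + d)"
      using that unfolding conc by linarith
    then have "a + b + c + d \<le> (a + d) * (b + c) + (a + b) * (c + d) + 1"
      using nat_mult_ge_sum[of "a + d" "b + c"] nat_mult_ge_sum[of "a + b" "c + d"] by linarith
    then have "real (a + b + c + d) \<le> real ((a + d) * (b + c) + (a + b) * (c + d) + 1)"
      by (simp only: of_nat_le_iff)
    then show ?thesis unfolding exc m' by simp
  qed
qed

text \<open>
  With weights \<open>a, b, c\<close> the excess is \<open>(m - 3) (m - 15) + 6 (a b + b c + c a)\<close>, because an edge of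
  the triangle does not see the edges hanging at the opposite vertex.
\<close>

lemma triangle_excess:
  assumes G: "cactus G" and C: "C \<in> cycles G" and m: "card (edges G) = m" and l: "card C = 3"
  shows "\<exists>h. end_cycle G C h \<Longrightarrow> cycle_excess G C = (real m - 3) * (real m - 15)"
    "\<nexists>h. end_cycle G C h \<Longrightarrow> cycle_excess G C > (real m - 3) * (real m - 15)"
proof -
  obtain vs \<pi> where ring: "C = cycle_edges vs" "3 \<le> length vs" "distinct vs" "gate G vs \<pi>"
    "card C = length vs"
    "int m - int (card C) = (\<Sum>j<length vs. int (gate_weight G vs \<pi> j))"
    "cycle_excess G C = (\<Sum>i<length vs. (real m)\<^sup>2 - (real_of_int (gate_diff G vs \<pi> i))\<^sup>2 - (2 * real m - 1))
       - (24 * real m - 60)"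
    "(\<exists>h. end_cycle G C h) \<longleftrightarrow> (\<exists>t<length vs. \<forall>j<length vs. j \<noteq> t \<longrightarrow> gate_weight G vs \<pi> j = 0)"
    using cycle_gate_profile[OF G C m] .
  note vs = ring(1,5-8)
  define a b c where w: "a = gate_weight G vs \<pi> 0" "b = gate_weight G vs \<pi> 1"
    "c = gate_weight G vs \<pi> 2"
  have len: "length vs = 3" using vs(2) l by simp
  have three: "{..<3::nat} = {0, 1, 2}" by auto
  have tot: "int m - 3 = int a + int b + int c"
    using vs(3) l len by (simp add: three w)
  have D: "gate_diff G vs \<pi> 0 = int a - int b"
    "gate_diff G vs \<pi> 1 = int b - int c"
    "gate_diff G vs \<pi> 2 = int c - int a"
    unfolding gate_diff_def len three by (simp_all add: cdist_def w)
  have m': "real m = real a + real b + real c + 3" using tot by linarith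
  have exc: "cycle_excess G C = (real m - 3) * (real m - 15) + 6 * real (a * b + b * c + c * a)"
    unfolding vs(4) len three by (simp add: D D(2)[unfolded One_nat_def] m') (simp add: power2_eq_square algebra_simps)
  have conc: "(\<exists>h. end_cycle G C h) \<longleftrightarrow> b + c = 0 \<or> a + c = 0 \<or> a + b = 0"
    unfolding vs(5) len w all_but_one_zero_3 by simp
  show "cycle_excess G C = (real m - 3) * (real m - 15)" if "\<exists>h. end_cycle G C h"
    using that unfolding conc exc by auto
  show "cycle_excess G C > (real m - 3) * (real m - 15)" if "\<nexists>h. end_cycle G C h"
  proof -
    have "0 < a * b + b * c + c * a" using that unfolding conc by auto
    then have "0 < real (a * b + b * c + c * a)" by (simp only: of_nat_0_less_iff)
    then show ?thesis unfolding exc by simp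
  qed
qed

text \<open>
  The cycle edges, of which there are at least five, cancel out in \<open>m\<^sub>u - m\<^sub>v\<close>, so that \<open>\<bar>m\<^sub>u - m\<^sub>v\<bar> \<le> m - 5\<close> for each of
  them. This crude bound is enough for all longer cycles.
\<close>

lemma long_cycle_excess:
  assumes G: "cactus G" and C: "C \<in> cycles G" and m: "card (edges G) = m" and l: "5 \<le> card C"
  shows "cycle_excess G C \<ge> 16 * real m - 60"
proof -
  have sG: "simple_graph G" using G by (simp add: cactus_def)
  obtain vs \<pi> where ring: "C = cycle_edges vs" "3 \<le> length vs" "distinct vs" "gate G vs \<pi>"
    "card C = length vs"
    "int m - int (card C) = (\<Sum>j<length vs. int (gate_weight G vs \<pi> j))"
    "cycle_excess G C = (\<Sum>i<length vs. (real m)\<^sup>2 - (real_of_int (gate_diff G vs \<pi> i))\<^sup>2 - (2 * real m - 1))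
       - (24 * real m - 60)"
    "(\<exists>h. end_cycle G C h) \<longleftrightarrow> (\<exists>t<length vs. \<forall>j<length vs. j \<noteq> t \<longrightarrow> gate_weight G vs \<pi> j = 0)"
    using cycle_gate_profile[OF G C m] .
  note vs = ring(1,5,4,7)
  have "C \<subseteq> edges G" using C by (auto elim!: cyclesE)
  then have lm: "card C \<le> m" using card_mono[OF finite_edges[OF sG]] m by blast
  have each: "8 * real m - 24 \<le> (real m)\<^sup>2 - (real_of_int (gate_diff G vs \<pi> i))\<^sup>2 - (2 * real m - 1)"
    if i: "i < length vs" for i
  proof -
    have "\<bar>gate_diff G vs \<pi> i\<bar> \<le> int m - 5"
      using gate_diff_bound[OF sG vs(3) i] m l vs(1) by simp
    then have "\<bar>real_of_int (gate_diff G vs \<pi> i)\<bar> \<le> real m - 5" by linarith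
    then have "(real_of_int (gate_diff G vs \<pi> i))\<^sup>2 \<le> (real m - 5)\<^sup>2"
      using l lm by (intro abs_le_square_iff[THEN iffD1]) simp
    then show ?thesis by (simp add: power2_eq_square algebra_simps)
  qed
  have "5 * (8 * real m - 24) \<le> real (length vs) * (8 * real m - 24)"
    using l vs(2) lm by (intro mult_right_mono) auto
  also have "\<dots> = (\<Sum>i<length vs. 8 * real m - 24)" by simp
  also have "\<dots> \<le> (\<Sum>i<length vs. (real m)\<^sup>2 - (real_of_int (gate_diff G vs \<pi> i))\<^sup>2 - (2 * real m - 1))"
    by (rule sum_mono) (use each in auto)
  finally show ?thesis unfolding vs(4) by simp
qed

subsection \<open>The possible excesses\<close>

definition total_excess :: "'a sgraph \<Rightarrow> real" where
  "total_excess G = (\<Sum>e\<in>bridges G. excess G e) + (\<Sum>C\<in>cycles G. cycle_excess G C)"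

lemma bridge_excess_cases:
  assumes G: "cactus G" and m: "card (edges G) = m" "5 \<le> m" and e: "e \<in> bridges G"
  shows "excess G e = 0 \<and> (\<exists>x. pendant_edge G e x) \<or>
    (\<nexists>x. pendant_edge G e x) \<and>
      (excess G e = 4 * real m - 8 \<and> (\<exists>p w. tail_edge G e p w) \<or> excess G e > 4 * real m - 8)"
proof -
  have sG: "simple_graph G" using G by (simp add: cactus_def)
  have "e \<in> edges G" using e by (simp add: bridges_def)
  then obtain u v where uv: "e = {u, v}" using edgeE[OF sG] by blast
  obtain a b where ab: "a + b + 1 = m" "excess G e = 4 * real a * real b"
    "a = 0 \<longleftrightarrow> pendant_edge G e u" "b = 0 \<longleftrightarrow> pendant_edge G e v"
    "a = 1 \<longleftrightarrow> (\<exists>w. tail_edge G e u w)" "b = 1 \<longleftrightarrow> (\<exists>w. tail_edge G e v w)"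
    using bridge_excess[OF G m(1) e uv] .
  have pend: "(\<exists>x. pendant_edge G e x) \<longleftrightarrow> a = 0 \<or> b = 0"
    using ab(3,4) uv by (auto simp: pendant_edge_def)
  have m': "real m = real a + real b + 1" using ab(1) by auto
  consider "a = 0 \<or> b = 0" | "a \<noteq> 0" "b \<noteq> 0" "a = 1 \<or> b = 1" | "2 \<le> a" "2 \<le> b" by linarith
  then show ?thesis
  proof cases
    case 1
    then show ?thesis using pend ab(2) by auto
  next
    case 2
    then have "excess G e = 4 * real m - 8" using ab(2) m' by auto
    moreover have "\<exists>p w. tail_edge G e p w" using ab(5,6) 2(3) by blast
    ultimately show ?thesis using pend 2 by blast
  next
    case 3
    then have "0 \<le> (real a - 2) * (real b - 2)" by simp
    then have "4 * real a * real b \<ge> 8 * (real a + real b) - 16" by (simp add: algebra_simps)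
    moreover have "4 * real m - 8 < 8 * (real a + real b) - 16" using m(2) m' by simp
    ultimately show ?thesis using pend 3 ab(2) by auto
  qed
qed

lemma tail_excess:
  assumes G: "cactus G" and m: "card (edges G) = m" and e: "e \<in> bridges G" "tail_edge G e p w"
  shows "excess G e = 4 * real m - 8"
proof -
  have sG: "simple_graph G" using G by (simp add: cactus_def)
  have "e \<in> edges G" "p \<in> e" using e by (auto simp: bridges_def tail_edge_def)
  then obtain v where uv: "e = {p, v}" using edgeE[OF sG] by (metis insertE insert_commute singletonD)
  obtain a b where ab: "a + b + 1 = m" "excess G e = 4 * real a * real b"
    "a = 1 \<longleftrightarrow> (\<exists>w. tail_edge G e p w)"
    using bridge_excess[OF G m(1) e(1) uv] by metis
  then show ?thesis using e(2) by auto
qed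

lemma cycle_excess_cases:
  assumes G: "cactus G" and m: "card (edges G) = m" "15 < m" and C: "C \<in> cycles G"
  shows "cycle_excess G C = 0 \<and> card C = 4 \<and> (\<exists>h. end_cycle G C h) \<or>
    cycle_excess G C = (real m - 3) * (real m - 15) \<and> card C = 3 \<and> (\<exists>h. end_cycle G C h) \<or>
    cycle_excess G C > (real m - 3) * (real m - 15) \<and> card C = 3 \<or>
    cycle_excess G C \<ge> 8 * real m - 40 \<and> card C \<noteq> 3"
proof -
  have "3 \<le> card C" using cycle_gate_profile[OF G C m(1)] by metis
  then consider "card C = 3" | "card C = 4" | "5 \<le> card C" by linarith
  then show ?thesis
  proof cases
    case 1
    then show ?thesis using triangle_excess[OF G C m(1) 1] by blast
  next
    case 2
    then show ?thesis using quadrangle_excess[OF G C m(1) 2] by force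
  next
    case 3
    then show ?thesis using long_cycle_excess[OF G C m(1) 3] m(2) by auto
  qed
qed

lemma excess_nonneg:
  assumes "cactus G" "card (edges G) = m" "15 < m"
  shows "e \<in> bridges G \<Longrightarrow> 0 \<le> excess G e" "C \<in> cycles G \<Longrightarrow> 0 \<le> cycle_excess G C"
proof -
  show "0 \<le> excess G e" if "e \<in> bridges G"
    using bridge_excess_cases[OF assms(1,2) _ that] assms(3) by auto
  have "0 \<le> (real m - 3) * (real m - 15)" using assms(3) by simp
  then show "0 \<le> cycle_excess G C" if "C \<in> cycles G"
    using cycle_excess_cases[OF assms that] assms(3) by (elim disjE conjE) linarith+
qed

section \<open>Cacti whose blocks all hang at one vertex\<close>

text \<open>
  The edges that may occur when all blocks meet at \<open>h\<close>: those of end cycles at \<open>h\<close>, pendant edges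
  at \<open>h\<close>, and the two edges of a path \<open>h p w\<close> ending at \<open>w\<close>. The set \<open>T\<close> lists the pairs \<open>(p, w)\<close>
  admitted for such paths; it will be empty or a singleton.
\<close>

definition star_edge :: "'a sgraph \<Rightarrow> ('a \<times> 'a) set \<Rightarrow> 'a \<Rightarrow> 'a set \<Rightarrow> bool" where
  "star_edge G T h e \<longleftrightarrow> (\<exists>C. e \<in> C \<and> end_cycle G C h) \<or> (\<exists>x. e = {h, x} \<and> pendant_edge G e x) \<or>
     (\<exists>p w. (p, w) \<in> T \<and> (e = {h, p} \<or> e = {p, w}) \<and> tail_edge G {h, p} p w)"

lemma cycles_sub_edges: "C \<in> cycles G \<Longrightarrow> C \<subseteq> edges G"
  by (auto elim!: cyclesE)

lemma end_cycleD:
  "\<lbrakk>end_cycle G C h; y \<in> \<Union>C; y \<noteq> h; e \<in> edges G; y \<in> e\<rbrakk> \<Longrightarrow> e \<in> C"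
  unfolding end_cycle_def by blast

lemma cycle_two_edges_at:
  assumes "C \<in> cycles G" "x \<in> \<Union>C"
  obtains e f where "e \<in> C" "f \<in> C" "x \<in> e" "x \<in> f" "e \<noteq> f" "e \<in> edges G" "f \<in> edges G"
proof -
  obtain vs where vs: "C = cycle_edges vs" "3 \<le> length vs" "distinct vs" "set vs \<subseteq> verts G"
    "cycle_edges vs \<subseteq> edges G" using cyclesE[OF assms(1)] .
  have "x \<in> set vs" using assms(2) vs(1) by (simp add: Union_cycle_edges)
  then obtain e f where "e \<in> C" "f \<in> C" "x \<in> e" "x \<in> f" "e \<noteq> f"
    unfolding vs(1) by (rule cycle_two_edges[OF vs(3,2)])
  then show thesis using vs(1,5) by (intro that) auto
qed

lemma pendant_not_on_cycle:
  assumes "pendant_edge G e x" "C \<in> cycles G"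
  shows "x \<notin> \<Union>C"
proof
  assume "x \<in> \<Union>C"
  then obtain f g where "f \<in> edges G" "g \<in> edges G" "x \<in> f" "x \<in> g" "f \<noteq> g"
    using cycle_two_edges_at[OF assms(2)] by blast
  then show False using assms(1) by (auto simp: pendant_edge_def)
qed

lemma tail_not_on_cycle:
  assumes tail: "tail_edge G e p w" and C: "C \<in> cycles G"
  shows "p \<notin> \<Union>C"
proof
  assume "p \<in> \<Union>C"
  then obtain a b where ab: "a \<in> C" "b \<in> C" "p \<in> a" "p \<in> b" "a \<noteq> b" "a \<in> edges G" "b \<in> edges G"
    using cycle_two_edges_at[OF C] by blast
  then have "a = {p, w} \<or> b = {p, w}" using tail unfolding tail_edge_def by metis
  then have "w \<in> \<Union>C" using ab by blast
  moreover have "pendant_edge G {p, w} w" using tail by (simp add: tail_edge_def)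
  ultimately show False using pendant_not_on_cycle[OF _ C] by blast
qed

text \<open>
  Around the common vertex of one cycle every block must end after at most two edges, and the
  vertices met this way have no further neighbours; by connectivity nothing else exists.
\<close>

lemma star_structure:
  assumes G: "cactus G" and C0: "end_cycle G C0 h"
    and cyc: "\<And>C. C \<in> cycles G \<Longrightarrow> \<exists>h'. end_cycle G C h'"
    and bri: "\<And>e. e \<in> bridges G \<Longrightarrow> (\<exists>x. pendant_edge G e x) \<or> (\<exists>p w. (p, w) \<in> T \<and> tail_edge G e p w)"
    and e: "e \<in> edges G"
  shows "star_edge G T h e"
proof -
  have sG: "simple_graph G" "connected_graph G" using G by (auto simp: cactus_def)
  let ?S = "{x. \<forall>e\<in>edges G. x \<in> e \<longrightarrow> star_edge G T h e}"
  have C0c: "C0 \<in> cycles G" "h \<in> \<Union>C0" using C0 by (auto simp: end_cycle_def)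
  obtain f g where fg: "f \<in> C0" "g \<in> C0" "h \<in> f" "h \<in> g" "f \<noteq> g" "f \<in> edges G" "g \<in> edges G"
    using cycle_two_edges_at[OF C0c] .
  have hV: "h \<in> verts G" using fg sG(1) unfolding simple_graph_def by blast
  \<comment> \<open>A cycle through \<open>h\<close> that hangs at another vertex contains all edges at \<open>h\<close>, so it is \<open>C0\<close>.
    A bridge at \<open>h\<close> cannot end at \<open>h\<close>, where two edges of \<open>C0\<close> leave.\<close>
  have hS: "h \<in> ?S"
  proof (intro CollectI ballI impI)
    fix e assume e: "e \<in> edges G" "h \<in> e"
    show "star_edge G T h e"
    proof (cases "\<exists>C\<in>cycles G. e \<in> C")
      case True
      then obtain C where C: "C \<in> cycles G" "e \<in> C" by blast
      obtain h' where h': "end_cycle G C h'" using cyc C by blast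
      have "end_cycle G C h"
      proof (cases "h' = h")
        case False
        have "h \<in> \<Union>C" using C(2) e(2) by blast
        then have "f \<in> C" using end_cycleD[OF h' _ _ fg(6,3)] False by simp
        then have "C = C0" using cactus_cycles_edge_disjoint[OF G C(1) C0c(1)] fg by blast
        then show ?thesis using C0 by simp
      qed (use h' in simp)
      then show ?thesis using C by (auto simp: star_edge_def)
    next
      case False
      then have eb: "e \<in> bridges G" using e by (auto simp: bridges_def)
      have ne: "f \<noteq> e" "g \<noteq> e" using False fg C0c by auto
      obtain a b where "e = {a, b}" "a \<noteq> b" using edgeE[OF sG(1) e(1)] .
      then obtain x where x: "e = {h, x}" "x \<noteq> h" using e(2) by blast
      from bri[OF eb] show ?thesis
      proof (elim disjE exE conjE)
        fix y assume y: "pendant_edge G e y"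
        then have "y = x" using fg ne x by (auto simp: pendant_edge_def)
        then show ?thesis using y x by (auto simp: star_edge_def)
      next
        fix p w assume pw: "(p, w) \<in> T" "tail_edge G e p w"
        have "p \<noteq> h" using pw(2) fg ne unfolding tail_edge_def by metis
        then have "p = x" using pw(2) x by (auto simp: tail_edge_def)
        then show ?thesis using pw x by (auto simp: star_edge_def)
      qed
    qed
  qed
  have closed: "b \<in> ?S" if a: "a \<in> ?S" and ab: "{a, b} \<in> edges G" for a b
  proof (cases "b = h")
    case True
    then show ?thesis using hS by simp
  next
    case False
    have star: "star_edge G T h {a, b}" using a ab by blast
    then show ?thesis
      unfolding star_edge_def[of G T h "{a, b}"]
    proof (elim disjE exE conjE)
      fix C assume C: "{a, b} \<in> C" "end_cycle G C h"
      then have "e \<in> C" if "e \<in> edges G" "b \<in> e" for e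
        using end_cycleD[OF C(2) _ False that] by blast
      then show ?thesis using C(2) by (auto simp: star_edge_def)
    next
      fix x assume x: "{a, b} = {h, x}" "pendant_edge G {a, b} x"
      then have "b = x" using False by (auto simp: doubleton_eq_iff)
      then show ?thesis using x(2) star by (auto simp: pendant_edge_def)
    next
      fix p w assume T: "(p, w) \<in> T" "{a, b} = {h, p}" "tail_edge G {h, p} p w"
      then have "b = p" using False by (auto simp: doubleton_eq_iff)
      then have "e = {h, p} \<or> e = {p, w}" if "e \<in> edges G" "b \<in> e" for e
        using T(3) that by (auto simp: tail_edge_def)
      then have "star_edge G T h e" if "e \<in> edges G" "b \<in> e" for e
        using that T(1,3) unfolding star_edge_def by blast
      then show ?thesis by simp
    next
      fix p w assume T: "(p, w) \<in> T" "{a, b} = {p, w}" "tail_edge G {h, p} p w"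
      then have "e = {h, p} \<or> e = {p, w}" if "e \<in> edges G" "b \<in> e" for e
        using that by (auto simp: tail_edge_def pendant_edge_def doubleton_eq_iff)
      then have "star_edge G T h e" if "e \<in> edges G" "b \<in> e" for e
        using that T(1,3) unfolding star_edge_def by blast
      then show ?thesis by simp
    qed
  qed
  obtain u v where uv: "e = {u, v}" "u \<in> verts G" using edgeE[OF sG(1) e] by blast
  have "u \<in> ?S"
    by (rule connected_closed_set[OF sG(2) hS hV uv(2)]) (rule closed)
  then show ?thesis using e uv by simp
qed

lemma star_cycle_end:
  assumes G: "cactus G" and star: "\<And>e. e \<in> edges G \<Longrightarrow> star_edge G T h e"
    and cyc: "\<And>C. C \<in> cycles G \<Longrightarrow> \<exists>h'. end_cycle G C h'" and C: "C \<in> cycles G"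
  shows "end_cycle G C h"
proof -
  obtain h' where "h' \<in> \<Union>C" using cyc[OF C] by (auto simp: end_cycle_def)
  then obtain e where e: "e \<in> C" "e \<in> edges G" using cycle_two_edges_at[OF C] by blast
  from star[OF e(2)] show ?thesis unfolding star_edge_def
  proof (elim disjE exE conjE)
    fix D assume D: "e \<in> D" "end_cycle G D h"
    then have "D \<in> cycles G" by (simp add: end_cycle_def)
    then show ?thesis using cactus_cycles_edge_disjoint[OF G C] e D by metis
  next
    fix x assume "e = {h, x}" "pendant_edge G e x"
    then show ?thesis using pendant_not_on_cycle[OF _ C] e by blast
  next
    fix p w assume "e = {h, p}" "tail_edge G {h, p} p w"
    then show ?thesis using tail_not_on_cycle[OF _ C] e by blast
  next
    fix p w assume "e = {p, w}" "tail_edge G {h, p} p w"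
    then show ?thesis using tail_not_on_cycle[OF _ C] e by blast
  qed
qed

section \<open>Flowers\<close>

text \<open>
  Cycles and pendant edges at a common vertex \<open>h\<close>, i.e. a bouquet with arbitrary vertices. A petal
  is a cycle through \<open>h\<close> without the vertex \<open>h\<close>; the elements of \<open>L\<close> are the leaves.
\<close>

definition flower :: "'a sgraph \<Rightarrow> 'a \<Rightarrow> 'a list list \<Rightarrow> 'a set \<Rightarrow> bool" where
  "flower G h Ps L \<longleftrightarrow> distinct (h # concat Ps) \<and> (\<forall>p\<in>set Ps. 2 \<le> length p) \<and> finite L \<and>
     L \<inter> set (h # concat Ps) = {} \<and> verts G = set (h # concat Ps) \<union> L \<and>
     edges G = (\<Union>p\<in>set Ps. cycle_edges (h # p)) \<union> (\<lambda>x. {h, x}) ` L"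

lemma end_cycle_petal:
  assumes "end_cycle G C h"
  shows "\<exists>p. C = cycle_edges (h # p) \<and> distinct (h # p) \<and> 2 \<le> length p \<and> length p = card C - 1"
proof -
  have C: "C \<in> cycles G" "h \<in> \<Union>C" using assms by (auto simp: end_cycle_def)
  obtain vs where vs: "C = cycle_edges vs" "3 \<le> length vs" "distinct vs" using cyclesE[OF C(1)] .
  have "h \<in> set vs" using C(2) vs(1) by (simp add: Union_cycle_edges)
  then obtain r where r: "r < length vs" "vs ! r = h" by (auto simp: in_set_conv_nth)
  define ws where "ws = rotate r vs"
  have ws: "C = cycle_edges ws" "distinct ws" "length ws = length vs"
    using vs by (auto simp: ws_def cycle_edges_rotate)
  have "ws \<noteq> []" using ws(3) vs(2) by auto
  then obtain a p where p: "ws = a # p" by (cases ws) auto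
  have "0 < length vs" using r(1) by linarith
  then have "ws ! 0 = h" using r by (simp add: ws_def nth_rotate)
  then have "ws = h # p" using p by simp
  moreover have "card C = length ws" using card_cycle_edges[of ws] ws vs(2) by simp
  ultimately show ?thesis using ws vs(2) by (intro exI[of _ p]) auto
qed

text \<open>
  The flower \<open>F\<close> is formed from cycles and leaf edges of \<open>G\<close>, but may leave out other edges of
  \<open>G\<close>. A vertex of a petal has all its edges in the cycle of this petal, therefore petals are
  disjoint from each other and from the leaves.
\<close>

lemma flowerI:
  assumes end_c: "\<And>C. C \<in> set Cs \<Longrightarrow> end_cycle G C h" and dist: "distinct Cs"
    and disj: "\<And>C D e. \<lbrakk>C \<in> set Cs; D \<in> set Cs; e \<in> C; e \<in> D\<rbrakk> \<Longrightarrow> C = D"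
    and L: "finite L" "\<And>x. x \<in> L \<Longrightarrow> {h, x} \<in> edges G - \<Union>(set Cs) \<and> x \<noteq> h"
    and E: "edges F = \<Union>(set Cs) \<union> (\<lambda>x. {h, x}) ` L"
    and V: "verts F = {h} \<union> \<Union>(\<Union>(set Cs)) \<union> L"
  obtains Ps where "flower F h Ps L" "map length Ps = map (\<lambda>C. card C - 1) Cs"
proof -
  obtain petal where petal: "\<And>C. C \<in> set Cs \<Longrightarrow> C = cycle_edges (h # petal C) \<and> distinct (h # petal C) \<and>
      2 \<le> length (petal C) \<and> length (petal C) = card C - 1"
    using end_cycle_petal[OF end_c] by metis
  define Ps where "Ps = map petal Cs"
  have UC: "\<Union>C = insert h (set (petal C))" if "C \<in> set Cs" for C
    using petal[OF that] Union_cycle_edges[of "h # petal C"] by simp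
  have at: "e \<in> C" if "C \<in> set Cs" "x \<in> set (petal C)" "e \<in> edges G" "x \<in> e" for C x e
  proof -
    have "x \<in> \<Union>C - {h}" using UC[OF that(1)] petal[OF that(1)] that(2) by auto
    then show ?thesis using end_cycleD[OF end_c[OF that(1)] _ _ that(3,4)] by blast
  qed
  have pdisj: "set (petal C) \<inter> set (petal D) = {}" if CD: "C \<in> set Cs" "D \<in> set Cs" "C \<noteq> D" for C D
  proof (rule ccontr)
    assume "\<not> ?thesis"
    then obtain x where x: "x \<in> set (petal C)" "x \<in> set (petal D)" by blast
    then have "x \<in> \<Union>D" using UC CD by blast
    then obtain e where e: "e \<in> D" "x \<in> e" by blast
    have "D \<in> cycles G" using end_c[OF CD(2)] by (simp add: end_cycle_def)
    then have "e \<in> edges G" using e(1) cycles_sub_edges by blast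
    then have "e \<in> C" using at[OF CD(1) x(1)] e by blast
    then show False using disj CD e by blast
  qed
  have inj: "inj_on petal (set Cs)"
    by (rule inj_onI) (use petal in metis)
  have dPs: "distinct Ps" using inj dist by (simp add: Ps_def distinct_map)
  have "distinct (concat Ps)"
  proof (rule distinct_concat[OF dPs])
    fix y z assume "y \<in> set Ps" "z \<in> set Ps" "y \<noteq> z"
    then obtain C D where "C \<in> set Cs" "D \<in> set Cs" "y = petal C" "z = petal D" "C \<noteq> D"
      by (auto simp: Ps_def)
    then show "set y \<inter> set z = {}" using pdisj by blast
  qed (use petal in \<open>auto simp: Ps_def\<close>)
  moreover have hP: "h \<notin> set (concat Ps)" using petal by (fastforce simp: Ps_def)
  have LP: "x \<notin> set (petal C)" if "x \<in> L" "C \<in> set Cs" for x C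
    using at[OF that(2)] L(2)[OF that(1)] that(2) by blast
  have setP: "set (h # concat Ps) = {h} \<union> \<Union>(\<Union>(set Cs))" using UC by (auto simp: Ps_def)
  have "L \<inter> set (h # concat Ps) = {}" using LP L(2) by (auto simp: Ps_def)
  moreover have "edges F = (\<Union>p\<in>set Ps. cycle_edges (h # p)) \<union> (\<lambda>x. {h, x}) ` L"
    unfolding E using petal by (auto simp: Ps_def)
  moreover have "verts F = set (h # concat Ps) \<union> L" unfolding V setP ..
  moreover have "\<forall>p\<in>set Ps. 2 \<le> length p"
    using petal unfolding Ps_def by (metis (no_types, lifting) imageE list.set_map)
  ultimately have "flower F h Ps L" using L(1) hP by (simp add: flower_def)
  moreover have "map length Ps = map (\<lambda>C. card C - 1) Cs" using petal by (auto simp: Ps_def)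
  ultimately show thesis by (rule that)
qed

lemma connected_vertex_edge:
  assumes "connected_graph G" "x \<in> verts G" "z \<in> verts G" "x \<noteq> z"
  shows "\<exists>e\<in>edges G. x \<in> e"
proof -
  have "(x, z) \<in> (adj G)\<^sup>*" using assms by (simp add: connected_graph_def)
  then obtain y where "(x, y) \<in> adj G" using assms(4) by (meson converse_rtranclE)
  then show ?thesis by (auto simp: adj_def)
qed

lemma edges_in_verts: "simple_graph G \<Longrightarrow> \<Union>(edges G) \<subseteq> verts G"
  by (auto simp: simple_graph_def)

lemma cactus_is_flower:
  assumes G: "cactus G" and Cs: "set Cs = cycles G" "distinct Cs" "Cs \<noteq> []"
    and cyc: "\<And>C. C \<in> cycles G \<Longrightarrow> \<exists>h. end_cycle G C h"
    and bri: "\<And>e. e \<in> bridges G \<Longrightarrow> \<exists>x. pendant_edge G e x"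
  obtains h Ps L where "flower G h Ps L" "map length Ps = map (\<lambda>C. card C - 1) Cs"
proof -
  have sG: "simple_graph G" "connected_graph G" using G by (auto simp: cactus_def)
  obtain C0 where C0: "C0 \<in> cycles G" using Cs by (cases Cs) auto
  obtain h where h: "end_cycle G C0 h" using cyc[OF C0] by blast
  have star: "star_edge G {} h e" if "e \<in> edges G" for e
    by (rule star_structure[OF G h cyc _ that]) (use bri in blast)+
  have hU: "h \<in> \<Union>C0" using h by (simp add: end_cycle_def)
  obtain f0 where f0: "f0 \<in> C0" "h \<in> f0" "f0 \<in> edges G" using cycle_two_edges_at[OF C0 hU] by blast
  have hV: "h \<in> verts G" using f0 edges_in_verts[OF sG(1)] by blast
  note end_c = star_cycle_end[OF G star cyc]
  let ?L = "{x. pendant_edge G {h, x} x}"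
  have sub: "\<Union>(cycles G) \<subseteq> edges G" using cycles_sub_edges by blast
  have L: "{h, x} \<in> edges G - \<Union>(set Cs) \<and> x \<noteq> h" if x: "x \<in> ?L" for x
  proof -
    have "{h, x} \<in> edges G" using x by (simp add: pendant_edge_def)
    moreover from this have "x \<noteq> h" using edge_verts[OF sG(1)] by blast
    ultimately show ?thesis using x pendant_not_on_cycle[of G "{h, x}" x] unfolding Cs(1) by blast
  qed
  have "?L \<subseteq> verts G" using L edges_in_verts[OF sG(1)] by blast
  then have fin: "finite ?L" using sG(1) by (auto simp: simple_graph_def intro: finite_subset)
  have E: "edges G = \<Union>(set Cs) \<union> (\<lambda>x. {h, x}) ` ?L"
  proof
    show "edges G \<subseteq> \<Union>(set Cs) \<union> (\<lambda>x. {h, x}) ` ?L"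
    proof
      fix e assume "e \<in> edges G"
      from star[OF this] show "e \<in> \<Union>(set Cs) \<union> (\<lambda>x. {h, x}) ` ?L"
        unfolding star_edge_def Cs(1) by (auto simp: end_cycle_def)
    qed
    show "\<Union>(set Cs) \<union> (\<lambda>x. {h, x}) ` ?L \<subseteq> edges G"
      using sub L Cs(1) by blast
  qed
  have "verts G = {h} \<union> \<Union>(edges G)"
    using connected_vertex_edge[OF sG(2) _ hV] hV edges_in_verts[OF sG(1)] by blast
  also have "\<dots> = {h} \<union> \<Union>(\<Union>(set Cs)) \<union> ?L" unfolding E by auto
  finally have V: "verts G = {h} \<union> \<Union>(\<Union>(set Cs)) \<union> ?L" .
  have disj: "C = D" if "C \<in> set Cs" "D \<in> set Cs" "e \<in> C" "e \<in> D" for C D e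
    using cactus_cycles_edge_disjoint[OF G _ _ that(3,4)] that(1,2) Cs(1) by blast
  have end_s: "end_cycle G C h" if "C \<in> set Cs" for C using end_c that Cs(1) by blast
  show thesis
    by (rule flowerI[OF end_s Cs(2) disj fin L E V]) (assumption | rule that)+
qed

lemma cactus_is_flower_with_tail:
  assumes G: "cactus G" and Cs: "set Cs = cycles G" "distinct Cs" "Cs \<noteq> []"
    and cyc: "\<And>C. C \<in> cycles G \<Longrightarrow> \<exists>h. end_cycle G C h"
    and bri: "\<And>e. e \<in> bridges G \<Longrightarrow> e \<noteq> e0 \<Longrightarrow> \<exists>x. pendant_edge G e x"
    and e0: "e0 \<in> bridges G" "\<nexists>x. pendant_edge G e0 x" "tail_edge G e0 p w"
  obtains F h Ps L where "flower F h Ps L" "map length Ps = map (\<lambda>C. card C - 1) Cs"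
    "p \<in> L" "w \<notin> verts F" "G = add_pendant p w F"
proof -
  have sG: "simple_graph G" "connected_graph G" using G by (auto simp: cactus_def)
  obtain C0 where C0: "C0 \<in> cycles G" using Cs by (cases Cs) auto
  obtain h where h: "end_cycle G C0 h" using cyc[OF C0] by blast
  have star: "star_edge G {(p, w)} h e" if "e \<in> edges G" for e
    by (rule star_structure[OF G h cyc _ that]) (use bri e0 in blast)+
  have hU: "h \<in> \<Union>C0" using h by (simp add: end_cycle_def)
  obtain f0 where f0: "f0 \<in> C0" "h \<in> f0" "f0 \<in> edges G" using cycle_two_edges_at[OF C0 hU] by blast
  have hV: "h \<in> verts G" using f0 edges_in_verts[OF sG(1)] by blast
  have e0E: "e0 \<in> edges G" "e0 \<notin> \<Union>(cycles G)" using e0(1) by (auto simp: bridges_def)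
  have tail: "tail_edge G {h, p} p w"
    using star[OF e0E(1)] e0E(2) e0(2) unfolding star_edge_def by (auto simp: end_cycle_def)
  have pw: "pendant_edge G {p, w} w" "{p, w} \<in> edges G" "{h, p} \<in> edges G" "w \<noteq> h" "w \<noteq> p" "p \<noteq> h"
    using tail edge_verts[OF sG(1), of h p] by (auto simp: tail_edge_def pendant_edge_def)
  have w_cyc: "w \<notin> \<Union>C" if "C \<in> cycles G" for C using pendant_not_on_cycle[OF pw(1) that] .
  have p_cyc: "p \<notin> \<Union>C" if "C \<in> cycles G" for C using tail_not_on_cycle[OF tail that] .
  note end_c = star_cycle_end[OF G star cyc]
  define F where "F = Graph (verts G - {w}) (edges G - {{p, w}})"
  let ?L = "insert p {x. pendant_edge G {h, x} x}"
  have sub: "\<Union>(cycles G) \<subseteq> edges G" using cycles_sub_edges by blast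
  have L: "{h, x} \<in> edges G - \<Union>(set Cs) \<and> x \<noteq> h" if x: "x \<in> ?L" for x
  proof (cases "x = p")
    case True
    then show ?thesis using pw p_cyc unfolding Cs(1) by blast
  next
    case False
    then have x: "pendant_edge G {h, x} x" using x by simp
    then have "{h, x} \<in> edges G" by (simp add: pendant_edge_def)
    moreover from this have "x \<noteq> h" using edge_verts[OF sG(1)] by blast
    ultimately show ?thesis using x pendant_not_on_cycle[of G "{h, x}" x] unfolding Cs(1) by blast
  qed
  have wL: "w \<notin> ?L"
  proof
    assume "w \<in> ?L"
    then have "{h, w} \<in> edges G" using pw(5) by (simp add: pendant_edge_def)
    then have "{h, w} = {p, w}" using pw(1) unfolding pendant_edge_def by blast
    then show False using pw(4,6) by (simp add: doubleton_eq_iff)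
  qed
  have "?L \<subseteq> verts G" using L edges_in_verts[OF sG(1)] by blast
  then have fin: "finite ?L" using sG(1) by (auto simp: simple_graph_def intro: finite_subset)
  have E: "edges F = \<Union>(set Cs) \<union> (\<lambda>x. {h, x}) ` ?L"
  proof
    show "edges F \<subseteq> \<Union>(set Cs) \<union> (\<lambda>x. {h, x}) ` ?L"
    proof
      fix e assume "e \<in> edges F"
      then have e: "e \<in> edges G" "e \<noteq> {p, w}" by (auto simp: F_def)
      then show "e \<in> \<Union>(set Cs) \<union> (\<lambda>x. {h, x}) ` ?L"
        using star[OF e(1)] unfolding star_edge_def Cs(1) by (auto simp: end_cycle_def)
    qed
    have "{h, x} \<noteq> {p, w}" for x using pw by (auto simp: doubleton_eq_iff)
    then have "{h, x} \<in> edges F" if "x \<in> ?L" for x using L[OF that] by (simp add: F_def)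
    moreover have "{p, w} \<notin> \<Union>(cycles G)" using w_cyc by blast
    then have "\<Union>(set Cs) \<subseteq> edges F" using sub unfolding F_def Cs(1) by auto
    ultimately show "\<Union>(set Cs) \<union> (\<lambda>x. {h, x}) ` ?L \<subseteq> edges F" by blast
  qed
  have "verts F = {h} \<union> \<Union>(edges F) \<union> {p}"
  proof
    show "verts F \<subseteq> {h} \<union> \<Union>(edges F) \<union> {p}"
      using connected_vertex_edge[OF sG(2) _ hV] by (auto simp: F_def)
    have "w \<notin> \<Union>(edges F)" using pw(1) unfolding F_def pendant_edge_def by auto
    then have "\<Union>(edges F) \<subseteq> verts F" using edges_in_verts[OF sG(1)] by (auto simp: F_def)
    moreover have "h \<in> verts F" "p \<in> verts F"
      using edge_verts[OF sG(1) pw(3)] pw(4,5) by (auto simp: F_def)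
    ultimately show "{h} \<union> \<Union>(edges F) \<union> {p} \<subseteq> verts F" by blast
  qed
  also have "\<dots> = {h} \<union> \<Union>(\<Union>(set Cs)) \<union> ?L" unfolding E by auto
  finally have V: "verts F = {h} \<union> \<Union>(\<Union>(set Cs)) \<union> ?L" .
  have disj: "C = D" if "C \<in> set Cs" "D \<in> set Cs" "e \<in> C" "e \<in> D" for C D e
    using cactus_cycles_edge_disjoint[OF G _ _ that(3,4)] that(1,2) Cs(1) by blast
  have end_s: "end_cycle G C h" if "C \<in> set Cs" for C using end_c that Cs(1) by blast
  obtain Ps where Ps: "flower F h Ps ?L" "map length Ps = map (\<lambda>C. card C - 1) Cs"
    by (rule flowerI[OF end_s Cs(2) disj fin L E V]) (assumption | rule that)+
  have "w \<in> verts G" using pw(2) edges_in_verts[OF sG(1)] by blast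
  then have "insert w (verts G - {w}) = verts G" "insert {p, w} (edges G - {{p, w}}) = edges G"
    using pw(2) by blast+
  then have "G = add_pendant p w F" by (simp add: add_pendant_def F_def)
  moreover have "w \<notin> verts F" by (simp add: F_def)
  ultimately show thesis
    using Ps that[of F h Ps ?L] by blast
qed

section \<open>Flowers up to isomorphism\<close>

definition image_graph :: "('a \<Rightarrow> 'b) \<Rightarrow> 'a sgraph \<Rightarrow> 'b sgraph" where
  "image_graph f G = Graph (f ` verts G) ((`) f ` edges G)"

lemma edges_image_graph: "edges (image_graph f G) = (`) f ` edges G"
  by (simp add: image_graph_def)

lemma verts_image_graph: "verts (image_graph f G) = f ` verts G"
  by (simp add: image_graph_def)

lemma graph_iso_iff: "graph_iso G H \<longleftrightarrow> (\<exists>f. inj_on f (verts G) \<and> image_graph f G = H)"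
proof
  assume "graph_iso G H"
  then obtain f where "bij_betw f (verts G) (verts H)" "(\<lambda>e. f ` e) ` edges G = edges H"
    by (auto simp: graph_iso_def)
  then have "inj_on f (verts G)" "image_graph f G = H"
    by (auto simp: bij_betw_def verts_image_graph edges_image_graph intro!: sgraph.expand)
  then show "\<exists>f. inj_on f (verts G) \<and> image_graph f G = H" by blast
next
  assume "\<exists>f. inj_on f (verts G) \<and> image_graph f G = H"
  then show "graph_iso G H"
    by (auto simp: graph_iso_def bij_betw_def verts_image_graph edges_image_graph)
qed

lemma graph_iso_inverse:
  assumes "simple_graph G" "graph_iso G H"
  obtains g where "inj_on g (verts H)" "image_graph g H = G"
proof -
  obtain f where f: "inj_on f (verts G)" "image_graph f G = H" using assms(2) graph_iso_iff by blast
  let ?g = "inv_into (verts G) f"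
  have H: "verts H = f ` verts G" "edges H = (`) f ` edges G"
    using f(2) verts_image_graph edges_image_graph by metis+
  have "?g ` f ` e = e" if "e \<subseteq> verts G" for e
    using f(1) that by (simp add: inv_into_image_cancel)
  then have "(`) ?g ` edges H = edges G" "?g ` verts H = verts G"
    unfolding H using edges_in_verts[OF assms(1)] by (auto simp: image_image Sup_le_iff)
  then have "image_graph ?g H = G"
    by (intro sgraph.expand) (simp add: verts_image_graph edges_image_graph)
  moreover have "inj_on ?g (verts H)" unfolding H by (rule inj_on_inv_into) simp
  ultimately show thesis using that by blast
qed

lemma image_graph_add_pendant:
  "image_graph f (add_pendant p w F) = add_pendant (f p) (f w) (image_graph f F)"
  by (simp add: add_pendant_def image_graph_def)

lemma flower_map:
  assumes fl: "flower F h Ps L" and f: "inj_on f (verts F)"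
  shows "flower (image_graph f F) (f h) (map (map f) Ps) (f ` L)"
proof -
  have F: "distinct (h # concat Ps)" "\<forall>p\<in>set Ps. 2 \<le> length p" "finite L"
    "L \<inter> set (h # concat Ps) = {}" "verts F = set (h # concat Ps) \<union> L"
    "edges F = (\<Union>p\<in>set Ps. cycle_edges (h # p)) \<union> (\<lambda>x. {h, x}) ` L"
    using fl unfolding flower_def by blast+
  have lst: "f h # concat (map (map f) Ps) = map f (h # concat Ps)" by (simp add: map_concat)
  have "distinct (map f (h # concat Ps))"
    using F(1,5) f unfolding distinct_map by (blast intro: inj_on_subset)
  moreover have "f ` L \<inter> f ` set (h # concat Ps) = {}"
    using inj_on_image_Int[OF f, of L "set (h # concat Ps)"] F(4,5) by (metis Un_upper1 Un_upper2 image_empty)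
  moreover have "edges (image_graph f F)
      = (\<Union>p\<in>set (map (map f) Ps). cycle_edges (f h # p)) \<union> (\<lambda>x. {f h, x}) ` f ` L"
    unfolding edges_image_graph F(6) by (simp add: image_Un image_UN cycle_edges_map image_image)
  ultimately show ?thesis
    unfolding flower_def lst using F(2,3,5) by (simp add: verts_image_graph image_Un)
qed

text \<open>
  Matching the concatenated lists of petals position by position maps petals to petals, since
  corresponding petals have the same length.
\<close>

lemma flowers_isomorphic:
  assumes F: "flower F h Ps L" and F': "flower F' h' Ps' L'"
    and len: "map length Ps = map length Ps'" and card: "card L = card L'"
  obtains f where "inj_on f (verts F)" "image_graph f F = F'" "f ` L = L'"
proof -
  have d: "distinct (h # concat Ps)" "finite L" "L \<inter> set (h # concat Ps) = {}"
    "verts F = set (h # concat Ps) \<union> L"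
    "edges F = (\<Union>p\<in>set Ps. cycle_edges (h # p)) \<union> (\<lambda>x. {h, x}) ` L"
    using F unfolding flower_def by blast+
  have d': "distinct (h' # concat Ps')" "finite L'" "L' \<inter> set (h' # concat Ps') = {}"
    "verts F' = set (h' # concat Ps') \<union> L'"
    "edges F' = (\<Union>p\<in>set Ps'. cycle_edges (h' # p)) \<union> (\<lambda>x. {h', x}) ` L'"
    using F' unfolding flower_def by blast+
  obtain g where g: "bij_betw g L L'" using finite_same_card_bij[OF d(2) d'(2) card] by blast
  define xs ys where xy: "xs = h # concat Ps" "ys = h' # concat Ps'"
  have lxy: "length xs = length ys" using len by (simp add: xy length_concat)
  define f where "f x = (if x \<in> L then g x else the (map_of (zip xs ys) x))" for x
  have fn: "f (xs ! i) = ys ! i" if "i < length xs" for i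
    using that lxy d(1,3) map_of_zip_nth[of xs ys i] unfolding f_def xy[symmetric]
    by (auto dest: nth_mem)
  have fxs: "map f xs = ys" using fn lxy by (auto intro: nth_equalityI)
  have fL: "f ` L = L'" using g by (auto simp: f_def bij_betw_def)
  have fh: "f h = h'" and "map f (concat Ps) = concat Ps'" using fxs by (simp_all add: xy)
  then have "concat (map (map f) Ps) = concat Ps'" by (simp add: map_concat)
  moreover have lPs: "length Ps = length Ps'" using len by (metis length_map)
  moreover have "\<forall>(x, y)\<in>set (zip (map (map f) Ps) Ps'). length x = length y"
    using len lPs by (auto simp: set_zip dest: arg_cong[where f = "\<lambda>zs. zs ! _"]) (metis length_map nth_map)
  ultimately have fPs: "map (map f) Ps = Ps'"
    using concat_eq_concat_iff[of "map (map f) Ps" Ps'] by simp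
  have "inj_on f (set xs)" using fxs d'(1) by (metis distinct_map xy(2))
  moreover have "inj_on f L" using g by (auto simp: f_def bij_betw_def inj_on_def)
  moreover have "f ` set xs \<inter> f ` L = {}"
    using fxs fL d'(3) by (metis inf_commute list.set_map xy(2))
  ultimately have "inj_on f (set xs \<union> L)" by (auto simp: inj_on_Un)
  then have inj: "inj_on f (verts F)" by (simp only: d(4) xy(1))
  have fl: "flower (image_graph f F) h' Ps' L'" using flower_map[OF F inj] fh fPs fL by simp
  then have "image_graph f F = F'"
    using d'(4,5) by (intro sgraph.expand) (simp add: flower_def)
  then show thesis using that inj fL by blast
qed

lemma bouquet_flower:
  assumes "\<forall>x\<in>set ms. 3 \<le> x"
  shows "flower (bouquet ms p) Hub (map (\<lambda>i. map (Rim i) [1..<ms ! i]) [0..<length ms]) (Leaf ` {..<p})"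
    (is "flower _ _ ?Ps _")
proof -
  have ms: "3 \<le> ms ! i" if "i < length ms" for i using assms that nth_mem by blast
  have set: "set (concat ?Ps) = (\<Union>i<length ms. Rim i ` {1..<ms ! i})" by auto
  have "distinct (concat ?Ps)"
  proof (rule distinct_concat)
    have "inj_on (\<lambda>i. map (Rim i) [1..<ms ! i]) {0..<length ms}"
    proof (rule inj_onI)
      fix i j assume i: "i \<in> {0..<length ms}" "j \<in> {0..<length ms}"
        and eq: "map (Rim i) [1..<ms ! i] = map (Rim j) [1..<ms ! j]"
      have "Rim i 1 \<in> set (map (Rim j) [1..<ms ! j])" unfolding eq[symmetric] using ms[of i] i by auto
      then show "i = j" by auto
    qed
    then show "distinct ?Ps" by (simp add: distinct_map)
  qed (auto simp: distinct_map inj_on_def)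
  then show ?thesis
    unfolding flower_def set
    by (auto simp: bouquet_def set image_image atLeast0LessThan image_UN dest: ms)
qed

lemma length_bouquet_petals:
  "map length (map (\<lambda>i. map (Rim i) [1..<ms ! i]) [0..<length ms]) = map (\<lambda>l. l - 1) ms"
  by (rule nth_equalityI) auto

lemma flower_card_verts:
  assumes "flower F h Ps L"
  shows "card (verts F) = 1 + sum_list (map length Ps) + card L"
proof -
  have d: "distinct (h # concat Ps)" "finite L" "L \<inter> set (h # concat Ps) = {}"
    "verts F = set (h # concat Ps) \<union> L"
    using assms unfolding flower_def by blast+
  have "card (verts F) = card (set (h # concat Ps)) + card L"
    unfolding d(4) by (rule card_Un_disjoint) (use d in auto)
  then show ?thesis using distinct_card[OF d(1)] by (simp add: length_concat)
qed

lemma flower_iso_bouquet: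
  assumes F: "flower F h Ps L" and ms: "map length Ps = map (\<lambda>l. l - 1) ms" "\<forall>x\<in>set ms. 3 \<le> x"
  obtains f where "inj_on f (verts F)" "image_graph f F = cycle_bouquet (card (verts F)) ms"
    "f ` L = Leaf ` {..<card L}"
proof -
  have "sum_list (map (\<lambda>l. l - 1) ms) + length ms = sum_list ms"
    using ms(2) by (induction ms) auto
  then have "card (verts F) + length ms - 1 - sum_list ms = card L"
    using flower_card_verts[OF F] ms(1) by simp
  then have "cycle_bouquet (card (verts F)) ms = bouquet ms (card L)" by (simp add: cycle_bouquet_def)
  moreover have "card (Leaf ` {..<card L}) = card L" by (simp add: card_image inj_on_def)
  ultimately show thesis
    using flowers_isomorphic[OF F bouquet_flower[OF ms(2), of "card L"]] ms(1) that
      length_bouquet_petals[of ms] by metis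
qed

lemma flower_edges_in_verts:
  assumes "flower F h Ps L" shows "\<Union>(edges F) \<subseteq> verts F"
proof -
  have "\<Union>(edges F) = (\<Union>p\<in>set Ps. \<Union>(cycle_edges (h # p))) \<union> \<Union>((\<lambda>x. {h, x}) ` L)"
    using assms by (auto simp: flower_def)
  then show ?thesis using assms by (auto simp: flower_def Union_cycle_edges)
qed

lemma flower_leaf_edges:
  assumes "flower F h Ps L" "x \<in> L" "e \<in> edges F" "x \<in> e"
  shows "e = {h, x}"
proof -
  have "e \<notin> cycle_edges (h # p)" if "p \<in> set Ps" for p
  proof
    assume "e \<in> cycle_edges (h # p)"
    then have "x \<in> set (h # p)" using Union_cycle_edges[of "h # p"] assms(4) by blast
    then show False using assms(1,2) that by (auto simp: flower_def)
  qed
  then obtain y where "e = {h, y}" "x \<noteq> h"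
    using assms by (auto simp: flower_def)
  then show ?thesis using assms(4) by auto
qed

lemma flower_leaf_is_pendant:
  assumes F: "flower F h Ps L" and x: "x \<in> L"
  shows "pendant_vertex F x"
proof -
  have "{e \<in> edges F. x \<in> e} = {{h, x}}"
    using flower_leaf_edges[OF F x] F x by (auto simp: flower_def)
  then show ?thesis using F x by (auto simp: pendant_vertex_def flower_def)
qed

text \<open>Every vertex that is not a leaf lies on a cycle; for \<open>h\<close> this needs a petal.\<close>

lemma flower_pendant_is_leaf:
  assumes F: "flower F h Ps L" and Ps: "Ps \<noteq> []" and x: "pendant_vertex F x"
  shows "x \<in> L"
proof (rule ccontr)
  assume "x \<notin> L"
  have d: "distinct (h # concat Ps)" "\<forall>p\<in>set Ps. 2 \<le> length p"
    "verts F = set (h # concat Ps) \<union> L"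
    "edges F = (\<Union>p\<in>set Ps. cycle_edges (h # p)) \<union> (\<lambda>x. {h, x}) ` L"
    using F unfolding flower_def by blast+
  obtain p where p: "p \<in> set Ps" "x \<in> set (h # p)"
    using x \<open>x \<notin> L\<close> Ps d(3) by (cases Ps) (auto simp: pendant_vertex_def)
  have "distinct (h # p)" "3 \<le> length (h # p)" using d(1,2) p(1) by (auto simp: distinct_concat_iff)
  then obtain e f where ef: "e \<in> cycle_edges (h # p)" "f \<in> cycle_edges (h # p)" "x \<in> e" "x \<in> f" "e \<noteq> f"
    using cycle_two_edges p(2) by metis
  obtain g where "{e \<in> edges F. x \<in> e} = {g}" using x by (auto simp: pendant_vertex_def card_1_singleton_iff)
  moreover have "e \<in> {e \<in> edges F. x \<in> e}" "f \<in> {e \<in> edges F. x \<in> e}" using ef p(1) d(4) by auto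
  ultimately show False using ef(5) by auto
qed

lemma add_pendant_iso:
  assumes f: "inj_on f (verts F)" "image_graph f F = H" and w: "w \<notin> verts F" "w' \<notin> verts H"
    and p: "p \<in> verts F" and E: "\<Union>(edges F) \<subseteq> verts F"
  shows "graph_iso (add_pendant p w F) (add_pendant (f p) w' H)"
proof -
  define g where "g x = (if x = w then w' else f x)" for x
  have g: "g w = w'" by (simp add: g_def)
  have vH: "verts H = f ` verts F" and eH: "edges H = (`) f ` edges F"
    using f(2) verts_image_graph edges_image_graph by metis+
  have "g ` e = f ` e" if "e \<in> edges F" for e
  proof -
    have "w \<notin> e" using that E w(1) by blast
    then show ?thesis by (auto simp: g_def intro!: image_cong)
  qed
  then have "(`) g ` edges F = (`) f ` edges F" by (rule image_cong[OF refl])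
  moreover have gf: "g ` verts F = f ` verts F"
    using w(1) by (auto simp: g_def intro!: image_cong)
  moreover have "g p = f p" using p w(1) by (auto simp: g_def)
  ultimately have "image_graph g (add_pendant p w F) = add_pendant (f p) w' H"
    using g by (simp add: image_graph_def add_pendant_def vH eH)
  moreover have "g x = f x" if "x \<in> verts F" for x using that w(1) by (auto simp: g_def)
  then have "inj_on g (verts F)" using f(1) by (simp add: inj_on_def)
  then have "inj_on g (verts (add_pendant p w F))"
    using w gf g unfolding vH by (simp add: add_pendant_def)
  ultimately show ?thesis unfolding graph_iso_iff by blast
qed

section \<open>Excess of flowers\<close>

text \<open>
  The set \<open>X\<close> holds the edges of \<open>G\<close> beyond those of the flower, such as the edge that prolongs a
  leaf. As \<open>G\<close> has no more cycles than the flower has petals, the bridges are known.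
\<close>

lemma flower_cycles:
  assumes fl: "flower F h Ps L" and sG: "simple_graph G" and k: "card (cycles G) = length Ps"
    and V: "verts F \<subseteq> verts G" and E: "edges G = edges F \<union> X" and X: "\<Union>X \<inter> set (h # concat Ps) = {}"
  shows "cycles G = (\<lambda>p. cycle_edges (h # p)) ` set Ps" (is "_ = ?c ` _")
    "\<And>p. p \<in> set Ps \<Longrightarrow> end_cycle G (cycle_edges (h # p)) h \<and> card (cycle_edges (h # p)) = length p + 1"
    "inj_on (\<lambda>p. cycle_edges (h # p)) (set Ps)" "distinct Ps"
    "bridges G = (\<lambda>x. {h, x}) ` L \<union> X"
proof -
  have F: "distinct (h # concat Ps)" "\<forall>p\<in>set Ps. 2 \<le> length p" "finite L"
    "L \<inter> set (h # concat Ps) = {}" "verts F = set (h # concat Ps) \<union> L"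
    "edges F = (\<Union>p\<in>set Ps. cycle_edges (h # p)) \<union> (\<lambda>x. {h, x}) ` L"
    using fl unfolding flower_def by blast+
  have dp: "distinct (h # p)" "3 \<le> length (h # p)" "set p \<noteq> {}" if p: "p \<in> set Ps" for p
  proof -
    have "distinct p" using F(1) p by (auto simp: distinct_concat_iff)
    then show "distinct (h # p)" using F(1) p by auto
    have "2 \<le> length p" using F(2) p by blast
    then show "3 \<le> length (h # p)" "set p \<noteq> {}" by auto
  qed
  have disj: "set p \<inter> set q = {}" if "p \<in> set Ps" "q \<in> set Ps" "p \<noteq> q" for p q
    using F(1) that by (auto simp: distinct_concat_iff)
  have U: "\<Union>(?c p) = insert h (set p)" for p using Union_cycle_edges[of "h # p"] by simp
  have at: "e \<in> ?c p" if p: "p \<in> set Ps" and e: "e \<in> edges G" "y \<in> e" "y \<in> set p" for p e y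
  proof -
    have y: "y \<in> set (concat Ps)" "y \<noteq> h" using p e dp[OF p] by auto
    have "e \<notin> X" using X y e by auto
    moreover have "e \<notin> (\<lambda>x. {h, x}) ` L" using F(4) y e by auto
    ultimately obtain q where q: "q \<in> set Ps" "e \<in> ?c q" using e(1) E F(6) by blast
    then have "y \<in> set q" using U[of q] e(2) y by blast
    then have "q = p" using disj[OF q(1) p] e(3) by blast
    then show ?thesis using q by simp
  qed
  have cyc: "?c p \<in> cycles G" if p: "p \<in> set Ps" for p
  proof (rule cyclesI)
    show "3 \<le> length (h # p)" "distinct (h # p)" using dp[OF p] by auto
    show "set (h # p) \<subseteq> verts G" using V F(5) p by auto
    show "?c p \<subseteq> edges G" using E F(6) p by blast
  qed
  show end_c: "end_cycle G (?c p) h \<and> card (?c p) = length p + 1" if p: "p \<in> set Ps" for p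
    unfolding end_cycle_def U
    using cyc[OF p] at[OF p] card_cycle_edges[OF dp(1,2)[OF p]] by auto
  show inj: "inj_on ?c (set Ps)"
  proof (rule inj_onI)
    fix p q assume pq: "p \<in> set Ps" "q \<in> set Ps" "?c p = ?c q"
    then have "insert h (set p) = insert h (set q)" using U[of p] U[of q] by simp
    then have "set p = set q" using dp(1)[OF pq(1)] dp(1)[OF pq(2)] by auto
    then show "p = q" using disj[OF pq(1,2)] dp(3)[OF pq(1)] by auto
  qed
  show dPs: "distinct Ps"
  proof -
    have "[] \<notin> set Ps" using dp(3) by auto
    then have "removeAll [] Ps = Ps" by simp
    then show ?thesis using F(1) by (simp add: distinct_concat_iff)
  qed
  have "card (?c ` set Ps) = length Ps" using inj dPs by (simp add: card_image distinct_card)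
  then show cs: "cycles G = ?c ` set Ps"
    using cyc k by (intro card_subset_eq[symmetric] finite_cycles[OF sG]) auto
  have "e \<notin> \<Union>(cycles G)" if "e \<in> X" for e
  proof
    assume "e \<in> \<Union>(cycles G)"
    then obtain p where p: "p \<in> set Ps" "e \<in> ?c p" using cs by blast
    then have e: "e \<subseteq> set (h # concat Ps)" "e \<in> edges G" using U[of p] cyc cycles_sub_edges by fastforce+
    moreover have "e \<noteq> {}" using e(2) sG by (auto simp: simple_graph_def)
    ultimately show False using X that by blast
  qed
  moreover have "{h, x} \<notin> \<Union>(cycles G)" if "x \<in> L" for x
  proof
    assume "{h, x} \<in> \<Union>(cycles G)"
    then obtain p where p: "p \<in> set Ps" "{h, x} \<in> ?c p" using cs by blast
    then have "x \<in> set (h # concat Ps)" using U[of p] by auto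
    then show False using F(4) that by blast
  qed
  ultimately show "bridges G = (\<lambda>x. {h, x}) ` L \<union> X"
    unfolding bridges_def E F(6) cs by blast
qed

lemma total_excess_flower_tail:
  assumes G: "cactus G" and m: "card (edges G) = m" "15 < m" and k: "card (cycles G) = length Ps"
    and F: "flower F h Ps L" and p: "p \<in> L" and w: "w \<notin> verts F" and GF: "G = add_pendant p w F"
    and len: "\<forall>q\<in>set Ps. length q = 3"
  shows "total_excess G = 4 * real m - 8"
proof -
  have sG: "simple_graph G" using G by (simp add: cactus_def)
  have V: "verts F \<subseteq> verts G" and E: "edges G = edges F \<union> {{p, w}}" using GF by (auto simp: add_pendant_def)
  have hV: "set (h # concat Ps) \<subseteq> verts F" "L \<inter> set (h # concat Ps) = {}" "L \<subseteq> verts F"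
    using F unfolding flower_def by blast+
  have X: "\<Union>{{p, w}} \<inter> set (h # concat Ps) = {}" using hV w p by blast
  note fc = flower_cycles[OF F sG k V E X]
  have ph: "h \<noteq> p" "h \<noteq> w" "p \<noteq> w" using X hV p w by auto
  have at_w: "f = {p, w}" if "f \<in> edges G" "w \<in> f" for f
    using that E flower_edges_in_verts[OF F] w by blast
  have pw: "pendant_edge G {p, w} w" using at_w E by (auto simp: pendant_edge_def)
  have hx: "{h, x} \<in> edges F" if "x \<in> L" for x using F that by (auto simp: flower_def)
  have pend: "pendant_edge G {h, x} x" if x: "x \<in> L" "x \<noteq> p" for x
  proof -
    have "x \<noteq> w" using x(1) hV w by blast
    then have "f = {h, x}" if "f \<in> edges G" "x \<in> f" for f
      using that E flower_leaf_edges[OF F x(1), of f] x(2) by auto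
    then show ?thesis using hx[OF x(1)] E by (simp add: pendant_edge_def)
  qed
  have at_p: "f = {h, p} \<or> f = {p, w}" if "f \<in> edges G" "p \<in> f" for f
    using that E flower_leaf_edges[OF F p, of f] by blast
  have tail: "tail_edge G {h, p} p w"
    unfolding tail_edge_def using at_p hx[OF p] E ph pw by simp
  have zero: "excess G e = 0" if e: "e \<in> bridges G - {{h, p}}" for e
  proof -
    have "\<exists>x. pendant_edge G e x" using e pend pw unfolding fc(5) by blast
    then show ?thesis using bridge_excess_cases[OF G m(1), of e] m(2) e by auto
  qed
  have hp: "{h, p} \<in> bridges G" unfolding fc(5) using p by blast
  have "finite (bridges G)" using finite_edges[OF sG] by (simp add: bridges_def)
  then have "(\<Sum>e\<in>bridges G. excess G e) = excess G {h, p} + (\<Sum>e\<in>bridges G - {{h, p}}. excess G e)"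
    using hp by (rule sum.remove)
  also have "(\<Sum>e\<in>bridges G - {{h, p}}. excess G e) = 0" using zero by (rule sum.neutral[rule_format])
  finally have "(\<Sum>e\<in>bridges G. excess G e) = 4 * real m - 8" using tail_excess[OF G m(1) hp tail] by simp
  moreover have "cycle_excess G C = 0" if C: "C \<in> cycles G" for C
  proof -
    obtain q where q: "q \<in> set Ps" "C = cycle_edges (h # q)" using C fc(1) by auto
    show ?thesis
      by (rule quadrangle_excess(1)[OF G C m(1)]) (use fc(2)[OF q(1)] q len in auto)
  qed
  ultimately show ?thesis by (simp add: total_excess_def)
qed

lemma total_excess_flower_triangle:
  assumes G: "cactus G" and m: "card (edges G) = m" "15 < m" and k: "card (cycles G) = length (t # Ps)"
    and F: "flower G h (t # Ps) L" and len: "length t = 2" "\<forall>q\<in>set Ps. length q = 3"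
  shows "total_excess G = (real m - 3) * (real m - 15)"
proof -
  have sG: "simple_graph G" using G by (simp add: cactus_def)
  note fc = flower_cycles[OF F sG k, of "{}", simplified Union_empty Int_empty_left Un_empty_right, OF subset_refl refl refl]
  have pend: "pendant_edge G {h, x} x" if x: "x \<in> L" for x
    using flower_leaf_edges[OF F x] F x by (auto simp: pendant_edge_def flower_def)
  have "excess G e = 0" if e: "e \<in> bridges G" for e
  proof -
    have "\<exists>x. pendant_edge G e x" using e pend unfolding fc(5) by blast
    then show ?thesis using bridge_excess_cases[OF G m(1), of e] m(2) e by auto
  qed
  moreover have "(\<Sum>C\<in>cycles G. cycle_excess G C) = (real m - 3) * (real m - 15)"
  proof -
    have Ct: "cycle_edges (h # t) \<in> cycles G" using fc(1) by auto
    have zero: "cycle_excess G C = 0" if C: "C \<in> cycles G - {cycle_edges (h # t)}" for C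
    proof -
      obtain q where q: "q \<in> set Ps" "C = cycle_edges (h # q)" using C fc(1) by auto
      have CC: "C \<in> cycles G" using C by blast
      show ?thesis
        by (rule quadrangle_excess(1)[OF G CC m(1)]) (use fc(2)[of q] q len in auto)
    qed
    have "(\<Sum>C\<in>cycles G. cycle_excess G C)
      = cycle_excess G (cycle_edges (h # t)) + (\<Sum>C\<in>cycles G - {cycle_edges (h # t)}. cycle_excess G C)"
      using finite_cycles[OF sG] Ct by (rule sum.remove)
    also have "(\<Sum>C\<in>cycles G - {cycle_edges (h # t)}. cycle_excess G C) = 0"
      using zero by (rule sum.neutral[rule_format])
    also have "cycle_excess G (cycle_edges (h # t)) = (real m - 3) * (real m - 15)"
      by (rule triangle_excess(1)[OF G Ct m(1)]) (use fc(2)[of t] len in auto)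
    finally show ?thesis by simp
  qed
  ultimately show ?thesis by (simp add: total_excess_def)
qed

section \<open>The two smallest excesses\<close>

lemma total_excess_G1_star:
  assumes G: "cactus G" and m: "card (edges G) = m" "15 < m" and k: "card (cycles G) = k" "1 \<le> k"
    and star: "is_G1_star n k G"
  shows "total_excess G = 4 * real m - 8"
proof -
  have sG: "simple_graph G" using G by (simp add: cactus_def)
  let ?B = "C1 (n - 1) k" and ?ms = "replicate k (4::nat)"
  obtain p w where pw: "pendant_vertex ?B p" "w \<notin> verts ?B" "graph_iso G (add_pendant p w ?B)"
    using star by (auto simp: is_G1_star_def)
  obtain q where q: "?B = bouquet ?ms q" by (auto simp: C1_def cycle_bouquet_def)
  have "\<forall>x\<in>set ?ms. 3 \<le> x" by auto
  from bouquet_flower[OF this, of q] obtain Ps where fl: "flower ?B Hub Ps (Leaf ` {..<q})"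
    and len: "map length Ps = map (\<lambda>l. l - 1) ?ms"
    unfolding q using length_bouquet_petals[of ?ms] by blast
  have lPs: "length Ps = k" using len by (metis length_map length_replicate)
  have "set (map length Ps) \<subseteq> {3}" unfolding len by auto
  then have len3: "\<forall>x\<in>set Ps. length x = 3" by auto
  then have "Ps \<noteq> []" using lPs k(2) by auto
  then have p: "p \<in> Leaf ` {..<q}" by (rule flower_pendant_is_leaf[OF fl _ pw(1)])
  obtain g where g: "inj_on g (verts (add_pendant p w ?B))" "image_graph g (add_pendant p w ?B) = G"
    using graph_iso_inverse[OF sG pw(3)] .
  have gB: "inj_on g (verts ?B)" using g(1) by (auto simp: add_pendant_def intro: inj_on_subset)
  have gw: "g w \<notin> verts (image_graph g ?B)"
    using g(1) pw(2) by (auto simp: add_pendant_def verts_image_graph inj_on_def)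
  show ?thesis
    by (rule total_excess_flower_tail[OF G m _ flower_map[OF fl gB] _ gw])
      (use k lPs p g(2) len3 in \<open>auto simp: image_graph_add_pendant\<close>)
qed

lemma total_excess_triangle_bouquet:
  assumes G: "cactus G" and m: "card (edges G) = m" "15 < m" and k: "card (cycles G) = k" "1 \<le> k"
    and iso: "graph_iso G (cycle_bouquet n (3 # replicate (k - 1) 4))"
  shows "total_excess G = (real m - 3) * (real m - 15)"
proof -
  have sG: "simple_graph G" using G by (simp add: cactus_def)
  let ?ms = "3 # replicate (k - 1) (4::nat)"
  let ?B = "cycle_bouquet n ?ms"
  obtain q where q: "?B = bouquet ?ms q" by (auto simp: cycle_bouquet_def)
  have "\<forall>x\<in>set ?ms. 3 \<le> x" by auto
  from bouquet_flower[OF this, of q] obtain Ps where fl: "flower ?B Hub Ps (Leaf ` {..<q})"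
    and len: "map length Ps = map (\<lambda>l. l - 1) ?ms"
    unfolding q using length_bouquet_petals[of ?ms] by blast
  obtain g where g: "inj_on g (verts ?B)" "image_graph g ?B = G"
    using graph_iso_inverse[OF sG iso] .
  have G': "flower G (g Hub) (map (map g) Ps) (g ` Leaf ` {..<q})" using flower_map[OF fl g(1)] g(2) by simp
  have lPs: "length Ps = k" using len k(2) by (metis length_map length_replicate length_Cons Suc_pred' less_eq_Suc_le One_nat_def)
  obtain t Qs where Q: "map (map g) Ps = t # Qs" using lPs k(2) by (cases Ps) auto
  have "map length (map (map g) Ps) = map length Ps" by simp
  then have "length t # map length Qs = 2 # map (\<lambda>l. l - 1) (replicate (k - 1) (4::nat))"
    unfolding Q len by simp
  then have t: "length t = 2" and "set (map length Qs) \<subseteq> {3}" by auto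
  then have Qs: "\<forall>x\<in>set Qs. length x = 3" by auto
  have "card (cycles G) = length (t # Qs)" unfolding Q[symmetric] using k(1) lPs by simp
  then show ?thesis using total_excess_flower_triangle[OF G m _ G'[unfolded Q] t Qs] by blast
qed

lemma sum_ge_single:
  fixes f :: "'b \<Rightarrow> real"
  assumes "finite A" "\<forall>x\<in>A. 0 \<le> f x" "a \<in> A"
  shows "f a \<le> sum f A" "sum f A = f a \<Longrightarrow> x \<in> A \<Longrightarrow> x \<noteq> a \<Longrightarrow> f x = 0"
proof -
  have s: "sum f A = f a + sum f (A - {a})" using assms(1,3) by (rule sum.remove)
  have nn: "0 \<le> sum f (A - {a})" using assms(2) by (intro sum_nonneg) auto
  show "f a \<le> sum f A" using s nn by simp
  assume "sum f A = f a" "x \<in> A" "x \<noteq> a"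
  then have "sum f (A - {a}) = 0" using s by simp
  then show "f x = 0"
    using sum_nonneg_eq_0_iff[of "A - {a}" f] assms \<open>x \<in> A\<close> \<open>x \<noteq> a\<close> by auto
qed

lemma quadrangle_petals:
  assumes "\<And>C. C \<in> set Cs \<Longrightarrow> card C = 4" "length Cs = k"
  shows "map (\<lambda>C. card C - 1) Cs = map (\<lambda>l. l - 1) (replicate k 4)"
proof -
  have "map (\<lambda>C. card C - 1) Cs = map (\<lambda>_. 4 - 1) Cs"
    by (rule map_cong[OF refl]) (simp only: assms(1))
  then show ?thesis by (simp only: map_replicate_const map_replicate assms(2))
qed

text \<open>
  All bridges are then pendant and all cycles are quadrangles hanging at one vertex, so \<open>G\<close> is a
  flower with petals of length \<open>3\<close>.
\<close>

lemma excess_zero_C1: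
  assumes G: "cactus G" and m: "card (edges G) = m" "15 < m" and n: "card (verts G) = n"
    and k: "card (cycles G) = k" "1 \<le> k"
    and zb: "\<And>e. e \<in> bridges G \<Longrightarrow> excess G e = 0" and zc: "\<And>C. C \<in> cycles G \<Longrightarrow> cycle_excess G C = 0"
  shows "graph_iso G (C1 n k)"
proof -
  have sG: "simple_graph G" using G by (simp add: cactus_def)
  have T: "(real m - 3) * (real m - 15) > 0" using m(2) by simp
  have cyc: "card C = 4 \<and> (\<exists>h. end_cycle G C h)" if "C \<in> cycles G" for C
    using cycle_excess_cases[OF G m that] zc[OF that] T m(2) by auto
  have bri: "\<exists>x. pendant_edge G e x" if "e \<in> bridges G" for e
    using bridge_excess_cases[OF G m(1) _ that] zb[OF that] m(2) by auto
  obtain Cs where Cs: "set Cs = cycles G" "distinct Cs" using finite_distinct_list[OF finite_cycles[OF sG]] by blast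
  have lCs: "length Cs = k" using Cs k(1) distinct_card by metis
  then have "Cs \<noteq> []" using k(2) by auto
  then obtain h Ps L where fl: "flower G h Ps L" and len: "map length Ps = map (\<lambda>C. card C - 1) Cs"
    using cactus_is_flower[OF G Cs] cyc bri by metis
  have "map (\<lambda>C. card C - 1) Cs = map (\<lambda>l. l - 1) (replicate k 4)"
    by (rule quadrangle_petals[OF _ lCs]) (simp only: cyc Cs(1))
  then have len4: "map length Ps = map (\<lambda>l. l - 1) (replicate k 4)" using len by simp
  have four: "\<forall>x\<in>set (replicate k (4::nat)). 3 \<le> x" by simp
  obtain f where "inj_on f (verts G)" "image_graph f G = cycle_bouquet (card (verts G)) (replicate k 4)"
    by (rule flower_iso_bouquet[OF fl len4 four])
  then show ?thesis unfolding graph_iso_iff C1_def n by blast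
qed

text \<open>
  Some block has positive excess, as \<open>G\<close> is not the bouquet of quadrangles. For \<open>m \<ge> 20\<close> one has
  \<open>(m - 3) (m - 15) - (4 m - 8) = (m - 20) (m - 2) + 13\<close>, so that bridges with one edge beyond them
  are the cheapest choice. In the case of equality there is exactly one of them.
\<close>

lemma total_excess_tail_bound:
  assumes G: "cactus G" and m: "card (edges G) = m" "20 \<le> m" and n: "card (verts G) = n"
    and k: "card (cycles G) = k" "1 \<le> k" and nC1: "\<not> graph_iso G (C1 n k)"
  shows "total_excess G \<ge> 4 * real m - 8" "total_excess G = 4 * real m - 8 \<Longrightarrow> is_G1_star n k G"
proof -
  have sG: "simple_graph G" using G by (simp add: cactus_def)
  have m15: "15 < m" using m(2) by simp
  let ?T = "4 * real m - 8" and ?B = "sum (excess G) (bridges G)" and ?C = "sum (cycle_excess G) (cycles G)"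
  have finB: "finite (bridges G)" using finite_edges[OF sG] by (simp add: bridges_def)
  note finC = finite_cycles[OF sG]
  have "0 \<le> (real m - 20) * (real m - 2)" using m(2) by simp
  then have tri: "(real m - 3) * (real m - 15) > ?T" by (simp add: algebra_simps)
  have nnB: "\<forall>e\<in>bridges G. 0 \<le> excess G e" and nnC: "\<forall>C\<in>cycles G. 0 \<le> cycle_excess G C"
    using excess_nonneg[OF G m(1) m15] by blast+
  have B0: "0 \<le> ?B" "0 \<le> ?C" using nnB nnC by (auto intro: sum_nonneg)
  have bc: "excess G e = 0 \<and> (\<exists>x. pendant_edge G e x) \<or> (\<nexists>x. pendant_edge G e x) \<and>
      (excess G e = ?T \<and> (\<exists>p w. tail_edge G e p w) \<or> excess G e > ?T)" if "e \<in> bridges G" for e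
    using bridge_excess_cases[OF G m(1) _ that] m(2) by simp
  have cc: "cycle_excess G C = 0 \<and> card C = 4 \<and> (\<exists>h. end_cycle G C h) \<or> cycle_excess G C > ?T"
    if "C \<in> cycles G" for C
    using cycle_excess_cases[OF G m(1) m15 that] tri m(2) by auto
  have tot: "total_excess G = ?B + ?C" by (simp add: total_excess_def)
  have dich: "total_excess G > ?T \<or> (\<exists>e0\<in>bridges G. excess G e0 = ?T \<and> ?T \<le> total_excess G)"
  proof (cases "\<exists>C\<in>cycles G. cycle_excess G C \<noteq> 0")
    case True
    then obtain C where C: "C \<in> cycles G" "cycle_excess G C \<noteq> 0" by blast
    have "cycle_excess G C > ?T" using cc[OF C(1)] C(2) by blast
    also have "cycle_excess G C \<le> ?C" by (rule sum_ge_single(1)[OF finC nnC C(1)])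
    finally show ?thesis using B0 tot by simp
  next
    case False
    then obtain e where e: "e \<in> bridges G" "excess G e \<noteq> 0"
      using excess_zero_C1[OF G m(1) m15 n k] nC1 by blast
    have "excess G e \<le> ?B" by (rule sum_ge_single(1)[OF finB nnB e(1)])
    then show ?thesis using bc[OF e(1)] e B0 tot by fastforce
  qed
  then show "total_excess G \<ge> ?T" by auto
  assume eq: "total_excess G = ?T"
  then obtain e0 where e0: "e0 \<in> bridges G" "excess G e0 = ?T" using dich by auto
  have le: "?T \<le> ?B" using sum_ge_single(1)[OF finB nnB e0(1)] e0(2) by simp
  then have B: "?B = excess G e0" and C: "?C = 0" using eq tot B0 e0(2) by auto
  have zc: "cycle_excess G D = 0" if "D \<in> cycles G" for D
    using C sum_nonneg_eq_0_iff[of "cycles G" "cycle_excess G"] finC nnC that by simp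
  have cyc: "card D = 4 \<and> (\<exists>h. end_cycle G D h)" if "D \<in> cycles G" for D
    using cc[OF that] zc[OF that] m(2) by auto
  have zb: "\<exists>x. pendant_edge G e x" if "e \<in> bridges G" "e \<noteq> e0" for e
    using bc[OF that(1)] sum_ge_single(2)[OF finB nnB e0(1) B that] m(2) by auto
  have e0p: "\<nexists>x. pendant_edge G e0 x" and "\<exists>p w. tail_edge G e0 p w"
    using bc[OF e0(1)] e0(2) m(2) by auto
  then obtain p w where tail: "tail_edge G e0 p w" by blast
  obtain Cs where Cs: "set Cs = cycles G" "distinct Cs" using finite_distinct_list[OF finC] by blast
  have lCs: "length Cs = k" using Cs k(1) distinct_card by metis
  then have "Cs \<noteq> []" using k(2) by auto
  then obtain F h Ps L where fl: "flower F h Ps L" and len: "map length Ps = map (\<lambda>C. card C - 1) Cs"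
    and pw: "p \<in> L" "w \<notin> verts F" "G = add_pendant p w F"
    using cactus_is_flower_with_tail[OF G Cs _ _ zb e0(1) e0p tail] cyc by metis
  have "map (\<lambda>C. card C - 1) Cs = map (\<lambda>l. l - 1) (replicate k 4)"
    by (rule quadrangle_petals[OF _ lCs]) (simp only: cyc Cs(1))
  then have len4: "map length Ps = map (\<lambda>l. l - 1) (replicate k 4)" using len by simp
  have four: "\<forall>x\<in>set (replicate k (4::nat)). 3 \<le> x" by simp
  obtain f where f: "inj_on f (verts F)"
    "image_graph f F = cycle_bouquet (card (verts F)) (replicate k 4)"
    by (rule flower_iso_bouquet[OF fl len4 four])
  have "finite (verts F)" using sG pw(3) by (auto simp: simple_graph_def add_pendant_def)
  then have "n = card (verts F) + 1" using n pw(2,3) by (simp add: add_pendant_def)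
  then have fC: "image_graph f F = C1 (n - 1) k" using f(2) by (simp add: C1_def)
  have "flower (C1 (n - 1) k) (f h) (map (map f) Ps) (f ` L)" using flower_map[OF fl f(1)] fC by simp
  then have pend: "pendant_vertex (C1 (n - 1) k) (f p)" using pw(1) by (intro flower_leaf_is_pendant) auto
  have "finite (verts (C1 (n - 1) k))" using \<open>finite (verts F)\<close> fC by (metis finite_imageI verts_image_graph)
  moreover have "infinite (UNIV :: bvertex set)"
    using infinite_iff_countable_subset[of "UNIV :: bvertex set"] by (metis bvertex.inject(2) injI subset_UNIV)
  ultimately obtain w' where w': "w' \<notin> verts (C1 (n - 1) k)" using ex_new_if_finite by blast
  have "p \<in> verts F" using fl pw(1) by (auto simp: flower_def)
  then have "graph_iso G (add_pendant (f p) w' (C1 (n - 1) k))"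
    unfolding pw(3) using add_pendant_iso[OF f(1) fC pw(2) w'] flower_edges_in_verts[OF fl] by blast
  then show "is_G1_star n k G" unfolding is_G1_star_def using pend w' by blast
qed

text \<open>
  For \<open>15 < m \<le> 19\<close> the order is reversed: a triangle with everything else hanging at one vertex
  has the least positive excess, and in the case of equality exactly one such triangle occurs.
\<close>

lemma total_excess_triangle_bound:
  assumes G: "cactus G" and m: "card (edges G) = m" "15 < m" "m \<le> 19" and n: "card (verts G) = n"
    and k: "card (cycles G) = k" "1 \<le> k" and nC1: "\<not> graph_iso G (C1 n k)"
  shows "total_excess G \<ge> (real m - 3) * (real m - 15)"
    "total_excess G = (real m - 3) * (real m - 15) \<Longrightarrow>
      graph_iso G (cycle_bouquet n (3 # replicate (k - 1) 4))"
proof -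
  have sG: "simple_graph G" using G by (simp add: cactus_def)
  let ?T = "(real m - 3) * (real m - 15)"
  let ?B = "sum (excess G) (bridges G)" and ?C = "sum (cycle_excess G) (cycles G)"
  have finB: "finite (bridges G)" using finite_edges[OF sG] by (simp add: bridges_def)
  note finC = finite_cycles[OF sG]
  have Tpos: "?T > 0" using m(2) by simp
  \<comment> \<open>The four values of \<open>m\<close> are compared one by one.\<close>
  have "m = 16 \<or> m = 17 \<or> m = 18 \<or> m = 19" using m by linarith
  then have T: "?T < 4 * real m - 8" "?T < 8 * real m - 40" by auto
  have nnB: "\<forall>e\<in>bridges G. 0 \<le> excess G e" and nnC: "\<forall>C\<in>cycles G. 0 \<le> cycle_excess G C"
    using excess_nonneg[OF G m(1,2)] by blast+
  have B0: "0 \<le> ?B" "0 \<le> ?C" using nnB nnC by (auto intro: sum_nonneg)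
  have bc: "excess G e = 0 \<and> (\<exists>x. pendant_edge G e x) \<or> excess G e > ?T" if "e \<in> bridges G" for e
    using bridge_excess_cases[OF G m(1) _ that] m(2) T by auto
  have cc: "cycle_excess G C = 0 \<and> card C = 4 \<and> (\<exists>h. end_cycle G C h) \<or>
      cycle_excess G C = ?T \<and> card C = 3 \<and> (\<exists>h. end_cycle G C h) \<or> cycle_excess G C > ?T"
    if "C \<in> cycles G" for C
    using cycle_excess_cases[OF G m(1,2) that] T by auto
  have tot: "total_excess G = ?B + ?C" by (simp add: total_excess_def)
  have dich: "total_excess G > ?T \<or> (\<exists>C\<in>cycles G. cycle_excess G C = ?T \<and> ?T \<le> total_excess G)"
  proof (cases "\<exists>e\<in>bridges G. excess G e \<noteq> 0")
    case True
    then obtain e where e: "e \<in> bridges G" "excess G e \<noteq> 0" by blast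
    have "excess G e > ?T" using bc[OF e(1)] e(2) by blast
    also have "excess G e \<le> ?B" by (rule sum_ge_single(1)[OF finB nnB e(1)])
    finally show ?thesis using B0 tot by simp
  next
    case False
    then obtain C where C: "C \<in> cycles G" "cycle_excess G C \<noteq> 0"
      using excess_zero_C1[OF G m(1,2) n k] nC1 by blast
    have "cycle_excess G C \<le> ?C" by (rule sum_ge_single(1)[OF finC nnC C(1)])
    then show ?thesis using cc[OF C(1)] C B0 tot by fastforce
  qed
  then show "total_excess G \<ge> ?T" by auto
  assume eq: "total_excess G = ?T"
  then obtain C0 where C0: "C0 \<in> cycles G" "cycle_excess G C0 = ?T" using dich by auto
  have le: "?T \<le> ?C" using sum_ge_single(1)[OF finC nnC C0(1)] C0(2) by simp
  then have C: "?C = cycle_excess G C0" and B: "?B = 0" using eq tot B0 C0(2) by auto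
  have "excess G e = 0" if "e \<in> bridges G" for e
    using B sum_nonneg_eq_0_iff[of "bridges G" "excess G"] finB nnB that by simp
  then have bri: "\<exists>x. pendant_edge G e x" if "e \<in> bridges G" for e
    using bc[OF that] that Tpos by auto
  have c0: "card C0 = 3 \<and> (\<exists>h. end_cycle G C0 h)" using cc[OF C0(1)] C0(2) Tpos by auto
  have c: "card D = 4 \<and> (\<exists>h. end_cycle G D h)" if "D \<in> cycles G" "D \<noteq> C0" for D
    using cc[OF that(1)] sum_ge_single(2)[OF finC nnC C0(1) C that] Tpos by auto
  have cyc: "\<exists>h. end_cycle G D h" if "D \<in> cycles G" for D using c0 c[OF that] by blast
  obtain Ds where Ds: "set Ds = cycles G - {C0}" "distinct Ds"
    using finite_distinct_list[of "cycles G - {C0}"] finC by blast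
  have Cs: "set (C0 # Ds) = cycles G" "distinct (C0 # Ds)" "C0 # Ds \<noteq> []" using Ds C0(1) by auto
  have "length (C0 # Ds) = k" using distinct_card[OF Cs(2)] Cs(1) k(1) by simp
  then have lDs: "length Ds = k - 1" by simp
  obtain h Ps L where fl: "flower G h Ps L" and len: "map length Ps = map (\<lambda>C. card C - 1) (C0 # Ds)"
    using cactus_is_flower[OF G Cs cyc bri] by metis
  have "map (\<lambda>C. card C - 1) Ds = map (\<lambda>l. l - 1) (replicate (k - 1) 4)"
  proof (rule quadrangle_petals[OF _ lDs])
    fix D assume "D \<in> set Ds"
    then show "card D = 4" using c[of D] unfolding Ds(1) by simp
  qed
  then have len': "map length Ps = map (\<lambda>l. l - 1) (3 # replicate (k - 1) 4)" using len c0 by simp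
  have three: "\<forall>x\<in>set (3 # replicate (k - 1) (4::nat)). 3 \<le> x" by auto
  obtain f where "inj_on f (verts G)"
    "image_graph f G = cycle_bouquet (card (verts G)) (3 # replicate (k - 1) 4)"
    by (rule flower_iso_bouquet[OF fl len' three])
  then show "graph_iso G (cycle_bouquet n (3 # replicate (k - 1) 4))"
    unfolding graph_iso_iff n by blast
qed

theorem theorem4p4:
  fixes G :: "'a sgraph" and n k m :: nat
  assumes "k \<ge> 1"
    and "G \<in> cacti n k"
    and "\<not> graph_iso G (C1 n k)"
    and "card (edges G) = m"
    and "m > 15"
    and "m > 4 * k"
  shows "(m \<ge> 20 \<longrightarrow>
            edge_revised_Szeged G \<ge>
              (2 * real m ^ 2 + 3 * real m + 4 * real k * (6 * real m - 15) - 8) / 4 \<and>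
            (edge_revised_Szeged G =
              (2 * real m ^ 2 + 3 * real m + 4 * real k * (6 * real m - 15) - 8) / 4
              \<longleftrightarrow> is_G1_star n k G)) \<and>
         (15 < m \<and> m \<le> 19 \<longrightarrow>
            edge_revised_Szeged G \<ge>
              (3 * real m ^ 2 - 19 * real m + 4 * real k * (6 * real m - 15) + 45) / 4 \<and>
            (edge_revised_Szeged G =
              (3 * real m ^ 2 - 19 * real m + 4 * real k * (6 * real m - 15) + 45) / 4
              \<longleftrightarrow> graph_iso G (cycle_bouquet n (3 # replicate (k - 1) 4))))"
proof -
  have G: "cactus G" and n: "card (verts G) = n" and k: "card (cycles G) = k"
    using assms(2) by (auto simp: cacti_def)
  have Sz: "edge_revised_Szeged G
      = (2 * real m ^ 2 - real m + 4 * real k * (6 * real m - 15) + total_excess G) / 4"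
    using Szeged_excess[OF G assms(4) k] by (simp add: total_excess_def)
  have T: "(real m - 3) * (real m - 15) = real m ^ 2 - 18 * real m + 45"
    by (simp add: power2_eq_square algebra_simps)
  have "total_excess G \<ge> 4 * real m - 8 \<and> (total_excess G = 4 * real m - 8 \<longleftrightarrow> is_G1_star n k G)"
    if "20 \<le> m"
    using total_excess_tail_bound[OF G assms(4) that n k assms(1,3)]
      total_excess_G1_star[OF G assms(4,5) k assms(1)] by blast
  moreover have "total_excess G \<ge> real m ^ 2 - 18 * real m + 45 \<and>
      (total_excess G = real m ^ 2 - 18 * real m + 45 \<longleftrightarrow>
        graph_iso G (cycle_bouquet n (3 # replicate (k - 1) 4)))"
    if "m \<le> 19"
    using total_excess_triangle_bound[OF G assms(4,5) that n k assms(1,3)]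
      total_excess_triangle_bouquet[OF G assms(4,5) k assms(1)] unfolding T by blast
  ultimately show ?thesis unfolding Sz by (auto simp: field_simps)
qed

end
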